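(* Let $A$ be a sequence algebra and let $X\in\overline{\mathcal H}$. Then $X$ is extremely projective with respect to $\overline{\mathcal H}$ if and only if for every $n\in\mathbb N$ the coordinate subspace $X_n$ is isometrically isomorphic to $l_1(\Lambda_n)$ for some index set $\Lambda_n$ (equivalently, each $X_n$ is extremely projective in $\mathbf{Ban}$).
   Context: All normed algebras and modules are contractive: $\|ab\|\le\|a\|\|b\|$ and $\|a\cdot x\|\le\|a\|\|x\|$; morphisms are bounded $A$-module maps. A morphism $\tau:Y\to X$ is coisometric if $\|\tau\|\le1$ and for every $x\in X$, $\varepsilon>0$ there is $y\in Y$ with $\tau(y)=x$, $\|y\|<\|x\|+\varepsilon$. A lifting of $\varphi:P\to X$ with respect to $\tau:Y\to X$ is a morphism $\psi:P\to Y$ with $\tau\psi=\varphi$. For a full subcategory $\mathcal K$ of normed $A$-modules, $P$ is extremely projective with respect to $\mathcal K$ if for every coisometric morphism $\tau:Y\to X$ with $X,Y\in\mathcal K$, every bounded morphism $\varphi:P\to X$ and every $\varepsilon>0$ there is a lifting $\psi$ with $\|\psi\|<\|\varphi\|+\varepsilon$. A Banach space is extremely projective in $\mathbf{Ban}$ if it is extremely projective with respect to the category of Banach spaces (over $A=\mathbb C$). A sequence algebra is a normed algebra of complex sequences with coordinatewise operations that contains $c_{00}$ (finite sequences) as a dense subalgebra and with $\|\mathbf p^n\|=1$, where $\mathbf p^n$ has $1$ in place $n$ and $0$ elsewhere. For an $A$-module $X$, $x_n:=\mathbf p^n\cdot x$ and $X_n:=\{\mathbf p^n\cdot x:x\in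 X\}$. $X$ is essential if the closed linear span of $\{a\cdot x\}$ is $X$; homogeneous if $\|x_n\|\le\|y_n\|$ for all $n$ implies $\|x\|\le\|y\|$. $\overline{\mathcal H}$ is the full subcategory of essential homogeneous Banach (complete) $A$-modules. *)

theory Defs
  imports "HOL-Analysis.Analysis"
begin

text \<open>A (complex) normed space / normed module is given by a carrier set inside an
ambient type together with explicit operations.  The field mact is the module action of
sequences (elements of the algebra A, which are complex sequences).\<close>

record 'v nmod =
  mcarr :: "'v set"
  mzero :: 'v
  madd :: "'v \<Rightarrow> 'v \<Rightarrow> 'v"
  msmul :: "complex \<Rightarrow> 'v \<Rightarrow> 'v"
  mnorm :: "'v \<Rightarrow> real"
  mact :: "(nat \<Rightarrow> complex) \<Rightarrow> 'v \<Rightarrow> 'v"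

definition msub :: "'v nmod \<Rightarrow> 'v \<Rightarrow> 'v \<Rightarrow> 'v" where
  "msub V x y = madd V x (msmul V (-1) y)"

definition cnormed_space :: "'v nmod \<Rightarrow> bool" where
  "cnormed_space V \<longleftrightarrow>
     mzero V \<in> mcarr V \<and>
     (\<forall>x\<in>mcarr V. \<forall>y\<in>mcarr V. madd V x y \<in> mcarr V) \<and>
     (\<forall>c. \<forall>x\<in>mcarr V. msmul V c x \<in> mcarr V) \<and>
     (\<forall>x\<in>mcarr V. \<forall>y\<in>mcarr V. \<forall>z\<in>mcarr V. madd V (madd V x y) z = madd V x (madd V y z)) \<and>
     (\<forall>x\<in>mcarr V. \<forall>y\<in>mcarr V. madd V x y = madd V y x) \<and>
     (\<forall>x\<in>mcarr V. madd V x (mzero V) = x) \<and>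
     (\<forall>x\<in>mcarr V. madd V x (msmul V (-1) x) = mzero V) \<and>
     (\<forall>x\<in>mcarr V. msmul V 1 x = x) \<and>
     (\<forall>a b. \<forall>x\<in>mcarr V. msmul V a (msmul V b x) = msmul V (a * b) x) \<and>
     (\<forall>a b. \<forall>x\<in>mcarr V. msmul V (a + b) x = madd V (msmul V a x) (msmul V b x)) \<and>
     (\<forall>a. \<forall>x\<in>mcarr V. \<forall>y\<in>mcarr V. msmul V a (madd V x y) = madd V (msmul V a x) (msmul V a y)) \<and>
     (\<forall>x\<in>mcarr V. 0 \<le> mnorm V x) \<and>
     (\<forall>x\<in>mcarr V. mnorm V x = 0 \<longleftrightarrow> x = mzero V) \<and>
     (\<forall>c. \<forall>x\<in>mcarr V. mnorm V (msmul V c x) = cmod c * mnorm V x) \<and>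
     (\<forall>x\<in>mcarr V. \<forall>y\<in>mcarr V. mnorm V (madd V x y) \<le> mnorm V x + mnorm V y)"

definition mod_complete :: "'v nmod \<Rightarrow> bool" where
  "mod_complete V \<longleftrightarrow>
     (\<forall>s. (\<forall>k. s k \<in> mcarr V) \<longrightarrow>
          (\<forall>e>0. \<exists>N::nat. \<forall>m\<ge>N. \<forall>k\<ge>N. mnorm V (msub V (s m) (s k)) < e) \<longrightarrow>
          (\<exists>l\<in>mcarr V. \<forall>e>0. \<exists>N::nat. \<forall>k\<ge>N. mnorm V (msub V (s k) l) < e))"

definition banach_space :: "'v nmod \<Rightarrow> bool" where
  "banach_space V \<longleftrightarrow> cnormed_space V \<and> mod_complete V"

definition pseq :: "nat \<Rightarrow> nat \<Rightarrow> complex" where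
  "pseq n = (\<lambda>k. if k = n then 1 else 0)"

definition c00 :: "(nat \<Rightarrow> complex) set" where
  "c00 = {a. finite {k. a k \<noteq> 0}}"

definition seq_algebra :: "(nat \<Rightarrow> complex) set \<Rightarrow> ((nat \<Rightarrow> complex) \<Rightarrow> real) \<Rightarrow> bool" where
  "seq_algebra A nA \<longleftrightarrow>
     (\<lambda>k. 0) \<in> A \<and>
     (\<forall>a\<in>A. \<forall>b\<in>A. (\<lambda>k. a k + b k) \<in> A) \<and>
     (\<forall>a\<in>A. \<forall>b\<in>A. (\<lambda>k. a k * b k) \<in> A) \<and>
     (\<forall>c. \<forall>a\<in>A. (\<lambda>k. c * a k) \<in> A) \<and>
     (\<forall>a\<in>A. 0 \<le> nA a) \<and>
     (\<forall>a\<in>A. nA a = 0 \<longleftrightarrow> a = (\<lambda>k. 0)) \<and>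
     (\<forall>c. \<forall>a\<in>A. nA (\<lambda>k. c * a k) = cmod c * nA a) \<and>
     (\<forall>a\<in>A. \<forall>b\<in>A. nA (\<lambda>k. a k + b k) \<le> nA a + nA b) \<and>
     (\<forall>a\<in>A. \<forall>b\<in>A. nA (\<lambda>k. a k * b k) \<le> nA a * nA b) \<and>
     c00 \<subseteq> A \<and>
     (\<forall>a\<in>A. \<forall>e>0. \<exists>b\<in>c00. nA (\<lambda>k. a k - b k) < e) \<and>
     (\<forall>n. nA (pseq n) = 1)"

definition normed_module ::
  "(nat \<Rightarrow> complex) set \<Rightarrow> ((nat \<Rightarrow> complex) \<Rightarrow> real) \<Rightarrow> 'v nmod \<Rightarrow> bool" where
  "normed_module A nA X \<longleftrightarrow>
     cnormed_space X \<and>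
     (\<forall>a\<in>A. \<forall>x\<in>mcarr X. mact X a x \<in> mcarr X) \<and>
     (\<forall>a\<in>A. \<forall>x\<in>mcarr X. \<forall>y\<in>mcarr X. mact X a (madd X x y) = madd X (mact X a x) (mact X a y)) \<and>
     (\<forall>a\<in>A. \<forall>c. \<forall>x\<in>mcarr X. mact X a (msmul X c x) = msmul X c (mact X a x)) \<and>
     (\<forall>a\<in>A. \<forall>b\<in>A. \<forall>x\<in>mcarr X. mact X (\<lambda>k. a k + b k) x = madd X (mact X a x) (mact X b x)) \<and>
     (\<forall>a\<in>A. \<forall>c. \<forall>x\<in>mcarr X. mact X (\<lambda>k. c * a k) x = msmul X c (mact X a x)) \<and>
     (\<forall>a\<in>A. \<forall>b\<in>A. \<forall>x\<in>mcarr X. mact X a (mact X b x) = mact X (\<lambda>k. a k * b k) x) \<and>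
     (\<forall>a\<in>A. \<forall>x\<in>mcarr X. mnorm X (mact X a x) \<le> nA a * mnorm X x)"

inductive_set mspan :: "'v nmod \<Rightarrow> 'v set \<Rightarrow> 'v set" for V S where
  span_zero: "mzero V \<in> mspan V S"
| span_base: "s \<in> S \<Longrightarrow> s \<in> mspan V S"
| span_add: "x \<in> mspan V S \<Longrightarrow> y \<in> mspan V S \<Longrightarrow> madd V x y \<in> mspan V S"
| span_smul: "x \<in> mspan V S \<Longrightarrow> msmul V c x \<in> mspan V S"

definition essential :: "(nat \<Rightarrow> complex) set \<Rightarrow> 'v nmod \<Rightarrow> bool" where
  "essential A X \<longleftrightarrow>
     (\<forall>x\<in>mcarr X. \<forall>e>0. \<exists>y\<in>mspan X {mact X a z | a z. a \<in> A \<and> z \<in> mcarr X}.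
        mnorm X (msub X x y) < e)"

definition homogeneous :: "'v nmod \<Rightarrow> bool" where
  "homogeneous X \<longleftrightarrow>
     (\<forall>x\<in>mcarr X. \<forall>y\<in>mcarr X.
        (\<forall>n. mnorm X (mact X (pseq n) x) \<le> mnorm X (mact X (pseq n) y)) \<longrightarrow> mnorm X x \<le> mnorm X y)"

definition Hbar :: "(nat \<Rightarrow> complex) set \<Rightarrow> ((nat \<Rightarrow> complex) \<Rightarrow> real) \<Rightarrow> 'v nmod set" where
  "Hbar A nA = {X. normed_module A nA X \<and> mod_complete X \<and> essential A X \<and> homogeneous X}"

definition morphism ::
  "(nat \<Rightarrow> complex) set \<Rightarrow> 'v nmod \<Rightarrow> 'w nmod \<Rightarrow> ('v \<Rightarrow> 'w) \<Rightarrow> bool" where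
  "morphism A X Y f \<longleftrightarrow>
     (\<forall>x\<in>mcarr X. f x \<in> mcarr Y) \<and>
     (\<forall>x\<in>mcarr X. \<forall>y\<in>mcarr X. f (madd X x y) = madd Y (f x) (f y)) \<and>
     (\<forall>c. \<forall>x\<in>mcarr X. f (msmul X c x) = msmul Y c (f x)) \<and>
     (\<forall>a\<in>A. \<forall>x\<in>mcarr X. f (mact X a x) = mact Y a (f x)) \<and>
     (\<exists>C. \<forall>x\<in>mcarr X. mnorm Y (f x) \<le> C * mnorm X x)"

definition opnorm :: "'v nmod \<Rightarrow> 'w nmod \<Rightarrow> ('v \<Rightarrow> 'w) \<Rightarrow> real" where
  "opnorm X Y f = Inf {C. 0 \<le> C \<and> (\<forall>x\<in>mcarr X. mnorm Y (f x) \<le> C * mnorm X x)}"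

definition coisometric ::
  "(nat \<Rightarrow> complex) set \<Rightarrow> 'v nmod \<Rightarrow> 'w nmod \<Rightarrow> ('v \<Rightarrow> 'w) \<Rightarrow> bool" where
  "coisometric A Y X t \<longleftrightarrow>
     morphism A Y X t \<and> opnorm Y X t \<le> 1 \<and>
     (\<forall>x\<in>mcarr X. \<forall>e>0. \<exists>y\<in>mcarr Y. t y = x \<and> mnorm Y y < mnorm X x + e)"

definition ext_proj_wrt ::
  "(nat \<Rightarrow> complex) set \<Rightarrow> 'u nmod set \<Rightarrow> 'p nmod \<Rightarrow> bool" where
  "ext_proj_wrt A K P \<longleftrightarrow>
     (\<forall>X\<in>K. \<forall>Y\<in>K. \<forall>t \<phi>. \<forall>e>0.
        coisometric A Y X t \<longrightarrow> morphism A P X \<phi> \<longrightarrow>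
        (\<exists>\<psi>. morphism A P Y \<psi> \<and> (\<forall>x\<in>mcarr P. t (\<psi> x) = \<phi> x) \<and>
              opnorm P Y \<psi> < opnorm P X \<phi> + e))"

definition coord_space :: "'v nmod \<Rightarrow> nat \<Rightarrow> 'v nmod" where
  "coord_space X n = X\<lparr>mcarr := mact X (pseq n) ` mcarr X\<rparr>"

text \<open>l1(Lambda), realised as complex functions on the ambient index type vanishing off Lambda.
(The module action is irrelevant; we only regard it as a Banach space.)\<close>
definition l1space :: "'i set \<Rightarrow> ('i \<Rightarrow> complex) nmod" where
  "l1space L = \<lparr>mcarr = {f. (\<forall>i. i \<notin> L \<longrightarrow> f i = 0) \<and> (\<lambda>i. norm (f i)) summable_on L},
                mzero = (\<lambda>i. 0),
                madd = (\<lambda>f g i. f i + g i),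
                msmul = (\<lambda>c f i. c * f i),
                mnorm = (\<lambda>f. infsum (\<lambda>i. norm (f i)) L),
                mact = (\<lambda>a f. f)\<rparr>"

definition isometric_iso :: "'v nmod \<Rightarrow> 'w nmod \<Rightarrow> bool" where
  "isometric_iso V W \<longleftrightarrow>
     (\<exists>T. bij_betw T (mcarr V) (mcarr W) \<and>
        (\<forall>x\<in>mcarr V. \<forall>y\<in>mcarr V. T (madd V x y) = madd W (T x) (T y)) \<and>
        (\<forall>c. \<forall>x\<in>mcarr V. T (msmul V c x) = msmul W c (T x)) \<and>
        (\<forall>x\<in>mcarr V. mnorm W (T x) = mnorm V x))"

end

theory Submission
  imports Defs
begin

text \<open>
  Necessity rests on Grothendieck's theorem. If \<open>E = X\<^sub>n\<close> is extremely projective, its identity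
  factors through \<open>l\<^sub>1(S)\<close>, \<open>S\<close> the unit sphere, with constants arbitrarily close to \<open>1\<close>. Such a
  factorization yields rank-one operators \<open>f \<otimes> x\<close> on \<open>E\<close> with
  \<open>|f(y)| + \<parallel>y - f(y)x\<parallel> \<le> (1 + \<epsilon>)\<parallel>y\<parallel>\<close>; successive improvement makes them converge to exact
  \<open>l\<^sub>1\<close>-summands of dimension one. Two of these are either proportional or annihilate each other, so
  they span an isometric \<open>l\<^sub>1(\<Lambda>)\<close>; and near every point where a functional almost attains its norm
  there is such a summand, so no functional can show that the span is smaller than \<open>E\<close>.

  For sufficiency, liftings on the \<open>l\<^sub>1\<close>-bases of the \<open>X\<^sub>n\<close> are glued. By homogeneity an element of
  an essential homogeneous module is determined by its coordinates, and the norm of the glued element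
  is controlled by lifting a suitable element of the target module.
\<close>

section \<open>Complex Banach spaces\<close>

text \<open>In l1(Lambda) the basis vectors, up to unimodular scalars, are the extreme points of the
  unit ball. The ball of \<open>E\<close> is not known to have any, and factorizations for different
  constants are unrelated to one another, so nothing converges by compactness. Near-maximisers
  replace extreme points, and the convergence of the functionals has to come from the inequality
  itself: it forces almost summands with nearby vectors to have nearby functionals. Norming
  functionals are read off a factorization by turning the phases of its coefficients.

  In the gluing, additive errors in infinitely many coordinates could not be absorbed, because
  homogeneity compares norms coordinate by coordinate. Hence every coordinate lifting is bounded by
  one common factor \<open>\<kappa> > 1\<close> times the norm of the morphism on that single
  coordinate space, and only at the end is \<open>\<kappa>\<close> chosen close to 1.\<close>

class complex_banach = banach +
  fixes cscale :: "complex \<Rightarrow> 'a \<Rightarrow> 'a" (infixr "*\<^sub>C" 75)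
  assumes cscale_add_right: "c *\<^sub>C (x + y) = c *\<^sub>C x + c *\<^sub>C y"
    and cscale_add_left: "(c + d) *\<^sub>C x = c *\<^sub>C x + d *\<^sub>C x"
    and cscale_cscale: "c *\<^sub>C d *\<^sub>C x = (c * d) *\<^sub>C x"
    and cscale_of_real: "complex_of_real r *\<^sub>C x = r *\<^sub>R x"
    and norm_cscale: "norm (c *\<^sub>C x) = cmod c * norm x"

lemma cscale_one [simp]: "1 *\<^sub>C x = (x::_::complex_banach)"
  using cscale_of_real[of 1 x] by simp

lemma cscale_zero_left [simp]: "0 *\<^sub>C x = (0::_::complex_banach)"
  using cscale_of_real[of 0 x] by simp

lemma cscale_zero_right [simp]: "c *\<^sub>C 0 = (0::_::complex_banach)"
  using cscale_add_right[of c 0 0] by simp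

lemma cscale_minus_one: "(- 1) *\<^sub>C x = - x"
  using cscale_of_real[of "-1" x] by simp

lemma cscale_minus_right: "c *\<^sub>C (- x) = - (c *\<^sub>C x)"
  using cscale_add_right[of c x "-x"] by (simp add: eq_neg_iff_add_eq_0 add.commute)

lemma cscale_minus_left: "(- c) *\<^sub>C x = - (c *\<^sub>C x)"
  using cscale_add_left[of c "-c" x] by (simp add: eq_neg_iff_add_eq_0 add.commute)

lemma cscale_diff_right: "c *\<^sub>C (x - y) = c *\<^sub>C x - c *\<^sub>C y"
  using cscale_add_right[of c x "-y"] by (simp add: cscale_minus_right)

lemma cscale_diff_left: "(c - d) *\<^sub>C x = c *\<^sub>C x - d *\<^sub>C x"
  using cscale_add_left[of c "-d" x] by (simp add: cscale_minus_left)

lemma bounded_bilinear_cscale: "bounded_bilinear (\<lambda>c x::'a::complex_banach. c *\<^sub>C x)"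
proof
  show "(r *\<^sub>R c) *\<^sub>C x = r *\<^sub>R c *\<^sub>C x" for r c and x :: 'a
    by (simp add: cscale_cscale scaleR_conv_of_real flip: cscale_of_real)
  show "c *\<^sub>C r *\<^sub>R x = r *\<^sub>R c *\<^sub>C x" for r c and x :: 'a
    by (simp add: cscale_cscale mult.commute flip: cscale_of_real)
  show "\<exists>K. \<forall>c x. norm (c *\<^sub>C (x::'a)) \<le> cmod c * norm x * K"
    by (rule exI[of _ 1]) (simp add: norm_cscale)
qed (rule cscale_add_right cscale_add_left)+

lemmas tendsto_cscale = bounded_bilinear.tendsto[OF bounded_bilinear_cscale]
lemmas bounded_linear_cscale_left = bounded_bilinear.bounded_linear_left[OF bounded_bilinear_cscale]
lemmas bounded_linear_cscale_right = bounded_bilinear.bounded_linear_right[OF bounded_bilinear_cscale]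

lemma has_sum_diff:
  fixes f g :: "'i \<Rightarrow> 'a::real_normed_vector"
  assumes "(f has_sum a) A" "(g has_sum b) A"
  shows "((\<lambda>x. f x - g x) has_sum (a - b)) A"
proof -
  have "((\<lambda>x. - g x) has_sum - b) A" using assms(2) by (simp add: has_sum_uminus)
  from has_sum_add[OF assms(1) this] show ?thesis by simp
qed

section \<open>Subspaces and the functionals on them\<close>

definition csubspace :: "'a::complex_banach set \<Rightarrow> bool" where
  "csubspace E \<longleftrightarrow> 0 \<in> E \<and> (\<forall>x\<in>E. \<forall>y\<in>E. x + y \<in> E) \<and> (\<forall>c. \<forall>x\<in>E. c *\<^sub>C x \<in> E)"

text \<open>Everything is relative to \<open>E\<close>: values elsewhere are arbitrary, so a
  functional built from data on \<open>E\<close> need not be extended to the ambient type.\<close>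

definition cfunctional :: "'a::complex_banach set \<Rightarrow> ('a \<Rightarrow> complex) \<Rightarrow> bool" where
  "cfunctional E f \<longleftrightarrow>
     (\<forall>x\<in>E. \<forall>y\<in>E. f (x + y) = f x + f y) \<and>
     (\<forall>c. \<forall>x\<in>E. f (c *\<^sub>C x) = c * f x) \<and>
     (\<exists>C. \<forall>x\<in>E. cmod (f x) \<le> C * norm x)"

context
  fixes E :: "'a::complex_banach set"
  assumes E: "csubspace E"
begin

lemma csubspace_0: "0 \<in> E"
  and csubspace_add: "x \<in> E \<Longrightarrow> y \<in> E \<Longrightarrow> x + y \<in> E"
  and csubspace_cscale: "x \<in> E \<Longrightarrow> c *\<^sub>C x \<in> E"
  using E unfolding csubspace_def by auto

lemma csubspace_scaleR: "x \<in> E \<Longrightarrow> r *\<^sub>R x \<in> E"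
  using csubspace_cscale[of x "complex_of_real r"] by (simp add: cscale_of_real)

lemma csubspace_diff: "x \<in> E \<Longrightarrow> y \<in> E \<Longrightarrow> x - y \<in> E"
  using csubspace_add[OF _ csubspace_cscale, of x y "-1"] by (simp add: cscale_minus_one)

lemma csubspace_sum: "(\<And>i. i \<in> F \<Longrightarrow> h i \<in> E) \<Longrightarrow> sum h F \<in> E"
  by (induction F rule: infinite_finite_induct) (auto simp: csubspace_0 csubspace_add)

lemma csubspace_has_sum:
  assumes "closed E" "(h has_sum x) I" "\<And>i. i \<in> I \<Longrightarrow> h i \<in> E"
  shows "x \<in> E"
proof (rule Lim_in_closed_set[OF assms(1)])
  show "\<forall>\<^sub>F F in finite_subsets_at_top I. sum h F \<in> E"
    by (intro eventually_finite_subsets_at_top_weakI csubspace_sum) (use assms(3) in auto)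
  show "(sum h \<longlongrightarrow> x) (finite_subsets_at_top I)"
    using assms(2) by (simp add: has_sum_def)
qed simp

lemma cfunctional_diff:
  assumes "cfunctional E f" "x \<in> E" "y \<in> E"
  shows "f (x - y) = f x - f y"
proof -
  have "f (x + (-1) *\<^sub>C y) = f x + (-1) * f y"
    using assms csubspace_cscale[OF assms(3)] unfolding cfunctional_def by simp
  then show ?thesis by (simp add: cscale_minus_one)
qed

lemma cfunctional_0: "cfunctional E f \<Longrightarrow> f 0 = 0"
  using cfunctional_diff[of f 0 0] csubspace_0 by simp

lemma cfunctional_scaleR: "cfunctional E f \<Longrightarrow> x \<in> E \<Longrightarrow> f (r *\<^sub>R x) = complex_of_real r * f x"
  unfolding cfunctional_def by (simp flip: cscale_of_real)

lemma cfunctional_sum: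
  assumes "cfunctional E f" "\<And>i. i \<in> F \<Longrightarrow> h i \<in> E"
  shows "f (sum h F) = (\<Sum>i\<in>F. f (h i))"
  using assms(2)
proof (induction F rule: infinite_finite_induct)
  case (insert i F)
  then have "sum h F \<in> E" by (intro csubspace_sum) auto
  with insert assms(1) show ?case by (auto simp: cfunctional_def)
qed (auto simp: cfunctional_0[OF assms(1)])

lemma cfunctional_tendsto:
  assumes f: "cfunctional E f" and lim: "(h \<longlongrightarrow> x) F" and h: "\<forall>\<^sub>F i in F. h i \<in> E" and x: "x \<in> E"
  shows "((\<lambda>i. f (h i)) \<longlongrightarrow> f x) F"
proof -
  obtain C where C: "\<And>y. y \<in> E \<Longrightarrow> cmod (f y) \<le> C * norm y"
    using f unfolding cfunctional_def by blast
  have "((\<lambda>i. C * norm (h i - x)) \<longlongrightarrow> C * 0) F"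
    by (rule tendsto_mult[OF tendsto_const tendsto_norm_zero]) (use lim in \<open>simp add: LIM_zero\<close>)
  moreover have "\<forall>\<^sub>F i in F. norm (f (h i) - f x) \<le> C * norm (h i - x)"
    using h
  proof eventually_elim
    case (elim i)
    with C[of "h i - x"] show ?case by (simp add: cfunctional_diff[OF f] csubspace_diff x)
  qed
  ultimately have "((\<lambda>i. f (h i) - f x) \<longlongrightarrow> 0) F"
    by (auto intro: Lim_null_comparison)
  then show ?thesis by (rule LIM_zero_cancel)
qed

lemma cfunctional_has_sum:
  assumes f: "cfunctional E f" and h: "(h has_sum x) I" "\<And>i. i \<in> I \<Longrightarrow> h i \<in> E" and x: "x \<in> E"
  shows "((\<lambda>i. f (h i)) has_sum f x) I"
proof -
  have fin: "\<forall>\<^sub>F F in finite_subsets_at_top I. sum h F \<in> E"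
    by (intro eventually_finite_subsets_at_top_weakI csubspace_sum) (use h in auto)
  have "((\<lambda>F. f (sum h F)) \<longlongrightarrow> f x) (finite_subsets_at_top I)"
    by (rule cfunctional_tendsto[OF f _ fin x]) (use h in \<open>simp add: has_sum_def\<close>)
  moreover have "\<forall>\<^sub>F F in finite_subsets_at_top I. f (sum h F) = (\<Sum>i\<in>F. f (h i))"
    by (intro eventually_finite_subsets_at_top_weakI cfunctional_sum[OF f]) (use h in auto)
  ultimately show ?thesis
    unfolding has_sum_def by (rule Lim_transform_eventually)
qed

lemma cfunctional_cmult: "cfunctional E f \<Longrightarrow> cfunctional E (\<lambda>x. c * f x)"
proof -
  assume f: "cfunctional E f"
  then obtain C where C: "\<And>y. y \<in> E \<Longrightarrow> cmod (f y) \<le> C * norm y"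
    unfolding cfunctional_def by blast
  have "cmod (c * f y) \<le> (cmod c * C) * norm y" if "y \<in> E" for y
    using mult_left_mono[OF C[OF that], of "cmod c"] by (simp add: norm_mult mult.assoc)
  with f show ?thesis unfolding cfunctional_def by (auto simp: distrib_left mult.left_commute)
qed

lemma cfunctional_add:
  assumes f: "cfunctional E f" and g: "cfunctional E g"
  shows "cfunctional E (\<lambda>x. f x + g x)"
proof -
  obtain C D where C: "\<And>y. y \<in> E \<Longrightarrow> cmod (f y) \<le> C * norm y" and D: "\<And>y. y \<in> E \<Longrightarrow> cmod (g y) \<le> D * norm y"
    using f g unfolding cfunctional_def by blast
  have "cmod (f y + g y) \<le> (C + D) * norm y" if "y \<in> E" for y
    using norm_triangle_ineq[of "f y" "g y"] C[OF that] D[OF that] by (simp add: distrib_right)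
  then have "\<exists>C. \<forall>y\<in>E. cmod (f y + g y) \<le> C * norm y" by blast
  moreover from f g have "\<forall>x\<in>E. \<forall>y\<in>E. f (x + y) + g (x + y) = f x + g x + (f y + g y)"
    and "\<forall>c. \<forall>x\<in>E. f (c *\<^sub>C x) + g (c *\<^sub>C x) = c * (f x + g x)"
    unfolding cfunctional_def by (simp_all add: algebra_simps)
  ultimately show ?thesis unfolding cfunctional_def by blast
qed

lemma cfunctional_finite_sum:
  assumes "\<And>i. i \<in> F \<Longrightarrow> cfunctional E (f i)"
  shows "cfunctional E (\<lambda>x. \<Sum>i\<in>F. f i x)"
proof -
  have "\<forall>i\<in>F. \<exists>C. \<forall>x\<in>E. cmod (f i x) \<le> C * norm x"
    using assms unfolding cfunctional_def by blast
  then obtain C where C: "\<And>i x. i \<in> F \<Longrightarrow> x \<in> E \<Longrightarrow> cmod (f i x) \<le> C i * norm x"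
    by metis
  then have "cmod (\<Sum>i\<in>F. f i x) \<le> (\<Sum>i\<in>F. C i) * norm x" if "x \<in> E" for x
    unfolding sum_distrib_right using that by (intro sum_norm_le) auto
  moreover have "(\<Sum>i\<in>F. f i (x + y)) = (\<Sum>i\<in>F. f i x) + (\<Sum>i\<in>F. f i y)"
    if "x \<in> E" "y \<in> E" for x y
    unfolding sum.distrib[symmetric] using assms that by (intro sum.cong) (auto simp: cfunctional_def)
  moreover have "(\<Sum>i\<in>F. f i (c *\<^sub>C x)) = c * (\<Sum>i\<in>F. f i x)" if "x \<in> E" for x c
    unfolding sum_distrib_left using assms that by (intro sum.cong) (auto simp: cfunctional_def)
  ultimately show ?thesis unfolding cfunctional_def by (intro conjI ballI allI exI)
qed

lemma cfunctional_infsum: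
  assumes f: "\<And>i. i \<in> I \<Longrightarrow> cfunctional E (f i)"
    and s: "\<And>y. y \<in> E \<Longrightarrow> ((\<lambda>i. f i y) has_sum g y) I"
    and b: "\<And>y. y \<in> E \<Longrightarrow> cmod (g y) \<le> C * norm y"
  shows "cfunctional E g"
proof -
  have "g (x + y) = g x + g y" if "x \<in> E" "y \<in> E" for x y
  proof (rule has_sum_unique[where A = I])
    show "((\<lambda>i. f i (x + y)) has_sum g (x + y)) I" using that s csubspace_add by blast
    have "((\<lambda>i. f i x + f i y) has_sum (g x + g y)) I" using that s by (intro has_sum_add)
    then show "((\<lambda>i. f i (x + y)) has_sum (g x + g y)) I"
      by (rule has_sum_cong[THEN iffD1, rotated]) (use f that in \<open>auto simp: cfunctional_def\<close>)
  qed
  moreover have "g (c *\<^sub>C x) = c * g x" if "x \<in> E" for x c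
  proof (rule has_sum_unique[where A = I])
    show "((\<lambda>i. f i (c *\<^sub>C x)) has_sum g (c *\<^sub>C x)) I" using that s csubspace_cscale by blast
    have "((\<lambda>i. c * f i x) has_sum (c * g x)) I" using that s by (intro has_sum_cmult_right)
    then show "((\<lambda>i. f i (c *\<^sub>C x)) has_sum (c * g x)) I"
      by (rule has_sum_cong[THEN iffD1, rotated]) (use f that in \<open>auto simp: cfunctional_def\<close>)
  qed
  ultimately show ?thesis unfolding cfunctional_def by (intro conjI ballI allI exI[of _ C] b)
qed

end

section \<open>Almost one-dimensional l1-summands\<close>

text \<open>Turning a coefficient by its conjugate phase makes it nonnegative; every norming
  functional below arises in this way. Zero is covered because \<open>sgn 0 = 0\<close>.\<close>

lemma cnj_sgn_mult: "cnj (sgn z) * z = complex_of_real (cmod z)"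
  by (cases "z = 0")
    (auto simp: sgn_eq complex_norm_square[symmetric] power2_eq_square mult.commute[of "cnj _"])

lemma cmod_diff_squared_cnj: "(cmod (a - b))\<^sup>2 = (cmod a)\<^sup>2 - 2 * Re (cnj b * a) + (cmod b)\<^sup>2"
  unfolding cmod_power2 by (simp add: power2_eq_square algebra_simps)

text \<open>The rank-one operator \<open>f \<otimes> x\<close> is, up to \<open>eps\<close>, a projection whose range is an \<open>l\<^sub>1\<close>-summand.\<close>
definition almost_L_line :: "'a::complex_banach set \<Rightarrow> real \<Rightarrow> 'a \<Rightarrow> ('a \<Rightarrow> complex) \<Rightarrow> bool" where
  "almost_L_line E eps x f \<longleftrightarrow> x \<in> E \<and> norm x \<le> 1 \<and> cfunctional E f \<and> cmod (f x - 1) \<le> eps \<and>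
     (\<forall>y\<in>E. cmod (f y) + norm (y - f y *\<^sub>C x) \<le> (1 + eps) * norm y)"

text \<open>The identity of \<open>E\<close> factors through l1(I): the coefficients
  \<open>\<psi> i y\<close> lead in, and sending the i-th basis vector to \<open>u i\<close> leads
  back. The vectors \<open>u i\<close> are fixed once and for all, while \<open>\<psi>\<close> may
  change completely with \<open>eps\<close>.\<close>

locale ell1_factorable =
  fixes E :: "'a::complex_banach set" and I :: "'i set" and u :: "'i \<Rightarrow> 'a"
  assumes sub: "csubspace E" and closed: "closed E"
    and u_mem: "\<And>i. i \<in> I \<Longrightarrow> u i \<in> E" and u_norm: "\<And>i. i \<in> I \<Longrightarrow> norm (u i) \<le> 1"
    and factor: "\<And>eps. 0 < eps \<Longrightarrow> \<exists>\<psi>. (\<forall>i\<in>I. cfunctional E (\<psi> i)) \<and>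
      (\<forall>y\<in>E. (\<lambda>i. cmod (\<psi> i y)) summable_on I \<and> (\<Sum>\<^sub>\<infinity>i\<in>I. cmod (\<psi> i y)) \<le> (1 + eps) * norm y \<and>
              ((\<lambda>i. \<psi> i y *\<^sub>C u i) has_sum y) I)"
begin

lemmas cscale_mem = csubspace_cscale[OF sub]
  and diff_mem = csubspace_diff[OF sub]
  and sum_mem = csubspace_sum[OF sub]
  and add_mem = csubspace_add[OF sub]
  and scaleR_mem = csubspace_scaleR[OF sub]
  and functional_cmult = cfunctional_cmult[OF sub]
  and functional_diff = cfunctional_diff[OF sub]
  and functional_sum = cfunctional_sum[OF sub]
  and functional_infsum = cfunctional_infsum[OF sub]
  and functional_has_sum = cfunctional_has_sum[OF sub]

lemma factorE:
  assumes "0 < eps"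
  obtains \<psi> where "\<And>i. i \<in> I \<Longrightarrow> cfunctional E (\<psi> i)"
    "\<And>y. y \<in> E \<Longrightarrow> (\<lambda>i. cmod (\<psi> i y)) summable_on I"
    "\<And>y. y \<in> E \<Longrightarrow> (\<Sum>\<^sub>\<infinity>i\<in>I. cmod (\<psi> i y)) \<le> (1 + eps) * norm y"
    "\<And>y. y \<in> E \<Longrightarrow> ((\<lambda>i. \<psi> i y *\<^sub>C u i) has_sum y) I"
    "\<And>y. y \<in> E \<Longrightarrow> norm y \<le> (\<Sum>\<^sub>\<infinity>i\<in>I. cmod (\<psi> i y))"
proof -
  obtain \<psi> where \<psi>: "\<And>i. i \<in> I \<Longrightarrow> cfunctional E (\<psi> i)"
    "\<And>y. y \<in> E \<Longrightarrow> (\<lambda>i. cmod (\<psi> i y)) summable_on I"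
    "\<And>y. y \<in> E \<Longrightarrow> (\<Sum>\<^sub>\<infinity>i\<in>I. cmod (\<psi> i y)) \<le> (1 + eps) * norm y"
    "\<And>y. y \<in> E \<Longrightarrow> ((\<lambda>i. \<psi> i y *\<^sub>C u i) has_sum y) I"
    using factor[OF assms] by blast
  have "norm y \<le> (\<Sum>\<^sub>\<infinity>i\<in>I. cmod (\<psi> i y))" if "y \<in> E" for y
  proof (rule norm_infsum_le[OF \<psi>(4)[OF that] has_sum_infsum[OF \<psi>(2)[OF that]]])
    fix i assume "i \<in> I"
    then show "norm (\<psi> i y *\<^sub>C u i) \<le> cmod (\<psi> i y)"
      using u_norm[of i] by (simp add: norm_cscale mult_left_le)
  qed
  with \<psi> show ?thesis by (rule that)
qed

text \<open>Take a near-maximiser \<open>x\<close> on the unit ball of a function \<open>\<Phi>\<close> of finitely many coordinates, made strictly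
  convex by a small quadratic term, and expand \<open>x\<close> as an almost convex combination of unit vectors
  \<open>v\<^sub>i\<close> by a factorization with a much smaller constant. Strict convexity forces most of the mass onto
  indices for which \<open>v\<^sub>i\<close> is near \<open>x\<close> in finitely many coordinates, and these carry almost all of the norm.\<close>
lemma almost_L_line_near_max:
  assumes eps: "0 < eps" "eps \<le> 1 / 10"
    and g: "cfunctional E g" and g_norm: "\<And>y. y \<in> E \<Longrightarrow> cmod (g y) \<le> norm y"
    and x0: "x0 \<in> E" "norm x0 \<le> 1" "Re (g x0) \<ge> 1 - eps"
  shows "\<exists>x f r. almost_L_line E (30 * eps) x f \<and> g x = complex_of_real r \<and> r \<ge> 1 - 6 * eps"
proof -
  \<comment> \<open>This factorization serves as a coordinate system in which distances are
    measured. The vector \<open>x\<close> found below is expanded by a second, much finer one,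
    \<open>\<phi>\<close>.\<close>
  obtain \<psi> where \<psi>: "\<And>i. i \<in> I \<Longrightarrow> cfunctional E (\<psi> i)"
    "\<And>y. y \<in> E \<Longrightarrow> (\<lambda>i. cmod (\<psi> i y)) summable_on I"
    "\<And>y. y \<in> E \<Longrightarrow> (\<Sum>\<^sub>\<infinity>i\<in>I. cmod (\<psi> i y)) \<le> (1 + eps) * norm y"
    "\<And>y. y \<in> E \<Longrightarrow> norm y \<le> (\<Sum>\<^sub>\<infinity>i\<in>I. cmod (\<psi> i y))"
    by (rule factorE[OF eps(1)]) blast
  have \<psi>_ball: "(\<Sum>\<^sub>\<infinity>i\<in>I. cmod (\<psi> i y)) \<le> 1 + eps" if "y \<in> E" "norm y \<le> 1" for y
  proof -
    have "(1 + eps) * norm y \<le> (1 + eps) * 1" using that eps by (intro mult_left_mono) auto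
    from order_trans[OF \<psi>(3)[OF that(1)] this] show ?thesis by simp
  qed
  obtain F where F: "finite F" "F \<subseteq> I"
    "dist (\<Sum>i\<in>F. cmod (\<psi> i x0)) (\<Sum>\<^sub>\<infinity>i\<in>I. cmod (\<psi> i x0)) \<le> eps"
    using infsum_finite_approximation[OF \<psi>(2)[OF x0(1)] eps(1)] by blast
  have \<psi>_F: "(\<Sum>i\<in>F. cmod (\<psi> i y)) \<le> (\<Sum>\<^sub>\<infinity>i\<in>I. cmod (\<psi> i y))" if "y \<in> E" for y
    by (rule finite_sum_le_infsum) (use \<psi>(2) that F in auto)
  have tail: "(\<Sum>\<^sub>\<infinity>i\<in>I-F. cmod (\<psi> i y)) = (\<Sum>\<^sub>\<infinity>i\<in>I. cmod (\<psi> i y)) - (\<Sum>i\<in>F. cmod (\<psi> i y))"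
    "(\<lambda>i. cmod (\<psi> i y)) summable_on (I - F)" if "y \<in> E" for y
    using infsum_Diff[OF \<psi>(2)[OF that] _ F(2)] F summable_on_subset[OF \<psi>(2)[OF that]] by auto

  \<comment> \<open>\<open>l\<close> nearly norms \<open>x0\<close> but sees only the coordinates in
    \<open>F\<close>: a point of the unit ball at which \<open>Re l\<close> is close to 1 has almost
    no mass outside \<open>F\<close>.\<close>
  define l where "l = (\<lambda>y. \<Sum>i\<in>F. cnj (sgn (\<psi> i x0)) * \<psi> i y)"
  have l: "cfunctional E l"
    unfolding l_def using F \<psi>(1) by (intro cfunctional_finite_sum[OF sub] functional_cmult) auto
  have l_le: "cmod (l y) \<le> (\<Sum>i\<in>F. cmod (\<psi> i y))" for y
    unfolding l_def
    by (intro sum_norm_le) (simp add: norm_mult norm_sgn)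
  have l_x0: "Re (l x0) \<ge> norm x0 - eps"
  proof -
    have "l x0 = (\<Sum>i\<in>F. complex_of_real (cmod (\<psi> i x0)))"
      unfolding l_def by (simp add: cnj_sgn_mult)
    then have "Re (l x0) = (\<Sum>i\<in>F. cmod (\<psi> i x0))" by simp
    with F(3) \<psi>(4)[OF x0(1)] show ?thesis by (simp add: dist_real_def)
  qed

  \<comment> \<open>The summand \<open>g\<close> keeps near-maximisers at points where
    \<open>g\<close> is close to 1.\<close>
  define k where "k = (\<lambda>y. l y + g y)"
  have k: "cfunctional E k" unfolding k_def by (rule cfunctional_add[OF sub l g])
  define Q where "Q = (\<lambda>y. \<Sum>i\<in>F. (cmod (\<psi> i y))\<^sup>2)"
  have Q_nonneg: "Q y \<ge> 0" for y unfolding Q_def by (simp add: sum_nonneg)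
  have Q_le: "Q y \<le> 3" if "y \<in> E" "norm y \<le> 1" for y
  proof -
    have le: "(\<Sum>i\<in>F. cmod (\<psi> i y)) \<le> 1 + eps" using \<psi>_F \<psi>_ball that by fastforce
    have "(cmod (\<psi> i y))\<^sup>2 \<le> 2 * cmod (\<psi> i y)" if "i \<in> F" for i
    proof -
      have "cmod (\<psi> i y) \<le> (\<Sum>i\<in>F. cmod (\<psi> i y))"
        by (rule member_le_sum) (use that F in auto)
      with le eps show ?thesis by (simp add: power2_eq_square mult_right_mono)
    qed
    then have "Q y \<le> 2 * (\<Sum>i\<in>F. cmod (\<psi> i y))"
      unfolding Q_def sum_distrib_left by (intro sum_mono)
    with le eps show ?thesis by simp
  qed
  \<comment> \<open>Since \<open>Q\<close> is at most 3 on the unit ball, the quadratic term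
    perturbs \<open>Re k\<close> by at most \<open>eps\<close>.\<close>
  define \<kappa> where "\<kappa> = eps / 3"
  have \<kappa>: "0 < \<kappa>" "\<kappa> \<le> eps" using eps by (auto simp: \<kappa>_def)
  have \<kappa>Q: "\<kappa> * Q y \<le> eps" if "y \<in> E" "norm y \<le> 1" for y
    using mult_left_mono[OF Q_le[OF that], of \<kappa>] \<kappa> by (simp add: \<kappa>_def)
  define \<Phi> where "\<Phi> = (\<lambda>y. Re (k y) + \<kappa> * Q y)"
  define ball1 where "ball1 = {y\<in>E. norm y \<le> 1}"
  have k_le: "Re (l y) \<le> 1 + eps" "Re (g y) \<le> 1" if "y \<in> E" "norm y \<le> 1" for y
  proof -
    have "Re (l y) \<le> cmod (l y)" "Re (g y) \<le> cmod (g y)" by (rule complex_Re_le_cmod)+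
    with l_le[of y] \<psi>_F[OF that(1)] \<psi>_ball[OF that] g_norm[OF that(1)] that(2)
    show "Re (l y) \<le> 1 + eps" "Re (g y) \<le> 1" by linarith+
  qed
  have \<Phi>_le: "\<Phi> y \<le> 3" if "y \<in> E" "norm y \<le> 1" for y
    using k_le[OF that] \<kappa>Q[OF that] eps by (simp add: \<Phi>_def k_def)
  have bdd: "bdd_above (\<Phi> ` ball1)" unfolding ball1_def using \<Phi>_le by (auto intro!: bdd_aboveI)
  define m where "m = Sup (\<Phi> ` ball1)"
  have \<Phi>_m: "\<Phi> y \<le> m" if "y \<in> E" "norm y \<le> 1" for y
    unfolding m_def by (rule cSup_upper[OF _ bdd]) (use that in \<open>auto simp: ball1_def\<close>)
  have \<Phi>x0: "\<Phi> x0 \<ge> 2 - 3 * eps"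
  proof -
    have "Re (g x0) \<le> norm x0" using complex_Re_le_cmod[of "g x0"] g_norm[OF x0(1)] by linarith
    moreover have "0 \<le> \<kappa> * Q x0" using \<kappa> Q_nonneg[of x0] by simp
    ultimately show ?thesis using l_x0 x0(3) by (simp add: \<Phi>_def k_def)
  qed
  have m: "2 - 3 * eps \<le> m" "m \<le> 3"
  proof -
    show "2 - 3 * eps \<le> m" using \<Phi>x0 \<Phi>_m[OF x0(1,2)] by linarith
    show "m \<le> 3" unfolding m_def using \<Phi>_le x0 by (intro cSup_least) (auto simp: ball1_def)
  qed

  \<comment> \<open>\<open>\<rho>\<close> lets the deviations in all coordinates of \<open>F\<close>
    add up to at most \<open>eps\<close>; the 1 in \<open>n\<close> covers an empty
    \<open>F\<close>. \<open>\<eta>\<close> is chosen so that the total defect, at most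
    \<open>6 * \<eta>\<close>, is the \<open>\<kappa> * \<rho>\<^sup>2 * eps\<close> wanted in
    \<open>total\<close>.\<close>
  define n where "n = real (card F) + 1"
  define \<rho> where "\<rho> = eps / n"
  define \<eta> where "\<eta> = \<kappa> * eps * \<rho>\<^sup>2 / 6"
  have n: "n \<ge> 1" by (simp add: n_def)
  have \<rho>: "0 < \<rho>" "real (card F) * \<rho> \<le> eps" "\<rho> \<le> 1"
    using n eps by (auto simp: \<rho>_def n_def field_simps)
  have \<eta>: "0 < \<eta>" "\<eta> \<le> eps"
  proof -
    show "0 < \<eta>" using \<kappa> eps \<rho> by (simp add: \<eta>_def)
    have "\<kappa> * (eps * \<rho>\<^sup>2) \<le> 1 * (eps * 1)"
      using \<kappa> eps \<rho> by (intro mult_mono power_le_one) auto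
    then show "\<eta> \<le> eps" using eps by (simp add: \<eta>_def)
  qed
  have "\<exists>z\<in>\<Phi> ` ball1. m - \<eta> < z"
    unfolding m_def by (rule less_cSupD) (use \<eta> x0 in \<open>auto simp: ball1_def\<close>)
  then obtain x where x: "x \<in> E" "norm x \<le> 1" and \<Phi>x: "\<Phi> x > m - \<eta>"
    unfolding ball1_def by auto
  have l_x: "Re (l x) \<ge> 1 - 5 * eps" and g_x: "Re (g x) \<ge> 1 - 6 * eps"
    using \<Phi>x m(1) \<kappa>Q[OF x] k_le[OF x] \<eta>(2) unfolding \<Phi>_def k_def by auto
  have norm_x: "norm x \<ge> 1 - 6 * eps"
    using g_x complex_Re_le_cmod[of "g x"] g_norm[OF x(1)] by linarith

  obtain \<phi> where \<phi>: "\<And>i. i \<in> I \<Longrightarrow> cfunctional E (\<phi> i)"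
    "\<And>y. y \<in> E \<Longrightarrow> (\<lambda>i. cmod (\<phi> i y)) summable_on I"
    "\<And>y. y \<in> E \<Longrightarrow> (\<Sum>\<^sub>\<infinity>i\<in>I. cmod (\<phi> i y)) \<le> (1 + \<eta>) * norm y"
    "\<And>y. y \<in> E \<Longrightarrow> ((\<lambda>i. \<phi> i y *\<^sub>C u i) has_sum y) I"
    "\<And>y. y \<in> E \<Longrightarrow> norm y \<le> (\<Sum>\<^sub>\<infinity>i\<in>I. cmod (\<phi> i y))"
    by (rule factorE[OF \<eta>(1)]) blast
  \<comment> \<open>With the phases moved into the vectors, \<open>x\<close> is a combination of
    vectors \<open>v i\<close> of the unit ball with nonnegative weights of total nearly 1. At a
    zero coefficient the phase is set to 1, so that \<open>\<sigma> i\<close> is unimodular for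
    every \<open>i\<close>.\<close>
  define w where "w = (\<lambda>i. cmod (\<phi> i x))"
  define \<sigma> where "\<sigma> = (\<lambda>i. if \<phi> i x = 0 then 1 else sgn (\<phi> i x))"
  define v where "v = (\<lambda>i. \<sigma> i *\<^sub>C u i)"
  define W where "W = (\<Sum>\<^sub>\<infinity>i\<in>I. w i)"
  have \<sigma>: "cmod (\<sigma> i) = 1" "\<phi> i x = complex_of_real (w i) * \<sigma> i" for i
    by (auto simp: \<sigma>_def w_def norm_sgn) (simp add: sgn_eq)
  have \<sigma>': "cnj (\<sigma> i) * \<sigma> i = 1" for i
    using complex_norm_square[of "\<sigma> i"] by (simp add: \<sigma>(1) mult.commute)
  have w_nonneg: "w i \<ge> 0" for i by (simp add: w_def)
  have w_sum: "(w has_sum W) I" unfolding W_def w_def using \<phi>(2)[OF x(1)] by simp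
  have W: "norm x \<le> W" "W \<le> 1 + \<eta>"
  proof -
    show "norm x \<le> W" using \<phi>(5)[OF x(1)] by (simp add: W_def w_def)
    have "W \<le> (1 + \<eta>) * norm x" using \<phi>(3)[OF x(1)] by (simp add: W_def w_def)
    also have "\<dots> \<le> (1 + \<eta>) * 1" using x(2) \<eta> by (intro mult_left_mono) auto
    finally show "W \<le> 1 + \<eta>" by simp
  qed
  have v: "v i \<in> E" "norm (v i) \<le> 1" if "i \<in> I" for i
    using that u_mem u_norm by (auto simp: v_def cscale_mem norm_cscale \<sigma>(1))
  have v_sum: "((\<lambda>i. w i *\<^sub>R v i) has_sum x) I"
    using \<phi>(4)[OF x(1)] by (simp add: \<sigma>(2) v_def cscale_cscale cscale_of_real[symmetric])
  have weighted_functional_sum: "((\<lambda>i. w i * Re (h (v i))) has_sum Re (h x)) I" if h: "cfunctional E h" for h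
  proof -
    have "((\<lambda>i. h (w i *\<^sub>R v i)) has_sum h x) I"
      by (rule functional_has_sum[OF h v_sum _ x(1)]) (auto intro: scaleR_mem v)
    then have "((\<lambda>i. Re (h (w i *\<^sub>R v i))) has_sum Re (h x)) I" by (rule has_sum_Re)
    then show ?thesis
      by (rule has_sum_cong[THEN iffD1, rotated]) (simp add: cfunctional_scaleR[OF sub h] v)
  qed

  define d where "d = (\<lambda>s. \<psi> s x)"
  define K where "K = (\<lambda>y. \<Sum>s\<in>F. cnj (d s) * \<psi> s y)"
  have K: "cfunctional E K"
    unfolding K_def using F \<psi>(1) by (intro cfunctional_finite_sum[OF sub] functional_cmult) auto
  have K_x: "Re (K x) = Q x"
    unfolding K_def Q_def d_def by (simp add: cmod_power2 flip: power2_eq_square)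
  \<comment> \<open>This is \<open>w i * (m - \<Phi> (v i))\<close> plus
    \<open>\<kappa> * w i\<close> times the squared distance of \<open>v i\<close> from
    \<open>x\<close> in the coordinates of \<open>F\<close>. The terms \<open>Q (v i)\<close>
    cancel, so only functionals of \<open>v i\<close> remain and the sum over \<open>I\<close> is
    computed by evaluating them at \<open>x\<close>.\<close>
  define R where "R = (\<lambda>i. w i * m - w i * Re (k (v i)) - 2 * \<kappa> * (w i * Re (K (v i))) + \<kappa> * Q x * w i)"
  have R_sum: "(R has_sum (W * m - Re (k x) - 2 * \<kappa> * Q x + \<kappa> * Q x * W)) I"
    unfolding R_def K_x[symmetric]
    by (intro has_sum_add has_sum_diff has_sum_cmult_right has_sum_cmult_left weighted_functional_sum w_sum k K)
  have R_ge: "\<kappa> * w i * (\<Sum>s\<in>F. (cmod (\<psi> s (v i) - d s))\<^sup>2) \<le> R i" if i: "i \<in> I" for i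
  proof -
    have "(\<Sum>s\<in>F. (cmod (\<psi> s (v i) - d s))\<^sup>2) = Q (v i) - 2 * Re (K (v i)) + Q x"
      unfolding cmod_diff_squared_cnj Q_def K_def
      by (simp add: sum.distrib sum_subtractf sum_distrib_left d_def)
    moreover have "w i * (Re (k (v i)) + \<kappa> * Q (v i)) \<le> w i * m"
      using \<Phi>_m[OF v[OF i]] w_nonneg by (intro mult_left_mono) (auto simp: \<Phi>_def)
    ultimately show ?thesis by (simp only: R_def) (simp add: algebra_simps)
  qed
  have total: "W * m - Re (k x) - 2 * \<kappa> * Q x + \<kappa> * Q x * W \<le> \<kappa> * \<rho>\<^sup>2 * eps"
  proof -
    have "m \<ge> 0" using m(1) eps by linarith
    have "W * (m + \<kappa> * Q x) \<le> (1 + \<eta>) * (m + \<kappa> * Q x)"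
      using W \<open>m \<ge> 0\<close> \<kappa> Q_nonneg[of x] by (intro mult_right_mono) auto
    moreover have "\<eta> * (m + \<kappa> * Q x) \<le> \<eta> * 4"
      using \<eta> m \<kappa>Q[OF x] eps by (intro mult_left_mono) auto
    ultimately have "W * m - Re (k x) - 2 * \<kappa> * Q x + \<kappa> * Q x * W \<le> 6 * \<eta>"
      using \<Phi>x \<eta> unfolding \<Phi>_def by (simp add: algebra_simps)
    then show ?thesis by (simp add: \<eta>_def algebra_simps)
  qed

  define B where "B = {i\<in>I. \<forall>s\<in>F. cmod (\<psi> s (v i) - d s) \<le> \<rho>}"
  have B: "B \<subseteq> I" by (auto simp: B_def)
  \<comment> \<open>Chebyshev's argument: an index outside \<open>B\<close> contributes at least
    \<open>\<kappa> * \<rho>\<^sup>2 * w i\<close> to the sum of \<open>R\<close>.\<close>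
  have w_B: "(\<Sum>\<^sub>\<infinity>i\<in>I-B. w i) \<le> eps"
  proof -
    have "w summable_on (I - B)"
      using w_sum summable_on_subset[of w I "I - B"] has_sum_imp_summable by blast
    then have *: "((\<lambda>i. \<kappa> * \<rho>\<^sup>2 * w i) has_sum (\<kappa> * \<rho>\<^sup>2 * (\<Sum>\<^sub>\<infinity>i\<in>I-B. w i))) (I - B)"
      by (intro has_sum_cmult_right has_sum_infsum)
    have "\<kappa> * \<rho>\<^sup>2 * (\<Sum>\<^sub>\<infinity>i\<in>I-B. w i) \<le> W * m - Re (k x) - 2 * \<kappa> * Q x + \<kappa> * Q x * W"
    proof (rule has_sum_mono_neutral[OF * R_sum])
      fix i assume i: "i \<in> (I - B) \<inter> I"
      then obtain s where s: "s \<in> F" "\<rho> < cmod (\<psi> s (v i) - d s)" by (auto simp: B_def)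
      have "\<rho>\<^sup>2 \<le> (cmod (\<psi> s (v i) - d s))\<^sup>2" using s \<rho> by (intro power_mono) auto
      also have "\<dots> \<le> (\<Sum>s\<in>F. (cmod (\<psi> s (v i) - d s))\<^sup>2)"
        by (rule member_le_sum) (use s F in auto)
      finally have "\<kappa> * w i * \<rho>\<^sup>2 \<le> \<kappa> * w i * (\<Sum>s\<in>F. (cmod (\<psi> s (v i) - d s))\<^sup>2)"
        using \<kappa> w_nonneg by (intro mult_left_mono) auto
      with R_ge[of i] i show "\<kappa> * \<rho>\<^sup>2 * w i \<le> R i" by (simp add: mult_ac)
    next
      fix i assume "i \<in> I - (I - B)"
      then have "i \<in> I" by auto
      have "0 \<le> \<kappa> * w i * (\<Sum>s\<in>F. (cmod (\<psi> s (v i) - d s))\<^sup>2)"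
        using \<kappa> w_nonneg by (intro mult_nonneg_nonneg sum_nonneg) auto
      with R_ge[OF \<open>i \<in> I\<close>] show "0 \<le> R i" by linarith
    qed auto
    with total have "\<kappa> * \<rho>\<^sup>2 * (\<Sum>\<^sub>\<infinity>i\<in>I-B. w i) \<le> \<kappa> * \<rho>\<^sup>2 * eps" by linarith
    then show ?thesis using \<kappa> \<rho> by simp
  qed
  have F_d: "(\<Sum>s\<in>F. cmod (d s)) \<ge> 1 - 5 * eps"
    using l_x l_le[of x] complex_Re_le_cmod[of "l x"] by (simp add: d_def)
  \<comment> \<open>14 = 1 + 7 + 6: the coordinates in \<open>F\<close> differ by at most
    \<open>eps\<close> in total, and the masses outside \<open>F\<close> are at most
    \<open>7 * eps\<close> for \<open>v i\<close> and \<open>6 * eps\<close> for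
    \<open>x\<close>.\<close>
  have v_x: "norm (v i - x) \<le> 14 * eps" if i: "i \<in> B" for i
  proof -
    have iI: "i \<in> I" using i B by auto
    have mem: "v i - x \<in> E" using v[OF iI] x by (simp add: diff_mem)
    have diff: "\<psi> s (v i - x) = \<psi> s (v i) - d s" if "s \<in> I" for s
      using that v[OF iI] x \<psi>(1) by (simp add: functional_diff d_def)
    have le: "cmod (\<psi> s (v i) - d s) \<le> \<rho>" if "s \<in> F" for s using i that by (auto simp: B_def)
    have 1: "(\<Sum>s\<in>F. cmod (\<psi> s (v i) - d s)) \<le> eps"
      using sum_bounded_above[of F "\<lambda>s. cmod (\<psi> s (v i) - d s)" \<rho>] le \<rho> by fastforce
    have "(\<Sum>s\<in>F. cmod (d s)) \<le> (\<Sum>s\<in>F. cmod (\<psi> s (v i) - d s) + cmod (\<psi> s (v i)))"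
      by (intro sum_mono) (metis add.commute norm_minus_commute norm_triangle_sub)
    then have 2: "(\<Sum>s\<in>F. cmod (\<psi> s (v i))) \<ge> 1 - 6 * eps"
      using 1 F_d by (simp add: sum.distrib)
    have "(\<Sum>\<^sub>\<infinity>s\<in>I-F. cmod (\<psi> s (v i - x))) \<le> (\<Sum>\<^sub>\<infinity>s\<in>I-F. cmod (\<psi> s (v i)) + cmod (\<psi> s x))"
    proof (rule infsum_mono)
      show "(\<lambda>s. cmod (\<psi> s (v i)) + cmod (\<psi> s x)) summable_on (I - F)"
        using tail(2) v[OF iI] x by (intro summable_on_add) auto
      show "cmod (\<psi> s (v i - x)) \<le> cmod (\<psi> s (v i)) + cmod (\<psi> s x)" if "s \<in> I - F" for s
        using that diff[of s] by (simp add: d_def norm_triangle_ineq4)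
    qed (use tail(2) mem in auto)
    also have "\<dots> = (\<Sum>\<^sub>\<infinity>s\<in>I-F. cmod (\<psi> s (v i))) + (\<Sum>\<^sub>\<infinity>s\<in>I-F. cmod (\<psi> s x))"
      using tail(2) v[OF iI] x by (intro infsum_add) auto
    also have "\<dots> \<le> 7 * eps + 6 * eps"
      using 2 F_d \<psi>_ball[OF v[OF iI]] \<psi>_ball[OF x]
      by (simp add: tail(1)[OF v(1)[OF iI]] tail(1)[OF x(1)] d_def)
    finally have 3: "(\<Sum>\<^sub>\<infinity>s\<in>I-F. cmod (\<psi> s (v i - x))) \<le> 13 * eps" by simp
    have "(\<Sum>s\<in>F. cmod (\<psi> s (v i - x))) = (\<Sum>s\<in>F. cmod (\<psi> s (v i) - d s))"
      using diff F by (intro sum.cong) auto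
    with 1 3 \<psi>(4)[OF mem] tail(1)[OF mem] show ?thesis by linarith
  qed

  \<comment> \<open>Since \<open>v i\<close> is close to \<open>x\<close> for every \<open>i\<close>
    in \<open>B\<close>, the part of the expansion of \<open>y\<close> indexed by \<open>B\<close>
    is nearly a multiple of \<open>x\<close>, and \<open>f y\<close> is the multiplier.\<close>
  define f where "f = (\<lambda>y. \<Sum>\<^sub>\<infinity>i\<in>B. cnj (\<sigma> i) * \<phi> i y)"
  have abs_B: "(\<lambda>i. cmod (\<phi> i y)) summable_on B" if "y \<in> E" for y
    using summable_on_subset[OF \<phi>(2)[OF that] B] .
  have f_sum: "((\<lambda>i. cnj (\<sigma> i) * \<phi> i y) has_sum f y) B" if "y \<in> E" for y
    unfolding f_def using abs_B[OF that]
    by (intro has_sum_infsum[OF abs_summable_summable]) (simp add: norm_mult \<sigma>(1))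
  have f_le: "cmod (f y) \<le> (\<Sum>\<^sub>\<infinity>i\<in>B. cmod (\<phi> i y))" if "y \<in> E" for y
    by (rule norm_infsum_le[OF f_sum[OF that] has_sum_infsum[OF abs_B[OF that]]]) (simp add: norm_mult \<sigma>(1))
  have B_le: "(\<Sum>\<^sub>\<infinity>i\<in>B. cmod (\<phi> i y)) \<le> (\<Sum>\<^sub>\<infinity>i\<in>I. cmod (\<phi> i y))" if "y \<in> E" for y
    by (rule infsum_mono2[OF abs_B[OF that] \<phi>(2)[OF that] B]) auto
  have f: "cfunctional E f"
  proof (rule functional_infsum[OF _ f_sum])
    show "cmod (f y) \<le> (1 + \<eta>) * norm y" if "y \<in> E" for y
      using f_le[OF that] B_le[OF that] \<phi>(3)[OF that] by linarith
  qed (rule functional_cmult[OF \<phi>(1)], use B in auto)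
  have f_x: "cmod (f x - 1) \<le> 7 * eps"
  proof -
    have "((\<lambda>i. complex_of_real (w i)) has_sum f x) B"
    proof (rule has_sum_cong[THEN iffD1, OF _ f_sum[OF x(1)]])
      show "cnj (\<sigma> i) * \<phi> i x = complex_of_real (w i)" for i
        using \<sigma>'[of i] by (metis \<sigma>(2) mult.left_commute mult.right_neutral)
    qed
    moreover have wB: "w summable_on B"
      using w_sum summable_on_subset[of w I B] has_sum_imp_summable B by blast
    ultimately have fx: "f x = complex_of_real (\<Sum>\<^sub>\<infinity>i\<in>B. w i)"
      by (metis has_sum_infsum has_sum_of_real has_sum_unique)
    have "(\<Sum>\<^sub>\<infinity>i\<in>I-B. w i) = W - (\<Sum>\<^sub>\<infinity>i\<in>B. w i)"
      using infsum_Diff[OF has_sum_imp_summable[OF w_sum] wB B] by (simp add: W_def)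
    moreover have "(\<Sum>\<^sub>\<infinity>i\<in>I-B. w i) \<ge> 0" using w_nonneg by (intro infsum_nonneg)
    ultimately have "\<bar>(\<Sum>\<^sub>\<infinity>i\<in>B. w i) - 1\<bar> \<le> 7 * eps"
      using W w_B norm_x \<eta> eps by (auto simp: abs_le_iff)
    then show ?thesis unfolding fx by (metis norm_of_real of_real_1 of_real_diff)
  qed
  have f_line: "cmod (f y) + norm (y - f y *\<^sub>C x) \<le> (1 + 30 * eps) * norm y" if y: "y \<in> E" for y
  proof -
    let ?c = "\<lambda>i. cmod (\<phi> i y)"
    have "((\<lambda>i. cnj (\<sigma> i) * \<phi> i y * (if i \<in> B then 1 else 0)) has_sum f y) I"
      using f_sum[OF y] by (rule has_sum_cong_neutral[THEN iffD1, rotated -1]) (use B in auto)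
    then have "((\<lambda>i. (cnj (\<sigma> i) * \<phi> i y * (if i \<in> B then 1 else 0)) *\<^sub>C x) has_sum f y *\<^sub>C x) I"
      using has_sum_bounded_linear[OF bounded_linear_cscale_left] by fastforce
    then have S: "((\<lambda>i. \<phi> i y *\<^sub>C u i - (cnj (\<sigma> i) * \<phi> i y * (if i \<in> B then 1 else 0)) *\<^sub>C x)
        has_sum (y - f y *\<^sub>C x)) I"
      by (intro has_sum_diff \<phi>(4) y)
    have T1: "(?c has_sum (\<Sum>\<^sub>\<infinity>i\<in>I. ?c i)) I" using \<phi>(2)[OF y] by simp
    have T2: "((\<lambda>i. if i \<in> B then ?c i else 0) has_sum (\<Sum>\<^sub>\<infinity>i\<in>B. ?c i)) I"
      using has_sum_infsum[OF abs_B[OF y]]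
      by (rule has_sum_cong_neutral[THEN iffD1, rotated -1]) (use B in auto)
    have "norm (y - f y *\<^sub>C x) \<le> (\<Sum>\<^sub>\<infinity>i\<in>I. ?c i) - (1 - 14 * eps) * (\<Sum>\<^sub>\<infinity>i\<in>B. ?c i)"
    proof (rule norm_infsum_le[OF S has_sum_diff[OF T1 has_sum_cmult_right[OF T2]]])
      fix i assume i: "i \<in> I"
      show "norm (\<phi> i y *\<^sub>C u i - (cnj (\<sigma> i) * \<phi> i y * (if i \<in> B then 1 else 0)) *\<^sub>C x)
        \<le> ?c i - (1 - 14 * eps) * (if i \<in> B then ?c i else 0)"
      proof (cases "i \<in> B")
        case True
        have "\<phi> i y *\<^sub>C u i = (cnj (\<sigma> i) * \<phi> i y) *\<^sub>C v i"
        proof -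
          have "cnj (\<sigma> i) * \<phi> i y * \<sigma> i = (cnj (\<sigma> i) * \<sigma> i) * \<phi> i y" by (simp only: mult_ac)
          then show ?thesis by (simp only: v_def cscale_cscale \<sigma>' mult_1)
        qed
        then have "\<phi> i y *\<^sub>C u i - (cnj (\<sigma> i) * \<phi> i y) *\<^sub>C x = (cnj (\<sigma> i) * \<phi> i y) *\<^sub>C (v i - x)"
          by (simp add: cscale_diff_right)
        then show ?thesis
          using True mult_left_mono[OF v_x[OF True], of "?c i"]
          by (simp add: norm_cscale norm_mult \<sigma>(1) algebra_simps)
      next
        case False
        then show ?thesis using u_norm[OF i] by (simp add: norm_cscale mult_left_le)
      qed
    qed
    then have "cmod (f y) + norm (y - f y *\<^sub>C x) \<le> (\<Sum>\<^sub>\<infinity>i\<in>I. ?c i) + 14 * eps * (\<Sum>\<^sub>\<infinity>i\<in>B. ?c i)"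
      using f_le[OF y] by (simp add: algebra_simps)
    also have "\<dots> \<le> (1 + 14 * eps) * (\<Sum>\<^sub>\<infinity>i\<in>I. ?c i)"
      using mult_left_mono[OF B_le[OF y], of "14 * eps"] eps by (simp add: algebra_simps)
    also have "\<dots> \<le> (1 + 14 * eps) * ((1 + eps) * norm y)"
    proof -
      have "(1 + \<eta>) * norm y \<le> (1 + eps) * norm y" using \<eta> by (intro mult_right_mono) auto
      with \<phi>(3)[OF y] eps show ?thesis by (intro mult_left_mono) auto
    qed
    also have "\<dots> \<le> (1 + 30 * eps) * norm y"
    proof -
      have "14 * (eps * eps) \<le> 14 * (eps * 1)" using eps by (intro mult_left_mono) auto
      then have "(1 + 14 * eps) * (1 + eps) \<le> 1 + 30 * eps" using eps by (simp add: algebra_simps)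
      from mult_right_mono[OF this, of "norm y"] show ?thesis by (simp add: mult.assoc)
    qed
    finally show ?thesis .
  qed

  \<comment> \<open>Rotating \<open>x\<close> makes \<open>g x\<close> real and positive; rotating
    \<open>f\<close> the opposite way leaves the rank-one operator unchanged.\<close>
  define \<tau> where "\<tau> = cnj (sgn (g x))"
  have "g x \<noteq> 0" using g_x eps by auto
  then have \<tau>: "cmod \<tau> = 1" by (simp add: \<tau>_def norm_sgn)
  then have \<tau>': "cnj \<tau> * \<tau> = 1" using complex_norm_square[of \<tau>] by (simp add: mult.commute)
  have "g (\<tau> *\<^sub>C x) = complex_of_real (cmod (g x))"
  proof -
    have "g (\<tau> *\<^sub>C x) = \<tau> * g x" using g x(1) unfolding cfunctional_def by blast
    also have "\<dots> = complex_of_real (cmod (g x))" by (simp add: \<tau>_def cnj_sgn_mult)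
    finally show ?thesis .
  qed
  moreover have "cmod (g x) \<ge> 1 - 6 * eps" using g_x complex_Re_le_cmod[of "g x"] by linarith
  moreover have "almost_L_line E (30 * eps) (\<tau> *\<^sub>C x) (\<lambda>y. cnj \<tau> * f y)"
  proof -
    have "f (\<tau> *\<^sub>C x) = \<tau> * f x" using f x(1) unfolding cfunctional_def by blast
    then have "cnj \<tau> * f (\<tau> *\<^sub>C x) = f x" by (simp add: \<tau>' flip: mult.assoc)
    moreover have "(cnj \<tau> * f y) *\<^sub>C \<tau> *\<^sub>C x = f y *\<^sub>C x" for y
    proof -
      have "cnj \<tau> * f y * \<tau> = (cnj \<tau> * \<tau>) * f y" by (simp only: mult_ac)
      then show ?thesis by (simp only: cscale_cscale \<tau>' mult_1)
    qed
    ultimately show ?thesis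
      unfolding almost_L_line_def using f_x f_line eps x \<tau> functional_cmult[OF f]
      by (auto simp: norm_cscale norm_mult cscale_mem)
  qed
  ultimately show ?thesis by blast
qed

end

section \<open>One-dimensional l1-summands and Grothendieck's theorem\<close>

text \<open>The case of zero error. The triangle inequality turns the estimate into an equality, so
  \<open>f \<otimes> e\<close> is an L-projection of rank one.\<close>

definition L_line :: "'a::complex_banach set \<Rightarrow> 'a \<Rightarrow> ('a \<Rightarrow> complex) \<Rightarrow> bool" where
  "L_line E e f \<longleftrightarrow> e \<in> E \<and> norm e \<le> 1 \<and> cfunctional E f \<and> f e = 1 \<and>
     (\<forall>y\<in>E. cmod (f y) + norm (y - f y *\<^sub>C e) \<le> norm y)"

lemma dyadic_Cauchy_limit:
  fixes h :: "nat \<Rightarrow> 'a::banach"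
  assumes "\<And>k. norm (h (Suc k) - h k) \<le> C * (1/2)^k"
  obtains l where "h \<longlonglongrightarrow> l" "norm (l - h 0) \<le> 2 * C"
proof -
  have geo: "(\<lambda>k. C * (1/2)^k) sums (C * 2)"
    using sums_mult[OF geometric_sums[of "1/2::real"], of C] by simp
  have sn: "summable (\<lambda>k. norm (h (Suc k) - h k))"
    by (rule summable_comparison_test'[OF sums_summable[OF geo]]) (use assms in simp)
  let ?s = "\<Sum>k. h (Suc k) - h k"
  have "(\<lambda>m. \<Sum>k<m. h (Suc k) - h k) \<longlonglongrightarrow> ?s"
    by (rule summable_LIMSEQ[OF summable_norm_cancel[OF sn]])
  then have "(\<lambda>m. (h m - h 0) + h 0) \<longlonglongrightarrow> ?s + h 0"
    unfolding sum_lessThan_telescope by (rule tendsto_add[OF _ tendsto_const])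
  moreover have "norm ?s \<le> (\<Sum>k. norm (h (Suc k) - h k))" by (rule summable_norm[OF sn])
  moreover have "\<dots> \<le> C * 2"
    using suminf_le[OF assms sn sums_summable[OF geo]] sums_unique[OF geo] by simp
  ultimately show ?thesis by (intro that[of "?s + h 0"]) auto
qed

context ell1_factorable
begin

lemma almost_L_line_functional_le:
  assumes "almost_L_line E eps x f" "y \<in> E"
  shows "cmod (f y) \<le> (1 + eps) * norm y"
proof -
  have "cmod (f y) + norm (y - f y *\<^sub>C x) \<le> (1 + eps) * norm y"
    using assms unfolding almost_L_line_def by blast
  then show ?thesis using norm_ge_zero[of "y - f y *\<^sub>C x"] by linarith
qed

text \<open>Apply \<open>almost_L_line_near_max\<close> to \<open>f\<close> divided by its norm. At
  the resulting \<open>x'\<close> the value of \<open>f\<close> is nearly 1, so the inequality for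
  \<open>(x, f)\<close>, tested at \<open>x'\<close>, leaves at most \<open>3 * eps\<close> for the
  distance between \<open>x'\<close> and \<open>f x' *\<^sub>C x\<close>.\<close>

lemma almost_L_line_improve:
  assumes eps: "0 < eps'" "eps' \<le> eps" "eps \<le> 1 / 10" and xf: "almost_L_line E eps x f"
  shows "\<exists>x' f'. almost_L_line E eps' x' f' \<and> norm (x' - x) \<le> 5 * eps \<and> cmod (f x' - 1) \<le> 2 * eps"
proof -
  have x: "x \<in> E" "norm x \<le> 1" and f: "cfunctional E f" and fx: "cmod (f x - 1) \<le> eps"
    and line: "\<And>y. y \<in> E \<Longrightarrow> cmod (f y) + norm (y - f y *\<^sub>C x) \<le> (1 + eps) * norm y"
    using xf unfolding almost_L_line_def by auto
  have f_scale: "f (c *\<^sub>C y) = c * f y" if "y \<in> E" for c y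
    using f that unfolding cfunctional_def by blast
  define S where "S = (\<lambda>y. cmod (f y)) ` {y\<in>E. norm y \<le> 1}"
  define N where "N = Sup S"
  have f_ball: "cmod (f y) \<le> 1 + eps" if "y \<in> E" "norm y \<le> 1" for y
  proof -
    have "(1 + eps) * norm y \<le> (1 + eps) * 1" using that eps by (intro mult_left_mono) auto
    with almost_L_line_functional_le[OF xf that(1)] show ?thesis by simp
  qed
  then have bdd: "bdd_above S" by (auto simp: S_def intro!: bdd_aboveI)
  have N_up: "cmod (f y) \<le> N" if "y \<in> E" "norm y \<le> 1" for y
    unfolding N_def by (rule cSup_upper[OF _ bdd]) (use that in \<open>auto simp: S_def\<close>)
  have N: "N \<ge> 1 - eps"
    using N_up[OF x] norm_triangle_ineq3[of "f x" 1] fx by simp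
  then have N0: "N > 0" using eps by linarith
  have f_N: "cmod (f y) \<le> N * norm y" if "y \<in> E" for y
  proof (cases "y = 0")
    case True
    then show ?thesis using f_scale[OF that, of 0] by simp
  next
    case False
    have "cmod (f (complex_of_real (1 / norm y) *\<^sub>C y)) \<le> N"
      by (rule N_up) (use that False in \<open>auto simp: norm_cscale cscale_mem norm_divide\<close>)
    then show ?thesis
      unfolding f_scale[OF that] using False by (simp add: norm_mult norm_divide field_simps)
  qed
  \<comment> \<open>The factor 30 is the loss in \<open>almost_L_line_near_max\<close>.\<close>
  define \<delta> where "\<delta> = eps' / 30"
  have \<delta>: "0 < \<delta>" "\<delta> \<le> 1 / 10" using eps by (auto simp: \<delta>_def)
  have "N * (1 - \<delta>) < N" using N0 \<delta> by (simp add: algebra_simps)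
  then have "\<exists>z\<in>S. N * (1 - \<delta>) < z"
    unfolding N_def by (intro less_cSupD) (use x in \<open>auto simp: S_def\<close>)
  then obtain x0 where x0: "x0 \<in> E" "norm x0 \<le> 1" "N * (1 - \<delta>) < cmod (f x0)"
    by (auto simp: S_def)
  define \<tau> where "\<tau> = cnj (sgn (f x0))"
  have "cmod (f x0) > 0" by (rule le_less_trans[OF _ x0(3)]) (use N0 \<delta> in simp)
  then have \<tau>: "cmod \<tau> = 1" "\<tau> * f x0 = complex_of_real (cmod (f x0))"
    by (auto simp: \<tau>_def norm_sgn cnj_sgn_mult)
  define g where "g = (\<lambda>y. complex_of_real (1 / N) * f y)"
  have g: "cfunctional E g" unfolding g_def by (rule functional_cmult[OF f])
  have g_le: "cmod (g y) \<le> norm y" if "y \<in> E" for y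
    using f_N[OF that] N0 by (simp add: g_def norm_mult norm_divide field_simps)
  have "g (\<tau> *\<^sub>C x0) = complex_of_real (cmod (f x0) / N)"
    unfolding g_def f_scale[OF x0(1)] \<tau>(2) by simp
  then have "Re (g (\<tau> *\<^sub>C x0)) = cmod (f x0) / N" by (simp only: Re_complex_of_real)
  moreover have "1 - \<delta> < cmod (f x0) / N"
    using x0(3) N0 by (simp add: pos_less_divide_eq mult.commute)
  ultimately have "Re (g (\<tau> *\<^sub>C x0)) \<ge> 1 - \<delta>" by linarith
  then obtain x' f' r where *: "almost_L_line E (30 * \<delta>) x' f'" "g x' = complex_of_real r" "r \<ge> 1 - 6 * \<delta>"
    using almost_L_line_near_max[OF \<delta> g g_le cscale_mem[OF x0(1), of \<tau>]] x0(2) \<tau>(1)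
    by (auto simp: norm_cscale)
  then have x'f': "almost_L_line E eps' x' f'" by (simp add: \<delta>_def)
  then have x': "x' \<in> E" "norm x' \<le> 1" by (auto simp: almost_L_line_def)
  have fx': "f x' = complex_of_real (N * r)" using *(2) N0 by (simp add: g_def field_simps)
  have r: "r \<ge> 1 - eps" using *(3) eps by (simp add: \<delta>_def)
  have "(1 - eps) * (1 - eps) \<le> N * r" using N r eps N0 by (intro mult_mono) auto
  moreover have "1 - 2 * eps \<le> (1 - eps) * (1 - eps)" by (simp add: algebra_simps)
  ultimately have lo: "1 - 2 * eps \<le> N * r" by linarith
  then have pos: "0 \<le> N * r" using eps by linarith
  have up: "N * r \<le> 1 + eps" using f_ball[OF x'] pos by (simp only: fx' norm_of_real abs_of_nonneg)
  have fx'1: "cmod (f x' - 1) \<le> 2 * eps"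
  proof -
    have "f x' - 1 = complex_of_real (N * r - 1)" by (simp add: fx')
    then have "cmod (f x' - 1) = \<bar>N * r - 1\<bar>" by (simp only: norm_of_real)
    then show ?thesis using lo up eps by linarith
  qed
  have "cmod (f x') + norm (x' - f x' *\<^sub>C x) \<le> (1 + eps) * norm x'" by (rule line[OF x'(1)])
  also have "\<dots> \<le> (1 + eps) * 1" using x' eps by (intro mult_left_mono) auto
  finally have "cmod (f x') + norm (x' - f x' *\<^sub>C x) \<le> 1 + eps" by simp
  then have 1: "norm (x' - f x' *\<^sub>C x) \<le> 3 * eps"
    using lo pos up by (smt (verit) fx' norm_of_real)
  have "norm ((f x' - 1) *\<^sub>C x) \<le> 2 * eps * 1"
    unfolding norm_cscale using fx'1 x eps by (intro mult_mono) auto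
  then have "norm ((x' - f x' *\<^sub>C x) + (f x' - 1) *\<^sub>C x) \<le> 5 * eps"
    using 1 by (intro norm_triangle_le) simp
  moreover have "(x' - f x' *\<^sub>C x) + (f x' - 1) *\<^sub>C x = x' - x"
    by (simp add: cscale_diff_left)
  ultimately have "norm (x' - x) \<le> 5 * eps" by simp
  with x'f' fx'1 show ?thesis by blast
qed

text \<open>Test the inequality for \<open>(x, f)\<close> on
  \<open>v = y - f' y *\<^sub>C x'\<close>. Up to multiples of \<open>eps * norm y\<close>,
  \<open>f v\<close> is \<open>f y - f' y\<close>, the remainder of \<open>v\<close> is that of
  \<open>y\<close> and thus has norm at least \<open>norm y - cmod (f y)\<close>, and
  \<open>norm v\<close> is at most \<open>norm y - cmod (f' y)\<close>. The errors add up to 14 + 28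
  + 3. When the two pairs are exchanged, \<open>cmod (f' y) - cmod (f y)\<close> changes sign, so
  the two bounds together control \<open>f y - f' y\<close>.\<close>

lemma almost_L_line_functional_close_half:
  assumes eps: "0 < eps" "eps \<le> 1 / 10" and xf: "almost_L_line E eps x f"
    and f': "\<And>y. y \<in> E \<Longrightarrow> cmod (f' y) + norm (y - f' y *\<^sub>C x') \<le> (1 + eps) * norm y"
    and x': "x' \<in> E" "norm (x' - x) \<le> 7 * eps" "cmod (f x' - 1) \<le> 7 * eps" and y: "y \<in> E"
  shows "cmod (f y - f' y) + cmod (f' y) - cmod (f y) \<le> 45 * eps * norm y"
proof -
  have x: "x \<in> E" "norm x \<le> 1" and f: "cfunctional E f"
    and line: "\<And>y. y \<in> E \<Longrightarrow> cmod (f y) + norm (y - f y *\<^sub>C x) \<le> (1 + eps) * norm y"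
    using xf unfolding almost_L_line_def by auto
  define c where "c = f y"
  define c' where "c' = f' y"
  define v where "v = y - c' *\<^sub>C x'"
  have v: "v \<in> E" "norm v \<le> (1 + eps) * norm y - cmod c'"
    using f'[OF y] x' y by (auto simp: v_def c'_def diff_mem cscale_mem)
  have c': "cmod c' \<le> 2 * norm y"
  proof -
    have "(1 + eps) * norm y \<le> 2 * norm y" using eps by (intro mult_right_mono) auto
    with f'[OF y] norm_ge_zero[of "y - f' y *\<^sub>C x'"] show ?thesis unfolding c'_def by linarith
  qed
  have fv: "f v = (c - c') - c' * (f x' - 1)"
  proof -
    have "f (c' *\<^sub>C x') = c' * f x'" using f x' unfolding cfunctional_def by blast
    then show ?thesis
      using functional_diff[OF f y cscale_mem[OF x'(1), of c']]
      by (simp add: v_def c_def algebra_simps)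
  qed
  have err: "cmod c' * cmod (f x' - 1) \<le> 14 * (eps * norm y)" "cmod c' * norm (x' - x) \<le> 14 * (eps * norm y)"
    using mult_mono[OF c' x'(3)] mult_mono[OF c' x'(2)] by (simp_all add: mult_ac)
  have "cmod (c - c') \<le> cmod (f v) + cmod (c' * (f x' - 1))"
    using norm_triangle_ineq[of "f v" "c' * (f x' - 1)"] by (simp add: fv)
  then have 1: "cmod (f v) \<ge> cmod (c - c') - 14 * (eps * norm y)"
    using err(1) by (simp add: norm_mult)
  have "y - c *\<^sub>C x = (v - f v *\<^sub>C x) + (c' *\<^sub>C (x' - x) - (c' * (f x' - 1)) *\<^sub>C x)"
    unfolding fv by (simp add: v_def cscale_diff_left cscale_diff_right)
  then have "norm (y - c *\<^sub>C x) \<le> norm (v - f v *\<^sub>C x) + norm (c' *\<^sub>C (x' - x) - (c' * (f x' - 1)) *\<^sub>C x)"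
    by (metis norm_triangle_ineq)
  also have "norm (c' *\<^sub>C (x' - x) - (c' * (f x' - 1)) *\<^sub>C x)
      \<le> cmod c' * norm (x' - x) + cmod c' * cmod (f x' - 1) * norm x"
    using norm_triangle_ineq4[of "c' *\<^sub>C (x' - x)" "(c' * (f x' - 1)) *\<^sub>C x"]
    by (simp add: norm_cscale norm_mult)
  also have "cmod c' * cmod (f x' - 1) * norm x \<le> cmod c' * cmod (f x' - 1)"
    using x by (simp add: mult_left_le)
  finally have 2: "norm (v - f v *\<^sub>C x) \<ge> norm (y - c *\<^sub>C x) - 28 * (eps * norm y)"
    using err by linarith
  have 3: "norm (y - c *\<^sub>C x) \<ge> norm y - cmod c"
  proof -
    have "norm (c *\<^sub>C x) \<le> cmod c" using x by (simp add: norm_cscale mult_left_le)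
    then show ?thesis using norm_triangle_ineq2[of y "c *\<^sub>C x"] by linarith
  qed
  have "cmod (f v) + norm (v - f v *\<^sub>C x) \<le> (1 + eps) * norm v" by (rule line[OF v(1)])
  also have "\<dots> \<le> (1 + eps) * ((1 + eps) * norm y - cmod c')" using v eps by (intro mult_left_mono) auto
  also have "\<dots> = norm y + 2 * (eps * norm y) + eps * (eps * norm y) - cmod c' - eps * cmod c'"
    by (simp add: algebra_simps)
  also have "\<dots> \<le> norm y + 3 * (eps * norm y) - cmod c'"
  proof -
    have "eps * (eps * norm y) \<le> 1 * (eps * norm y)" using eps by (intro mult_right_mono) auto
    moreover have "0 \<le> eps * cmod c'" using eps by simp
    ultimately show ?thesis by linarith
  qed
  finally have "cmod (c - c') + cmod c' - cmod c \<le> 45 * (eps * norm y)"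
    using 1 2 3 by linarith
  then show ?thesis by (simp add: c_def c'_def mult.assoc)
qed

lemma almost_L_line_functional_close:
  assumes eps: "0 < eps'" "eps' \<le> eps" "eps \<le> 1 / 10"
    and xf: "almost_L_line E eps x f" and xf': "almost_L_line E eps' x' f'"
    and d: "norm (x' - x) \<le> 5 * eps" "cmod (f x' - 1) \<le> 2 * eps" and y: "y \<in> E"
  shows "cmod (f' y - f y) \<le> 45 * eps * norm y"
proof -
  have mono: "(1 + eps') * norm z \<le> (1 + eps) * norm z" for z :: 'a
    using eps by (intro mult_right_mono) auto
  have xf'': "almost_L_line E eps x' f'"
    using xf' eps order_trans[OF _ mono] unfolding almost_L_line_def by fastforce
  have x: "x \<in> E" and x': "x' \<in> E" and f': "cfunctional E f'" and f'x': "cmod (f' x' - 1) \<le> eps"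
    using xf xf'' unfolding almost_L_line_def by auto
  have line: "\<And>z. z \<in> E \<Longrightarrow> cmod (f z) + norm (z - f z *\<^sub>C x) \<le> (1 + eps) * norm z"
    and line': "\<And>z. z \<in> E \<Longrightarrow> cmod (f' z) + norm (z - f' z *\<^sub>C x') \<le> (1 + eps) * norm z"
    using xf xf'' unfolding almost_L_line_def by auto
  have eps0: "0 < eps" using eps by linarith
  have dx: "norm (x - x') \<le> 5 * eps" using d(1) by (simp add: norm_minus_commute)
  \<comment> \<open>The hypotheses are not symmetric in the two pairs: the bound on
    \<open>f' x - 1\<close> has to be derived and comes out as \<open>7 * eps\<close>, which is why
    the preceding lemma tolerates this much.\<close>
  have "cmod (f' (x - x')) \<le> (1 + eps) * norm (x - x')"
    by (rule almost_L_line_functional_le[OF xf'' diff_mem[OF x x']])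
  also have "\<dots> \<le> (11 / 10) * (5 * eps)" using dx eps by (intro mult_mono) auto
  finally have "cmod (f' x - f' x') \<le> 6 * eps"
    using eps0 by (simp add: functional_diff[OF f' x x'])
  then have "cmod (f' x - 1) \<le> 7 * eps"
    using norm_triangle_ineq[of "f' x - f' x'" "f' x' - 1"] f'x' by simp
  then have "cmod (f' y - f y) + cmod (f y) - cmod (f' y) \<le> 45 * eps * norm y"
    using dx eps0 by (intro almost_L_line_functional_close_half[OF eps0 eps(3) xf'' line x _ _ y]) auto
  moreover have "cmod (f y - f' y) + cmod (f' y) - cmod (f y) \<le> 45 * eps * norm y"
    using d eps0 by (intro almost_L_line_functional_close_half[OF eps0 eps(3) xf line' x' _ _ y]) auto
  ultimately show ?thesis using norm_minus_commute[of "f y" "f' y"] by linarith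
qed

text \<open>Halve the error at every improvement. The vectors move by at most
  \<open>5 * eps * (1/2)^k\<close> in step \<open>k\<close>, so by \<open>10 * eps\<close>
  altogether; the functionals converge by \<open>almost_L_line_functional_close\<close>, although
  each comes from a fresh factorization.\<close>

lemma L_line_near_almost_L_line:
  assumes eps: "0 < eps" "eps \<le> 1 / 10" and xf: "almost_L_line E eps x f"
  shows "\<exists>e f. L_line E e f \<and> norm (e - x) \<le> 10 * eps"
proof -
  define \<eta> where "\<eta> k = eps * (1/2)^k" for k :: nat
  have \<eta>: "0 < \<eta> k" "\<eta> (Suc k) \<le> \<eta> k" "\<eta> k \<le> 1 / 10" for k
  proof -
    have "eps * (1/2)^k \<le> eps * 1" using eps by (intro mult_left_mono power_le_one) auto
    with eps show "\<eta> k \<le> 1 / 10" unfolding \<eta>_def by linarith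
  qed (use eps in \<open>auto simp: \<eta>_def\<close>)
  have "\<exists>p. p 0 = (x, f) \<and> (\<forall>k. almost_L_line E (\<eta> k) (fst (p k)) (snd (p k)) \<and>
      (norm (fst (p (Suc k)) - fst (p k)) \<le> 5 * \<eta> k \<and> cmod (snd (p k) (fst (p (Suc k))) - 1) \<le> 2 * \<eta> k))"
  proof -
    \<comment> \<open>The clause for \<open>k = 0\<close> pins the start of the chosen sequence to
      the given pair.\<close>
    define P where "P k q \<longleftrightarrow> almost_L_line E (\<eta> k) (fst q) (snd q) \<and> (k = 0 \<longrightarrow> q = (x, f))" for k q
    define R where "R k q q' \<longleftrightarrow> norm (fst q' - fst q) \<le> 5 * \<eta> k \<and> cmod (snd q (fst q') - 1) \<le> 2 * \<eta> k"
      for k and q q' :: "'a \<times> ('a \<Rightarrow> complex)"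
    have "\<exists>p. \<forall>k. P k (p k) \<and> R k (p k) (p (Suc k))"
    proof (intro dependent_nat_choice)
      show "\<exists>q. P 0 q" using xf by (auto simp: P_def \<eta>_def)
    next
      fix q k assume "P k q"
      then obtain x' f' where "almost_L_line E (\<eta> (Suc k)) x' f'" "R k q (x', f')"
        using almost_L_line_improve[OF \<eta>(1,2,3)] unfolding P_def R_def by fastforce
      then show "\<exists>q'. P (Suc k) q' \<and> R k q q'" unfolding P_def by force
    qed
    then show ?thesis unfolding P_def R_def by blast
  qed
  then obtain p where p0: "p 0 = (x, f)"
    and p: "\<And>k. almost_L_line E (\<eta> k) (fst (p k)) (snd (p k))"
      "\<And>k. norm (fst (p (Suc k)) - fst (p k)) \<le> 5 * \<eta> k"
      "\<And>k. cmod (snd (p k) (fst (p (Suc k))) - 1) \<le> 2 * \<eta> k"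
    by blast
  define X where "X k = fst (p k)" for k
  define \<Phi> where "\<Phi> k = snd (p k)" for k
  have X: "X k \<in> E" "norm (X k) \<le> 1" and \<Phi>: "cfunctional E (\<Phi> k)" "cmod (\<Phi> k (X k) - 1) \<le> \<eta> k"
    "\<And>y. y \<in> E \<Longrightarrow> cmod (\<Phi> k y) + norm (y - \<Phi> k y *\<^sub>C X k) \<le> (1 + \<eta> k) * norm y" for k
    using p(1)[of k] unfolding almost_L_line_def X_def \<Phi>_def by auto
  have \<Phi>_le: "cmod (\<Phi> k y) \<le> 2 * norm y" if "y \<in> E" for k y
  proof -
    have "(1 + \<eta> k) * norm y \<le> 2 * norm y" using \<eta>[of k] by (intro mult_right_mono) auto
    with almost_L_line_functional_le[OF p(1) that, of k] show ?thesis by (simp add: \<Phi>_def)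
  qed
  obtain e where e: "X \<longlonglongrightarrow> e" "norm (e - X 0) \<le> 2 * (5 * eps)"
    by (rule dyadic_Cauchy_limit[of X "5 * eps"]) (use p(2) in \<open>auto simp: X_def \<eta>_def mult.assoc\<close>)
  have eE: "e \<in> E" by (rule closed_sequentially[OF closed X(1) e(1)])
  have "\<exists>l. (\<lambda>k. \<Phi> k y) \<longlonglongrightarrow> l" if y: "y \<in> E" for y
  proof -
    have "cmod (\<Phi> (Suc k) y - \<Phi> k y) \<le> 45 * eps * norm y * (1/2)^k" for k
      using almost_L_line_functional_close[OF \<eta> p(1,1,2,3) y, of k] by (simp add: \<Phi>_def \<eta>_def mult_ac)
    then show ?thesis by (rule dyadic_Cauchy_limit) blast
  qed
  then obtain F where F: "\<And>y. y \<in> E \<Longrightarrow> (\<lambda>k. \<Phi> k y) \<longlonglongrightarrow> F y" by metis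
  have \<eta>_lim: "\<eta> \<longlonglongrightarrow> 0"
    unfolding \<eta>_def[abs_def] by (rule tendsto_mult_right_zero) (simp add: LIMSEQ_power_zero)
  have "cfunctional E F"
    unfolding cfunctional_def
  proof (intro conjI ballI allI exI)
    fix y z assume yz: "y \<in> E" "z \<in> E"
    have "(\<lambda>k. \<Phi> k (y + z)) \<longlonglongrightarrow> F y + F z"
      using tendsto_add[OF F[OF yz(1)] F[OF yz(2)]] \<Phi>(1) yz unfolding cfunctional_def by simp
    with F[OF add_mem[OF yz]] show "F (y + z) = F y + F z" by (rule LIMSEQ_unique)
  next
    fix c y assume y: "y \<in> E"
    have "(\<lambda>k. \<Phi> k (c *\<^sub>C y)) \<longlonglongrightarrow> c * F y"
      using tendsto_mult[OF tendsto_const F[OF y]] \<Phi>(1) y unfolding cfunctional_def by simp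
    with F[OF cscale_mem[OF y]] show "F (c *\<^sub>C y) = c * F y" by (rule LIMSEQ_unique)
  next
    fix y assume y: "y \<in> E"
    show "cmod (F y) \<le> 2 * norm y"
      by (rule tendsto_upperbound[OF tendsto_norm[OF F[OF y]]]) (use \<Phi>_le[OF y] in auto)
  qed
  moreover have "F e = 1"
  proof (rule LIMSEQ_unique[OF F[OF eE]])
    have "(\<lambda>k. \<eta> k + 2 * norm (e - X k)) \<longlonglongrightarrow> 0 + 2 * norm (e - e)"
      by (intro tendsto_intros \<eta>_lim e)
    moreover have "norm (\<Phi> k e - 1) \<le> \<eta> k + 2 * norm (e - X k)" for k
    proof -
      have "norm (\<Phi> k (e - X k) + (\<Phi> k (X k) - 1)) \<le> \<eta> k + 2 * norm (e - X k)"
        using \<Phi>(2)[of k] \<Phi>_le[OF diff_mem[OF eE X(1)[of k]], of k]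
        by (intro norm_triangle_le) simp
      then show ?thesis by (simp add: functional_diff[OF \<Phi>(1) eE X(1)])
    qed
    ultimately have "(\<lambda>k. \<Phi> k e - 1) \<longlonglongrightarrow> 0"
      by (intro Lim_null_comparison[of "\<lambda>k. \<Phi> k e - 1" "\<lambda>k. \<eta> k + 2 * norm (e - X k)"]) auto
    then show "(\<lambda>k. \<Phi> k e) \<longlonglongrightarrow> 1" by (rule LIM_zero_cancel)
  qed
  moreover have "cmod (F y) + norm (y - F y *\<^sub>C e) \<le> norm y" if y: "y \<in> E" for y
  proof (rule tendsto_le[OF sequentially_bot])
    show "(\<lambda>k. cmod (\<Phi> k y) + norm (y - \<Phi> k y *\<^sub>C X k)) \<longlonglongrightarrow> cmod (F y) + norm (y - F y *\<^sub>C e)"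
      by (intro tendsto_intros tendsto_cscale F y e)
    have "(\<lambda>k. (1 + \<eta> k) * norm y) \<longlonglongrightarrow> (1 + 0) * norm y"
      by (intro tendsto_intros \<eta>_lim)
    then show "(\<lambda>k. (1 + \<eta> k) * norm y) \<longlonglongrightarrow> norm y" by simp
  qed (use \<Phi>(3)[OF y] in simp)
  moreover have "norm e \<le> 1"
    by (rule tendsto_upperbound[OF tendsto_norm[OF e(1)]]) (use X in auto)
  ultimately have "L_line E e F" using eE unfolding L_line_def by blast
  moreover have "norm (e - x) \<le> 10 * eps" using e(2) p0 by (simp add: X_def)
  ultimately show ?thesis by blast
qed

text \<open>Put \<open>a = f e'\<close> and \<open>b = f' e\<close>. The remainder
  \<open>r = e' - a *\<^sub>C e\<close> has norm at most \<open>1 - cmod a\<close>, so the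
  inequality for \<open>(e', f')\<close> at \<open>r\<close> gives
  \<open>1 - cmod a * cmod b + cmod a * (1 - cmod b) \<le> 1 - cmod a\<close>. For nonzero
  \<open>a\<close> this forces \<open>cmod b \<ge> 1\<close>, and then the inequality for
  \<open>(e', f')\<close> at \<open>e\<close> leaves no room for
  \<open>e - b *\<^sub>C e'\<close>.\<close>

lemma L_lines_orthogonal_or_parallel:
  assumes L: "L_line E e f" and L': "L_line E e' f'" and nz: "f e' \<noteq> 0"
  shows "cmod (f' e) = 1" "e = f' e *\<^sub>C e'"
proof -
  have e: "e \<in> E" "norm e \<le> 1" and f: "cfunctional E f"
    and line: "\<And>y. y \<in> E \<Longrightarrow> cmod (f y) + norm (y - f y *\<^sub>C e) \<le> norm y"
    using L unfolding L_line_def by auto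
  have e': "e' \<in> E" "norm e' \<le> 1" "f' e' = 1" and f': "cfunctional E f'"
    and line': "\<And>y. y \<in> E \<Longrightarrow> cmod (f' y) + norm (y - f' y *\<^sub>C e') \<le> norm y"
    using L' unfolding L_line_def by auto
  define a where "a = f e'"
  define b where "b = f' e"
  define r where "r = e' - a *\<^sub>C e"
  have b: "cmod b \<le> 1" "norm (e - b *\<^sub>C e') \<le> 1 - cmod b"
    using line'[OF e(1)] e(2) norm_ge_zero[of "e - f' e *\<^sub>C e'"] unfolding b_def by linarith+
  have r: "r \<in> E" "norm r \<le> 1 - cmod a"
    using line[OF e'(1)] e'(2) e e' by (auto simp: r_def a_def diff_mem cscale_mem)
  have f'r: "f' r = 1 - a * b"
  proof -
    have "f' (a *\<^sub>C e) = a * b" using f' e unfolding cfunctional_def b_def by blast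
    then show ?thesis
      using functional_diff[OF f' e'(1) cscale_mem[OF e(1), of a]] e' by (simp add: r_def)
  qed
  have "r - f' r *\<^sub>C e' = - (a *\<^sub>C (e - b *\<^sub>C e'))"
    unfolding f'r by (simp add: r_def cscale_diff_left cscale_diff_right cscale_cscale)
  then have nr: "norm (r - f' r *\<^sub>C e') = cmod a * norm (e - b *\<^sub>C e')"
    by (simp add: norm_cscale)
  have e_norm: "norm e \<ge> 1"
    using line[OF e(1)] L by (simp add: L_line_def)
  have "norm (e - b *\<^sub>C e') \<ge> 1 - cmod b"
    using norm_triangle_ineq2[of e "b *\<^sub>C e'"] e_norm e'(2) mult_left_le[of "norm e'" "cmod b"]
    by (simp add: norm_cscale)
  then have "cmod a * (1 - cmod b) \<le> norm (r - f' r *\<^sub>C e')"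
    unfolding nr by (intro mult_left_mono) auto
  moreover have "1 - cmod a * cmod b \<le> cmod (f' r)"
    using norm_triangle_ineq2[of 1 "a * b"] by (simp add: f'r norm_mult)
  ultimately have "1 - cmod a * cmod b + cmod a * (1 - cmod b) \<le> 1 - cmod a"
    using line'[OF r(1)] r(2) by linarith
  then have "cmod a * 1 \<le> cmod a * cmod b" by (simp add: algebra_simps)
  then have "1 \<le> cmod b" using nz by (simp add: a_def)
  with b show "cmod (f' e) = 1" "e = f' e *\<^sub>C e'" by (simp_all add: b_def)
qed

text \<open>Representatives of different lines annihilate each other, so their rank-one projections
  add up to an L-projection \<open>P\<close> onto the closed span of \<open>\<Lambda>\<close>; what
  remains is that \<open>P\<close> is the identity. The last conclusion says that the coefficient
  map is onto l1(Lambda).\<close>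

theorem ell1_structure:
  obtains \<Lambda> :: "'a set" and f :: "'a \<Rightarrow> 'a \<Rightarrow> complex" where "\<Lambda> \<subseteq> E"
    "\<And>e. e \<in> \<Lambda> \<Longrightarrow> cfunctional E (f e)"
    "\<And>y. y \<in> E \<Longrightarrow> (\<lambda>e. cmod (f e y)) summable_on \<Lambda>"
    "\<And>y. y \<in> E \<Longrightarrow> (\<Sum>\<^sub>\<infinity>e\<in>\<Lambda>. cmod (f e y)) = norm y"
    "\<And>c. (\<lambda>e. cmod (c e)) summable_on \<Lambda> \<Longrightarrow> \<exists>y\<in>E. \<forall>e\<in>\<Lambda>. f e y = c e"
proof -
  define A where "A = {e. \<exists>f. L_line E e f}"
  \<comment> \<open>Unimodular multiples of a vector span the same line, so \<open>\<Lambda>\<close>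
    may contain only one vector of each class.\<close>
  define par where "par e e' \<longleftrightarrow> (\<exists>c. cmod c = 1 \<and> e = c *\<^sub>C e')" for e e' :: 'a
  have par_refl: "par e e" for e unfolding par_def by (rule exI[of _ 1]) simp
  have par_sym: "par e' e" if par: "par e e'" for e e'
  proof -
    obtain c where c: "cmod c = 1" "e = c *\<^sub>C e'" using par unfolding par_def by blast
    moreover have "inverse c * c = 1" using c(1) by (intro left_inverse) auto
    ultimately show ?thesis
      unfolding par_def by (intro exI[of _ "inverse c"]) (simp add: norm_inverse cscale_cscale)
  qed
  have par_trans: "par e e''" if "par e e'" "par e' e''" for e e' e''
    using that unfolding par_def by (metis cscale_cscale mult_1 norm_mult)
  define rep where "rep e = (SOME e'. e' \<in> A \<and> par e e')" for e
  have rep: "rep e \<in> A" "par e (rep e)" if "e \<in> A" for e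
    using someI[of "\<lambda>e'. e' \<in> A \<and> par e e'" e] that par_refl unfolding rep_def by auto
  have rep_eq: "rep e = rep e'" if "par e e'" for e e'
  proof -
    have "(\<lambda>z. z \<in> A \<and> par e z) = (\<lambda>z. z \<in> A \<and> par e' z)"
      using that par_sym par_trans by blast
    then show ?thesis unfolding rep_def by simp
  qed
  define \<Lambda> where "\<Lambda> = rep ` A"
  have \<Lambda>A: "\<Lambda> \<subseteq> A" using rep by (auto simp: \<Lambda>_def)
  have \<Lambda>_par: "e = e'" if "e \<in> \<Lambda>" "e' \<in> \<Lambda>" "par e e'" for e e'
    using that rep rep_eq par_sym unfolding \<Lambda>_def by (metis (no_types, lifting) imageE)
  define f where "f e = (SOME f. L_line E e f)" for e
  have f: "L_line E e (f e)" if "e \<in> A" for e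
    using that someI_ex[of "L_line E e"] unfolding A_def f_def by blast
  have \<Lambda>f: "e \<in> E" "norm e \<le> 1" "cfunctional E (f e)" "f e e = 1"
    "\<And>y. y \<in> E \<Longrightarrow> cmod (f e y) + norm (y - f e y *\<^sub>C e) \<le> norm y" if "e \<in> \<Lambda>" for e
    using f[of e] that \<Lambda>A unfolding L_line_def by auto
  have orth: "f e e' = 0" if "e \<in> \<Lambda>" "e' \<in> \<Lambda>" "e \<noteq> e'" for e e'
  proof (rule ccontr)
    assume "f e e' \<noteq> 0"
    then have "par e e'"
      using L_lines_orthogonal_or_parallel[OF f f] that \<Lambda>A unfolding par_def by blast
    with that show False using \<Lambda>_par by blast
  qed
  \<comment> \<open>By orthogonality the remainder after the lines in \<open>F\<close> still has the
    value \<open>f e y\<close> under the next functional, so the next line splits exactly that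
    coefficient off the remaining norm.\<close>
  have fin: "(\<Sum>e\<in>F. cmod (f e y)) + norm (y - (\<Sum>e\<in>F. f e y *\<^sub>C e)) \<le> norm y"
    if "finite F" "F \<subseteq> \<Lambda>" and y: "y \<in> E" for F y
    using that(1,2)
  proof (induction F)
    case (insert e F)
    define z where "z = y - (\<Sum>e\<in>F. f e y *\<^sub>C e)"
    have sE: "(\<Sum>e\<in>F. f e y *\<^sub>C e) \<in> E"
      using insert \<Lambda>f by (intro sum_mem cscale_mem) auto
    have zE: "z \<in> E" unfolding z_def by (rule diff_mem[OF y sE])
    have e: "e \<in> \<Lambda>" using insert by auto
    have "f e (\<Sum>e\<in>F. f e y *\<^sub>C e) = (\<Sum>e'\<in>F. f e (f e' y *\<^sub>C e'))"
      using insert \<Lambda>f(1) by (intro functional_sum[OF \<Lambda>f(3)[OF e]] cscale_mem) auto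
    also have "\<dots> = (\<Sum>e'\<in>F. f e' y * f e e')"
      using insert \<Lambda>f(1) \<Lambda>f(3)[OF e] unfolding cfunctional_def by (intro sum.cong) auto
    also have "\<dots> = 0" using insert orth[OF e] by (intro sum.neutral) auto
    finally have fz: "f e z = f e y"
      unfolding z_def functional_diff[OF \<Lambda>f(3)[OF e] y sE] by simp
    have "cmod (f e y) + norm (z - f e y *\<^sub>C e) \<le> norm z"
      using \<Lambda>f(5)[OF e zE] by (simp add: fz)
    moreover have "(\<Sum>e\<in>F. cmod (f e y)) + norm z \<le> norm y"
      using insert unfolding z_def by auto
    moreover have "z - f e y *\<^sub>C e = y - (\<Sum>e\<in>insert e F. f e y *\<^sub>C e)"
      using insert by (simp add: z_def algebra_simps)
    ultimately show ?case using insert by simp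
  qed simp
  have sum_F: "(\<Sum>e\<in>F. cmod (f e y)) \<le> norm y" if "finite F" "F \<subseteq> \<Lambda>" "y \<in> E" for F y
    using fin[OF that] norm_ge_zero[of "y - (\<Sum>e\<in>F. f e y *\<^sub>C e)"] by linarith
  have summable: "(\<lambda>e. cmod (f e y)) summable_on \<Lambda>" if "y \<in> E" for y
    by (rule nonneg_bdd_above_summable_on) (use sum_F that in \<open>auto intro!: bdd_aboveI\<close>)
  have synth: "\<exists>y\<in>E. ((\<lambda>e. c e *\<^sub>C e) has_sum y) \<Lambda> \<and> (\<forall>e\<in>\<Lambda>. f e y = c e)"
    if c: "(\<lambda>e. cmod (c e)) summable_on \<Lambda>" for c
  proof -
    have "(\<lambda>e. norm (c e *\<^sub>C e)) summable_on \<Lambda>"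
      by (rule summable_on_comparison_test[OF c]) (auto simp: norm_cscale mult_left_le \<Lambda>f(2))
    then have "(\<lambda>e. c e *\<^sub>C e) summable_on \<Lambda>" by (rule abs_summable_summable)
    then obtain y where y: "((\<lambda>e. c e *\<^sub>C e) has_sum y) \<Lambda>" unfolding summable_on_def by blast
    have mem: "c e *\<^sub>C e \<in> E" if "e \<in> \<Lambda>" for e by (rule cscale_mem[OF \<Lambda>f(1)[OF that]])
    have yE: "y \<in> E" by (rule csubspace_has_sum[OF sub closed y mem])
    have "f e y = c e" if e: "e \<in> \<Lambda>" for e
    proof (rule has_sum_unique)
      show "((\<lambda>e'. f e (c e' *\<^sub>C e')) has_sum f e y) \<Lambda>"
        by (rule functional_has_sum[OF \<Lambda>f(3)[OF e] y mem yE])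
      have fe: "f e (c e' *\<^sub>C e') = c e' * f e e'" if "e' \<in> \<Lambda>" for e'
        using \<Lambda>f(3)[OF e] \<Lambda>f(1)[OF that] unfolding cfunctional_def by blast
      show "((\<lambda>e'. f e (c e' *\<^sub>C e')) has_sum c e) \<Lambda>"
        by (rule has_sum_finite_neutralI[of "{e}"]) (use e fe orth[OF e] \<Lambda>f(4)[OF e] in auto)
    qed
    with y yE show ?thesis by blast
  qed
  define P where "P y = (\<Sum>\<^sub>\<infinity>e\<in>\<Lambda>. f e y *\<^sub>C e)" for y
  have P: "P y \<in> E" "((\<lambda>e. f e y *\<^sub>C e) has_sum P y) \<Lambda>" "\<And>e. e \<in> \<Lambda> \<Longrightarrow> f e (P y) = f e y" if y: "y \<in> E" for y
  proof -
    obtain z where z: "z \<in> E" "((\<lambda>e. f e y *\<^sub>C e) has_sum z) \<Lambda>" "\<forall>e\<in>\<Lambda>. f e z = f e y"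
      using synth[OF summable[OF y]] by blast
    moreover have "P y = z" unfolding P_def by (rule infsumI[OF z(2)])
    ultimately show "P y \<in> E" "((\<lambda>e. f e y *\<^sub>C e) has_sum P y) \<Lambda>" "\<And>e. e \<in> \<Lambda> \<Longrightarrow> f e (P y) = f e y" by auto
  qed
  have P_line: "(\<Sum>\<^sub>\<infinity>e\<in>\<Lambda>. cmod (f e y)) + norm (y - P y) \<le> norm y" if y: "y \<in> E" for y
  proof (rule tendsto_upperbound)
    show "((\<lambda>F. (\<Sum>e\<in>F. cmod (f e y)) + norm (y - (\<Sum>e\<in>F. f e y *\<^sub>C e)))
       \<longlongrightarrow> (\<Sum>\<^sub>\<infinity>e\<in>\<Lambda>. cmod (f e y)) + norm (y - P y)) (finite_subsets_at_top \<Lambda>)"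
      using P(2)[OF y] has_sum_infsum[OF summable[OF y]] unfolding has_sum_def
      by (intro tendsto_intros)
  qed (auto intro!: eventually_finite_subsets_at_top_weakI fin y)
  \<comment> \<open>Otherwise some functional vanishes on all lines yet almost attains its norm, and there is a line
    close to a point where it does.\<close>
  have total: "P y = y" if y: "y \<in> E" for y
  proof (rule ccontr)
    assume "P y \<noteq> y"
    define z where "z = y - P y"
    have z: "z \<in> E" "z \<noteq> 0" using \<open>P y \<noteq> y\<close> P(1)[OF y] y by (auto simp: z_def diff_mem)
    have fz: "f e z = 0" if "e \<in> \<Lambda>" for e
      using P[OF y] that by (simp add: z_def functional_diff[OF \<Lambda>f(3) y])
    then have Pz: "P z = 0" unfolding P_def by (intro infsum_0) simp
    \<comment> \<open>At the end \<open>cmod (g x)\<close> is at least \<open>1 - 6 * eps\<close>,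
      but also at most \<open>300 * eps\<close>, the distance from \<open>x\<close> to a line on
      which \<open>g\<close> vanishes. The value 1/1000 makes this contradictory and keeps
      \<open>30 * eps\<close> below 1/10.\<close>
    define eps :: real where "eps = 1 / 1000"
    have eps: "0 < eps" "eps \<le> 1 / 10" by (auto simp: eps_def)
    obtain \<psi> where \<psi>: "\<And>i. i \<in> I \<Longrightarrow> cfunctional E (\<psi> i)"
      "\<And>y. y \<in> E \<Longrightarrow> (\<lambda>i. cmod (\<psi> i y)) summable_on I"
      "\<And>y. y \<in> E \<Longrightarrow> (\<Sum>\<^sub>\<infinity>i\<in>I. cmod (\<psi> i y)) \<le> (1 + eps) * norm y"
      "\<And>y. y \<in> E \<Longrightarrow> norm y \<le> (\<Sum>\<^sub>\<infinity>i\<in>I. cmod (\<psi> i y))"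
      by (rule factorE[OF eps(1)]) blast
    \<comment> \<open>A functional that norms \<open>z\<close> up to the factor
      \<open>1 + eps\<close>, read off the factorization. Composed with \<open>1 - P\<close> it
      vanishes on all lines and keeps its bound, as \<open>P_line\<close> makes \<open>1 - P\<close>
      contractive; its value at \<open>z\<close> is unchanged because
      \<open>P z = 0\<close>.\<close>
    define h where "h y = (\<Sum>\<^sub>\<infinity>i\<in>I. cnj (sgn (\<psi> i z)) * \<psi> i y)" for y
    have h_term: "norm (cnj (sgn (\<psi> i z)) * \<psi> i y) \<le> cmod (\<psi> i y)" for i y
      by (simp add: norm_mult norm_sgn)
    have h_sum: "((\<lambda>i. cnj (sgn (\<psi> i z)) * \<psi> i y) has_sum h y) I" if "y \<in> E" for y
      unfolding h_def
      by (intro has_sum_infsum[OF abs_summable_summable] summable_on_comparison_test[OF \<psi>(2)[OF that]] h_term) simp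
    have h_le: "cmod (h y) \<le> (1 + eps) * norm y" if "y \<in> E" for y
      using norm_infsum_le[OF h_sum[OF that] has_sum_infsum[OF \<psi>(2)[OF that]] h_term] \<psi>(3)[OF that]
      by linarith
    have h: "cfunctional E h"
      by (rule functional_infsum[OF _ h_sum h_le]) (rule functional_cmult[OF \<psi>(1)])
    have h_z: "h z = complex_of_real (\<Sum>\<^sub>\<infinity>i\<in>I. cmod (\<psi> i z))"
    proof (rule has_sum_unique[OF h_sum[OF z(1)]])
      show "((\<lambda>i. cnj (sgn (\<psi> i z)) * \<psi> i z) has_sum complex_of_real (\<Sum>\<^sub>\<infinity>i\<in>I. cmod (\<psi> i z))) I"
        by (simp add: cnj_sgn_mult has_sum_of_real_iff has_sum_infsum \<psi>(2) z)
    qed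
    define s where "s = complex_of_real (1 / (1 + eps))"
    have s: "cmod s * (1 + eps) = 1"
      unfolding s_def norm_of_real by (simp add: eps_def)
    define g where "g y = s * (h y + (-1) * h (P y))" for y
    \<comment> \<open>Expanding \<open>P y\<close> writes \<open>h (P y)\<close> as the sum of
      \<open>h e * f e y\<close> over \<open>\<Lambda>\<close>, which yields linearity without a
      separate argument for \<open>P\<close>.\<close>
    have "cfunctional E (\<lambda>y. h (P y))"
    proof (rule functional_infsum)
      show "((\<lambda>e. h e * f e y) has_sum h (P y)) \<Lambda>" if "y \<in> E" for y
      proof -
        have "((\<lambda>e. h (f e y *\<^sub>C e)) has_sum h (P y)) \<Lambda>"
          by (rule functional_has_sum[OF h P(2)[OF that] cscale_mem[OF \<Lambda>f(1)] P(1)[OF that]])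
        then show ?thesis
          by (rule has_sum_cong[THEN iffD1, rotated]) (use h \<Lambda>f(1) in \<open>auto simp: cfunctional_def\<close>)
      qed
      show "cmod (h (P y)) \<le> (2 * (1 + eps)) * norm y" if "y \<in> E" for y
      proof -
        have "norm (P y) \<le> 2 * norm y"
          using norm_triangle_ineq4[of y "y - P y"] P_line[OF that]
            infsum_nonneg[of \<Lambda> "\<lambda>e. cmod (f e y)"] by simp
        then have "(1 + eps) * norm (P y) \<le> (1 + eps) * (2 * norm y)" using eps by (intro mult_left_mono) auto
        with h_le[OF P(1)[OF that]] show ?thesis by (simp add: mult_ac)
      qed
    qed (rule functional_cmult[OF \<Lambda>f(3)])
    then have g: "cfunctional E g"
      unfolding g_def by (intro functional_cmult cfunctional_add[OF sub] h)
    have g_le: "cmod (g w) \<le> norm w" if "w \<in> E" for w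
    proof -
      have "g w = s * h (w - P w)"
        using functional_diff[OF h that P(1)[OF that]] by (simp add: g_def)
      then have "cmod (g w) \<le> cmod s * ((1 + eps) * norm (w - P w))"
        using h_le[OF diff_mem[OF that P(1)[OF that]]] by (simp add: norm_mult mult_left_mono)
      also have "\<dots> = norm (w - P w)" using s by (simp flip: mult.assoc)
      also have "\<dots> \<le> norm w"
        using P_line[OF that] infsum_nonneg[of \<Lambda> "\<lambda>e. cmod (f e w)"] by simp
      finally show ?thesis .
    qed
    define x0 where "x0 = complex_of_real (1 / norm z) *\<^sub>C z"
    have x0: "x0 \<in> E" "norm x0 \<le> 1"
      using z by (auto simp: x0_def cscale_mem norm_cscale norm_divide)
    have "h 0 = 0" by (rule cfunctional_0[OF sub h])
    have "g x0 = complex_of_real (1 / norm z) * g z"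
      using g z(1) unfolding cfunctional_def x0_def by blast
    also have "\<dots> = complex_of_real ((1 / norm z) * (1 / (1 + eps)) * (\<Sum>\<^sub>\<infinity>i\<in>I. cmod (\<psi> i z)))"
      by (simp add: g_def Pz \<open>h 0 = 0\<close> h_z s_def)
    finally have "Re (g x0) = (1 / (1 + eps)) * ((\<Sum>\<^sub>\<infinity>i\<in>I. cmod (\<psi> i z)) / norm z)" by simp
    moreover have "(1 / (1 + eps)) * ((\<Sum>\<^sub>\<infinity>i\<in>I. cmod (\<psi> i z)) / norm z) \<ge> (1 / (1 + eps)) * 1"
      using \<psi>(4)[OF z(1)] z eps by (intro mult_left_mono) auto
    moreover have "(1 / (1 + eps)) * 1 \<ge> 1 - eps" by (simp add: eps_def)
    ultimately have gx0: "Re (g x0) \<ge> 1 - eps" by linarith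
    obtain x f0 r where x: "almost_L_line E (30 * eps) x f0" and gx: "g x = complex_of_real r" "r \<ge> 1 - 6 * eps"
      using almost_L_line_near_max[OF eps g g_le x0 gx0] by blast
    obtain e f1 where e: "L_line E e f1" "norm (e - x) \<le> 10 * (30 * eps)"
      using L_line_near_almost_L_line[OF _ _ x] by (auto simp: eps_def)
    have xE: "x \<in> E" using x by (simp add: almost_L_line_def)
    have eA: "e \<in> A" using e by (auto simp: A_def)
    have eE: "e \<in> E" using e by (simp add: L_line_def)
    obtain c where c: "cmod c = 1" "e = c *\<^sub>C rep e" using rep(2)[OF eA] unfolding par_def by blast
    have re: "rep e \<in> \<Lambda>" using eA by (simp add: \<Lambda>_def)
    have "P (rep e) = rep e"
    proof -
      have "((\<lambda>e'. f e' (rep e) *\<^sub>C e') has_sum rep e) \<Lambda>"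
        by (rule has_sum_finite_neutralI[of "{rep e}"]) (use re orth \<Lambda>f(4)[OF re] in auto)
      then show ?thesis unfolding P_def by (rule infsumI)
    qed
    then have "g (rep e) = 0" by (simp add: g_def)
    moreover have "g (c *\<^sub>C rep e) = c * g (rep e)"
      using g \<Lambda>f(1)[OF re] unfolding cfunctional_def by blast
    ultimately have "g e = 0" using c(2) by simp
    then have "cmod (g x) \<le> norm (e - x)"
      using g_le[OF diff_mem[OF eE xE]] by (simp add: functional_diff[OF g eE xE])
    then have "\<bar>r\<bar> \<le> 10 * (30 * eps)" using e(2) by (simp add: gx(1))
    with gx(2) show False by (simp add: eps_def)
  qed
  show ?thesis
  proof (rule that[of \<Lambda> f])
    show "\<Lambda> \<subseteq> E" using \<Lambda>f(1) by blast
    show "cfunctional E (f e)" if "e \<in> \<Lambda>" for e by (rule \<Lambda>f(3)[OF that])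
    show "(\<lambda>e. cmod (f e y)) summable_on \<Lambda>" if "y \<in> E" for y by (rule summable[OF that])
    show "\<exists>y\<in>E. \<forall>e\<in>\<Lambda>. f e y = c e" if "(\<lambda>e. cmod (c e)) summable_on \<Lambda>" for c
      using synth[OF that] by blast
    show "(\<Sum>\<^sub>\<infinity>e\<in>\<Lambda>. cmod (f e y)) = norm y" if y: "y \<in> E" for y
    proof (rule antisym)
      show "(\<Sum>\<^sub>\<infinity>e\<in>\<Lambda>. cmod (f e y)) \<le> norm y" using P_line[OF y] by (simp add: total[OF y])
      have "norm (P y) \<le> (\<Sum>\<^sub>\<infinity>e\<in>\<Lambda>. cmod (f e y))"
        by (rule norm_infsum_le[OF P(2)[OF y] has_sum_infsum[OF summable[OF y]]])
          (simp add: norm_cscale mult_left_le \<Lambda>f(2))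
      then show "norm y \<le> (\<Sum>\<^sub>\<infinity>e\<in>\<Lambda>. cmod (f e y))" by (simp add: total[OF y])
    qed
  qed
qed

end

section \<open>Carrier-based Banach spaces\<close>

context
  fixes V :: "'v nmod"
  assumes V: "cnormed_space V"
begin

lemma cnormed_zero: "mzero V \<in> mcarr V"
  and cnormed_add: "x \<in> mcarr V \<Longrightarrow> y \<in> mcarr V \<Longrightarrow> madd V x y \<in> mcarr V"
  and cnormed_smul: "x \<in> mcarr V \<Longrightarrow> msmul V c x \<in> mcarr V"
  and cnormed_commute: "x \<in> mcarr V \<Longrightarrow> y \<in> mcarr V \<Longrightarrow> madd V x y = madd V y x"
  and cnormed_add_zero: "x \<in> mcarr V \<Longrightarrow> madd V x (mzero V) = x"
  and cnormed_minus: "x \<in> mcarr V \<Longrightarrow> madd V x (msmul V (-1) x) = mzero V"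
  and cnormed_smul_one: "x \<in> mcarr V \<Longrightarrow> msmul V 1 x = x"
  and cnormed_smul_smul: "x \<in> mcarr V \<Longrightarrow> msmul V a (msmul V b x) = msmul V (a * b) x"
  and cnormed_smul_add_left: "x \<in> mcarr V \<Longrightarrow> msmul V (a + b) x = madd V (msmul V a x) (msmul V b x)"
  and cnormed_smul_add: "x \<in> mcarr V \<Longrightarrow> y \<in> mcarr V \<Longrightarrow>
      msmul V a (madd V x y) = madd V (msmul V a x) (msmul V a y)"
  and cnormed_norm_ge_0: "x \<in> mcarr V \<Longrightarrow> 0 \<le> mnorm V x"
  and cnormed_norm_eq_0: "x \<in> mcarr V \<Longrightarrow> mnorm V x = 0 \<longleftrightarrow> x = mzero V"
  and cnormed_norm_smul: "x \<in> mcarr V \<Longrightarrow> mnorm V (msmul V c x) = cmod c * mnorm V x"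
  and cnormed_triangle: "x \<in> mcarr V \<Longrightarrow> y \<in> mcarr V \<Longrightarrow> mnorm V (madd V x y) \<le> mnorm V x + mnorm V y"
  by (auto simp only: V[unfolded cnormed_space_def])

lemma cnormed_assoc: "x \<in> mcarr V \<Longrightarrow> y \<in> mcarr V \<Longrightarrow> z \<in> mcarr V \<Longrightarrow>
    madd V (madd V x y) z = madd V x (madd V y z)"
proof -
  have "\<forall>x\<in>mcarr V. \<forall>y\<in>mcarr V. \<forall>z\<in>mcarr V. madd V (madd V x y) z = madd V x (madd V y z)"
    using V unfolding cnormed_space_def by (elim conjE)
  then show "x \<in> mcarr V \<Longrightarrow> y \<in> mcarr V \<Longrightarrow> z \<in> mcarr V \<Longrightarrow>
    madd V (madd V x y) z = madd V x (madd V y z)" by blast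
qed

lemmas cnormed_axioms = cnormed_add cnormed_smul cnormed_assoc cnormed_add_zero cnormed_minus cnormed_smul_one
  cnormed_smul_smul cnormed_smul_add_left cnormed_smul_add cnormed_norm_ge_0 cnormed_norm_eq_0 cnormed_norm_smul
  cnormed_triangle

lemma cnormed_norm_zero: "mnorm V (mzero V) = 0"
  by (simp add: cnormed_norm_eq_0 cnormed_zero)

lemma cnormed_norm_le_0: "x \<in> mcarr V \<Longrightarrow> mnorm V x \<le> 0 \<Longrightarrow> x = mzero V"
  using cnormed_norm_ge_0[of x] cnormed_norm_eq_0[of x] by simp

lemma cnormed_smul_0: "x \<in> mcarr V \<Longrightarrow> msmul V 0 x = mzero V"
  using cnormed_norm_smul[of x 0] cnormed_norm_eq_0[of "msmul V 0 x"] cnormed_smul[of x 0] by simp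

lemma cnormed_smul_zero: "msmul V c (mzero V) = mzero V"
  using cnormed_norm_smul[of "mzero V" c] cnormed_norm_eq_0[of "msmul V c (mzero V)"]
  by (simp add: cnormed_smul cnormed_zero cnormed_norm_zero)

lemma cnormed_sub: "x \<in> mcarr V \<Longrightarrow> y \<in> mcarr V \<Longrightarrow> msub V x y \<in> mcarr V"
  unfolding msub_def by (simp add: cnormed_add cnormed_smul)

lemma cnormed_sub_add:
  assumes "x \<in> mcarr V" "y \<in> mcarr V"
  shows "madd V (msub V x y) y = x"
  using assms unfolding msub_def
  by (metis cnormed_add_zero cnormed_assoc cnormed_commute cnormed_minus cnormed_smul)

lemma cnormed_minus_sub:
  assumes "x \<in> mcarr V" "y \<in> mcarr V"
  shows "msmul V (-1) (msub V x y) = msub V y x"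
proof -
  have "msmul V (-1) (msub V x y) = madd V (msmul V (-1) x) (msmul V (-1 * -1) y)"
    unfolding msub_def using assms by (simp add: cnormed_smul_add cnormed_smul cnormed_smul_smul)
  then show ?thesis
    unfolding msub_def using assms cnormed_commute[OF assms(2) cnormed_smul[OF assms(1)]]
    by (simp add: cnormed_smul_one)
qed

lemma cnormed_norm_sub_commute:
  assumes "x \<in> mcarr V" "y \<in> mcarr V"
  shows "mnorm V (msub V x y) = mnorm V (msub V y x)"
  using cnormed_norm_smul[OF cnormed_sub[OF assms], of "-1"] cnormed_minus_sub[OF assms] by simp

lemma cnormed_norm_le_sub:
  assumes "x \<in> mcarr V" "y \<in> mcarr V"
  shows "mnorm V x \<le> mnorm V (msub V x y) + mnorm V y"
  using cnormed_triangle[OF cnormed_sub[OF assms] assms(2)] cnormed_sub_add[OF assms] by simp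

lemma cnormed_sub_triangle:
  assumes m: "x \<in> mcarr V" "y \<in> mcarr V" "z \<in> mcarr V"
  shows "mnorm V (msub V x z) \<le> mnorm V (msub V x y) + mnorm V (msub V y z)"
proof -
  have m': "msmul V (-1) z \<in> mcarr V" "msub V x y \<in> mcarr V"
    using m by (simp_all add: cnormed_smul cnormed_sub)
  have "msub V x z = madd V (madd V (msub V x y) y) (msmul V (-1) z)"
    using cnormed_sub_add[OF m(1,2)] by (simp add: msub_def)
  also have "\<dots> = madd V (msub V x y) (msub V y z)"
    using cnormed_assoc[OF m'(2) m(2) m'(1)] by (simp add: msub_def)
  finally show ?thesis
    using cnormed_triangle[OF m'(2) cnormed_sub[OF m(2,3)]] by simp
qed

lemma cnormed_sub_eq_zero:
  assumes "x \<in> mcarr V" "y \<in> mcarr V" "msub V x y = mzero V"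
  shows "x = y"
  using cnormed_sub_add[OF assms(1,2)] assms by (metis cnormed_add_zero cnormed_commute cnormed_zero)

end

text \<open>Indices that are not Banach spaces contribute a zero space, so that every index can be
  treated uniformly.\<close>
definition banach_pad :: "'v nmod \<Rightarrow> 'v nmod" where
  "banach_pad N = (if banach_space N then N else
     \<lparr>mcarr = {undefined}, mzero = undefined, madd = (\<lambda>_ _. undefined), msmul = (\<lambda>_ _. undefined),
      mnorm = (\<lambda>_. 0), mact = (\<lambda>_ _. undefined)\<rparr>)"

lemma banach_pad: "cnormed_space (banach_pad N)" "mod_complete (banach_pad N)"
  by (auto simp: banach_pad_def banach_space_def cnormed_space_def mod_complete_def)

text \<open>Every Banach space carried by a subset of \<open>'v\<close> is a summand of this \<open>l\<^sub>\<infinity>\<close>-sum, so one Banach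
  type makes the infinite sums of the library available in all of them.\<close>
typedef 'v bsum = "{F :: 'v nmod \<Rightarrow> 'v. (\<forall>N. F N \<in> mcarr (banach_pad N)) \<and>
    bdd_above (range (\<lambda>N. mnorm (banach_pad N) (F N)))}"
  morphisms bcoord Abs_bsum
proof
  show "(\<lambda>N. mzero (banach_pad N)) \<in> {F. (\<forall>N. F N \<in> mcarr (banach_pad N)) \<and>
    bdd_above (range (\<lambda>N. mnorm (banach_pad N) (F N)))}"
    by (simp add: cnormed_zero[OF banach_pad(1)] cnormed_norm_zero[OF banach_pad(1)])
qed

lemmas pad = banach_pad(1)

lemma bcoord_mem: "bcoord F N \<in> mcarr (banach_pad N)"
  using bcoord[of F] by simp

lemma bcoord_bdd: "bdd_above (range (\<lambda>N. mnorm (banach_pad N) (bcoord F N)))"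
  using bcoord[of F] by simp

lemma bcoord_Abs:
  assumes "\<And>N. F N \<in> mcarr (banach_pad N)" "\<And>N. mnorm (banach_pad N) (F N) \<le> C"
  shows "bcoord (Abs_bsum F) = F"
  by (rule Abs_bsum_inverse) (use assms in \<open>auto intro!: bdd_aboveI\<close>)

lemma bsum_eqI: "(\<And>N. bcoord F N = bcoord G N) \<Longrightarrow> F = G"
  by (simp add: bcoord_inject[symmetric] fun_eq_iff)

instantiation bsum :: (type) real_normed_vector
begin

definition "norm_bsum F = (SUP N. mnorm (banach_pad N) (bcoord F N))"
definition "zero_bsum = Abs_bsum (\<lambda>N. mzero (banach_pad N))"
definition "plus_bsum F G = Abs_bsum (\<lambda>N. madd (banach_pad N) (bcoord F N) (bcoord G N))"
definition "scaleR_bsum r F = Abs_bsum (\<lambda>N. msmul (banach_pad N) (complex_of_real r) (bcoord F N))"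
definition uminus_bsum :: "'a bsum \<Rightarrow> 'a bsum" where "uminus_bsum F = (-1) *\<^sub>R F"
definition minus_bsum :: "'a bsum \<Rightarrow> 'a bsum \<Rightarrow> 'a bsum" where "minus_bsum F G = F + - G"
definition dist_bsum :: "'a bsum \<Rightarrow> 'a bsum \<Rightarrow> real" where "dist_bsum F G = norm (F - G)"
definition sgn_bsum :: "'a bsum \<Rightarrow> 'a bsum" where "sgn_bsum F = inverse (norm F) *\<^sub>R F"
definition "(uniformity :: ('a bsum \<times> 'a bsum) filter) = (INF e\<in>{0 <..}. principal {(x, y). dist x y < e})"
definition "open_bsum (S :: 'a bsum set) \<longleftrightarrow> (\<forall>x\<in>S. \<forall>\<^sub>F (x', y) in uniformity. x' = x \<longrightarrow> y \<in> S)"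

lemma bcoord_norm: "mnorm (banach_pad N) (bcoord F N) \<le> norm F"
  unfolding norm_bsum_def by (rule cSUP_upper[OF _ bcoord_bdd]) simp

lemma bsum_norm_leI: "(\<And>N. mnorm (banach_pad N) (bcoord F N) \<le> C) \<Longrightarrow> norm F \<le> C"
  unfolding norm_bsum_def by (rule cSUP_least) auto

lemma bcoord_zero: "bcoord 0 N = mzero (banach_pad N)"
  unfolding zero_bsum_def
  by (subst bcoord_Abs[where C = 0]) (auto simp: cnormed_zero[OF pad] cnormed_norm_zero[OF pad])

lemma bcoord_plus: "bcoord (F + G) N = madd (banach_pad N) (bcoord F N) (bcoord G N)"
  unfolding plus_bsum_def
proof (subst bcoord_Abs[where C = "norm F + norm G"])
  show "mnorm (banach_pad N) (madd (banach_pad N) (bcoord F N) (bcoord G N)) \<le> norm F + norm G" for N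
    using cnormed_triangle[OF pad bcoord_mem bcoord_mem, of N F G] bcoord_norm[of N F] bcoord_norm[of N G]
    by linarith
qed (simp_all add: cnormed_add[OF pad] bcoord_mem)

lemma bcoord_smul_aux:
  fixes F :: "'a bsum"
  shows "bcoord (Abs_bsum (\<lambda>N. msmul (banach_pad N) c (bcoord F N))) N = msmul (banach_pad N) c (bcoord F N)"
  by (subst bcoord_Abs[where C = "cmod c * norm F"])
    (auto simp: cnormed_smul[OF pad] bcoord_mem cnormed_norm_smul[OF pad] intro!: mult_left_mono bcoord_norm)

text \<open>One inequality is coordinatewise; used for \<open>inverse c\<close> it also gives the
  other. It is stated for the raw construction because the real and the complex scalar
  multiplication are both instances of it.\<close>

lemma norm_smul_aux:
  fixes F :: "'a bsum"
  shows "norm (Abs_bsum (\<lambda>N. msmul (banach_pad N) c (bcoord F N))) = cmod c * norm F"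
proof -
  define sm where "sm c G = Abs_bsum (\<lambda>N. msmul (banach_pad N) c (bcoord G N))" for c and G :: "'a bsum"
  have sm: "bcoord (sm c G) N = msmul (banach_pad N) c (bcoord G N)" for c G N
    unfolding sm_def by (rule bcoord_smul_aux)
  have nonneg: "0 \<le> norm G" for G :: "'a bsum"
    using order_trans[OF cnormed_norm_ge_0[OF pad bcoord_mem] bcoord_norm] .
  have le: "norm (sm c G) \<le> cmod c * norm G" for c G
    by (rule bsum_norm_leI)
      (simp add: sm cnormed_norm_smul[OF pad] bcoord_mem mult_left_mono bcoord_norm)
  have "norm (sm c F) = cmod c * norm F"
  proof (cases "c = 0")
    case True
    then show ?thesis using le[of c F] nonneg[of "sm c F"] by simp
  next
    case False
    have "F = sm (inverse c) (sm c F)"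
      using False by (intro bsum_eqI) (simp add: sm bcoord_mem cnormed_smul_smul[OF pad] cnormed_smul_one[OF pad])
    then have "norm F \<le> cmod (inverse c) * norm (sm c F)" using le[of "inverse c" "sm c F"] by simp
    then have "norm F \<le> norm (sm c F) / cmod c" by (simp add: norm_inverse divide_inverse mult.commute)
    then have "cmod c * norm F \<le> norm (sm c F)" using False by (simp add: pos_le_divide_eq mult.commute)
    with le[of c F] show ?thesis by simp
  qed
  then show ?thesis by (simp only: sm_def)
qed

lemma bcoord_scaleR: "bcoord (r *\<^sub>R F) N = msmul (banach_pad N) (complex_of_real r) (bcoord F N)"
  unfolding scaleR_bsum_def by (rule bcoord_smul_aux)

lemma bcoord_minus: "bcoord (F - G) N = msub (banach_pad N) (bcoord F N) (bcoord G N)"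
  unfolding minus_bsum_def uminus_bsum_def msub_def by (simp add: bcoord_plus bcoord_scaleR)

instance
proof
  fix F G H :: "'a bsum" and a b :: real
  note simps = bcoord_plus bcoord_scaleR bcoord_zero bcoord_mem
  show "F + G + H = F + (G + H)" by (rule bsum_eqI) (simp add: simps cnormed_assoc[OF pad])
  show "F + G = G + F" by (rule bsum_eqI) (simp add: simps cnormed_commute[OF pad])
  show "0 + F = F"
    by (rule bsum_eqI) (simp add: simps cnormed_commute[OF pad cnormed_zero[OF pad]] cnormed_add_zero[OF pad])
  show "- F + F = 0"
    unfolding uminus_bsum_def
    by (rule bsum_eqI)
      (simp add: simps cnormed_commute[OF pad cnormed_smul[OF pad]] cnormed_minus[OF pad])
  show "F - G = F + - G" by (rule minus_bsum_def)
  show "a *\<^sub>R (F + G) = a *\<^sub>R F + a *\<^sub>R G" by (rule bsum_eqI) (simp add: simps cnormed_smul_add[OF pad])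
  show "(a + b) *\<^sub>R F = a *\<^sub>R F + b *\<^sub>R F" by (rule bsum_eqI) (simp add: simps cnormed_smul_add_left[OF pad])
  show "a *\<^sub>R b *\<^sub>R F = (a * b) *\<^sub>R F" by (rule bsum_eqI) (simp add: simps cnormed_smul_smul[OF pad])
  show "1 *\<^sub>R F = F" by (rule bsum_eqI) (simp add: simps cnormed_smul_one[OF pad])
  show "dist F G = norm (F - G)" by (rule dist_bsum_def)
  show "sgn F = inverse (norm F) *\<^sub>R F" by (rule sgn_bsum_def)
  show "uniformity = (INF e\<in>{0 <..}. principal {(x, y). dist (x::'a bsum) y < e})" by (rule uniformity_bsum_def)
  show "open U \<longleftrightarrow> (\<forall>x\<in>U. \<forall>\<^sub>F (x', y) in uniformity. x' = x \<longrightarrow> y \<in> U)" for U :: "'a bsum set"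
    by (rule open_bsum_def)
  show "norm F = 0 \<longleftrightarrow> F = 0"
  proof
    assume "norm F = 0"
    then have "mnorm (banach_pad N) (bcoord F N) = 0" for N
      using bcoord_norm[of N F] cnormed_norm_ge_0[OF pad bcoord_mem, of N F] by simp
    then show "F = 0" by (intro bsum_eqI) (simp add: cnormed_norm_eq_0[OF pad] bcoord_mem bcoord_zero)
  next
    assume "F = 0"
    then show "norm F = 0" by (simp add: norm_bsum_def bcoord_zero cnormed_norm_zero[OF pad])
  qed
  show "norm (F + G) \<le> norm F + norm G"
  proof (rule bsum_norm_leI)
    show "mnorm (banach_pad N) (bcoord (F + G) N) \<le> norm F + norm G" for N
      using cnormed_triangle[OF pad bcoord_mem bcoord_mem, of N F G] bcoord_norm[of N F] bcoord_norm[of N G]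
      by (simp add: bcoord_plus)
  qed
  show "norm (a *\<^sub>R F) = \<bar>a\<bar> * norm F"
    unfolding scaleR_bsum_def norm_smul_aux by simp
qed

end

instantiation bsum :: (type) complex_banach
begin

definition "cscale_bsum c F = Abs_bsum (\<lambda>N. msmul (banach_pad N) c (bcoord F N))"

lemma bcoord_cscale: "bcoord (c *\<^sub>C F) N = msmul (banach_pad N) c (bcoord F N)"
  unfolding cscale_bsum_def by (rule bcoord_smul_aux)

instance
proof
  fix X :: "nat \<Rightarrow> 'a bsum" assume X: "Cauchy X"
  have le: "mnorm (banach_pad N) (msub (banach_pad N) (bcoord F N) (bcoord G N)) \<le> dist F G"
    for N and F G :: "'a bsum"
    using bcoord_norm[of N "F - G"] by (simp add: bcoord_minus dist_norm)
  have "\<exists>l\<in>mcarr (banach_pad N). \<forall>e>0. \<exists>K. \<forall>k\<ge>K.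
      mnorm (banach_pad N) (msub (banach_pad N) (bcoord (X k) N) l) < e" for N :: "'a nmod"
  proof -
    have "\<exists>K. \<forall>m\<ge>K. \<forall>k\<ge>K. mnorm (banach_pad N) (msub (banach_pad N) (bcoord (X m) N) (bcoord (X k) N)) < e"
      if "e > 0" for e
    proof -
      obtain K where "\<And>m n. m \<ge> K \<Longrightarrow> n \<ge> K \<Longrightarrow> dist (X m) (X n) < e"
        using metric_CauchyD[OF X \<open>0 < e\<close>] by blast
      then show ?thesis using le_less_trans[OF le] by blast
    qed
    then show ?thesis
      using banach_pad(2)[of N, unfolded mod_complete_def, rule_format, of "\<lambda>k. bcoord (X k) N"]
      by (simp add: bcoord_mem)
  qed
  then obtain l where l: "\<And>N. l N \<in> mcarr (banach_pad N)"
    "\<And>N e. e > 0 \<Longrightarrow> \<exists>K. \<forall>k\<ge>K. mnorm (banach_pad N) (msub (banach_pad N) (bcoord (X k) N) (l N)) < e"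
    by metis
  \<comment> \<open>The Cauchy estimate passes to the coordinatewise limit with a bound independent
    of \<open>N\<close>, which turns convergence of the coordinates into convergence in
    norm.\<close>
  have close: "mnorm (banach_pad N) (msub (banach_pad N) (bcoord (X k) N) (l N)) \<le> e"
    if K: "\<And>m. m \<ge> K \<Longrightarrow> dist (X k) (X m) \<le> e" for k K e and N :: "'a nmod"
  proof (rule field_le_epsilon)
    fix d :: real assume "d > 0"
    let ?V = "banach_pad N"
    obtain M where M: "\<And>m. m \<ge> M \<Longrightarrow> mnorm ?V (msub ?V (bcoord (X m) N) (l N)) < d"
      using l(2)[OF \<open>d > 0\<close>] by blast
    define m where "m = max K M"
    have "msub ?V (bcoord (X k) N) (l N)
        = madd ?V (msub ?V (bcoord (X k) N) (bcoord (X m) N)) (msub ?V (bcoord (X m) N) (l N))"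
      unfolding msub_def
      by (metis bcoord_mem pad cnormed_add cnormed_assoc cnormed_smul cnormed_sub_add l(1) msub_def)
    then have "mnorm ?V (msub ?V (bcoord (X k) N) (l N))
        \<le> mnorm ?V (msub ?V (bcoord (X k) N) (bcoord (X m) N)) + mnorm ?V (msub ?V (bcoord (X m) N) (l N))"
      by (simp add: cnormed_triangle[OF pad] cnormed_sub[OF pad] bcoord_mem l(1))
    moreover have "mnorm ?V (msub ?V (bcoord (X k) N) (bcoord (X m) N)) \<le> e"
      using le[of N "X k" "X m"] K[of m] by (simp add: m_def)
    ultimately show "mnorm ?V (msub ?V (bcoord (X k) N) (l N)) \<le> e + d"
      using M[of m] by (simp add: m_def)
  qed
  obtain K1 where K1: "\<And>m. m \<ge> K1 \<Longrightarrow> dist (X K1) (X m) \<le> 1"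
    using metric_CauchyD[OF X, of 1] by (metis less_le order_refl zero_less_one)
  have L: "bcoord (Abs_bsum l) = l"
  proof (rule bcoord_Abs[where C = "norm (X K1) + 1"])
    fix N :: "'a nmod" let ?V = "banach_pad N"
    have "mnorm ?V (l N) \<le> mnorm ?V (msub ?V (bcoord (X K1) N) (l N)) + mnorm ?V (bcoord (X K1) N)"
      using cnormed_norm_le_sub[OF pad l(1) bcoord_mem] cnormed_norm_sub_commute[OF pad l(1) bcoord_mem] by metis
    then show "mnorm ?V (l N) \<le> norm (X K1) + 1" using bcoord_norm[of N "X K1"] close[OF K1, where N = N] by fastforce
  qed (rule l(1))
  have "X \<longlonglongrightarrow> Abs_bsum l"
  proof (rule metric_LIMSEQ_I)
    fix e :: real assume "e > 0"
    then obtain K where K: "\<And>m n. m \<ge> K \<Longrightarrow> n \<ge> K \<Longrightarrow> dist (X m) (X n) < e / 2"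
      using metric_CauchyD[OF X, of "e / 2"] by auto
    have "dist (X k) (Abs_bsum l) < e" if "k \<ge> K" for k
    proof -
      have "norm (X k - Abs_bsum l) \<le> e / 2"
        by (rule bsum_norm_leI) (use close[of K k "e / 2"] K[OF that] in \<open>auto simp: bcoord_minus L less_imp_le\<close>)
      with \<open>e > 0\<close> show ?thesis by (simp add: dist_norm)
    qed
    then show "\<exists>K. \<forall>k\<ge>K. dist (X k) (Abs_bsum l) < e" by blast
  qed
  then show "convergent X" by (rule convergentI)
next
  fix F G :: "'a bsum" and c d :: complex and r :: real
  note simps = bcoord_plus bcoord_scaleR bcoord_cscale bcoord_mem
  show "c *\<^sub>C (F + G) = c *\<^sub>C F + c *\<^sub>C G" by (rule bsum_eqI) (simp add: simps cnormed_smul_add[OF pad])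
  show "(c + d) *\<^sub>C F = c *\<^sub>C F + d *\<^sub>C F" by (rule bsum_eqI) (simp add: simps cnormed_smul_add_left[OF pad])
  show "c *\<^sub>C d *\<^sub>C F = (c * d) *\<^sub>C F" by (rule bsum_eqI) (simp add: simps cnormed_smul_smul[OF pad])
  show "complex_of_real r *\<^sub>C F = r *\<^sub>R F" by (rule bsum_eqI) (simp add: simps)
  show "norm (c *\<^sub>C F) = cmod c * norm F"
    unfolding cscale_bsum_def by (rule norm_smul_aux)
qed

end

section \<open>A Banach space as a summand of the ambient Banach type\<close>

definition bemb :: "'v nmod \<Rightarrow> 'v \<Rightarrow> 'v bsum" where
  "bemb N x = Abs_bsum (\<lambda>M. if M = N then x else mzero (banach_pad M))"

context
  fixes N :: "'v nmod"
  assumes N: "banach_space N"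
begin

lemma banach_cnormed: "cnormed_space N"
  using N by (simp add: banach_space_def)

lemma banach_pad_banach: "banach_pad N = N"
  using N by (simp add: banach_pad_def)

lemma bcoord_bemb:
  assumes "x \<in> mcarr N"
  shows "bcoord (bemb N x) M = (if M = N then x else mzero (banach_pad M))"
  unfolding bemb_def
proof (subst bcoord_Abs[where C = "mnorm N x"])
  show "mnorm (banach_pad M) (if M = N then x else mzero (banach_pad M)) \<le> mnorm N x" for M
    using assms by (auto simp: banach_pad_banach cnormed_norm_zero[OF pad] cnormed_norm_ge_0[OF banach_cnormed])
qed (use assms in \<open>auto simp: banach_pad_banach cnormed_zero[OF pad]\<close>)

lemma bcoord_bemb_self: "x \<in> mcarr N \<Longrightarrow> bcoord (bemb N x) N = x"
  by (simp add: bcoord_bemb)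

lemma bemb_add: "x \<in> mcarr N \<Longrightarrow> y \<in> mcarr N \<Longrightarrow> bemb N (madd N x y) = bemb N x + bemb N y"
  by (rule bsum_eqI)
    (simp add: bcoord_bemb bcoord_plus cnormed_add[OF banach_cnormed] banach_pad_banach
      cnormed_add_zero[OF pad] cnormed_zero[OF pad])

lemma bemb_smul: "x \<in> mcarr N \<Longrightarrow> bemb N (msmul N c x) = c *\<^sub>C bemb N x"
  by (rule bsum_eqI)
    (simp add: bcoord_bemb bcoord_cscale cnormed_smul[OF banach_cnormed] banach_pad_banach
      cnormed_smul_zero[OF pad])

lemma norm_bemb:
  assumes "x \<in> mcarr N"
  shows "norm (bemb N x) = mnorm N x"
proof (rule antisym)
  show "norm (bemb N x) \<le> mnorm N x"
    by (rule bsum_norm_leI)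
      (use assms in \<open>auto simp: bcoord_bemb banach_pad_banach cnormed_norm_zero[OF pad] cnormed_norm_ge_0[OF banach_cnormed]\<close>)
  show "mnorm N x \<le> norm (bemb N x)"
    using bcoord_norm[of N "bemb N x"] assms by (simp add: bcoord_bemb banach_pad_banach)
qed

text \<open>Described by the vanishing of all other coordinates, the copy of \<open>N\<close> is
  visibly a subspace, and closed since coordinates are contractive.\<close>

lemma bemb_image: "bemb N ` mcarr N = {F. \<forall>M. M \<noteq> N \<longrightarrow> bcoord F M = mzero (banach_pad M)}"
proof (intro equalityI subsetI)
  fix F assume F: "F \<in> {F. \<forall>M. M \<noteq> N \<longrightarrow> bcoord F M = mzero (banach_pad M)}"
  have "bcoord F N \<in> mcarr N" using bcoord_mem[of F N] by (simp add: banach_pad_banach)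
  moreover from this F have "F = bemb N (bcoord F N)" by (intro bsum_eqI) (simp add: bcoord_bemb)
  ultimately show "F \<in> bemb N ` mcarr N" by blast
qed (auto simp: bcoord_bemb)

lemma csubspace_bemb: "csubspace (bemb N ` mcarr N)"
  unfolding csubspace_def bemb_image
  by (simp add: bcoord_zero bcoord_plus bcoord_cscale cnormed_zero[OF pad] cnormed_add_zero[OF pad] cnormed_smul_zero[OF pad])

lemma closed_bemb: "closed (bemb N ` mcarr N)"
  unfolding closed_sequential_limits
proof (intro allI impI, elim conjE)
  fix X l assume X: "\<forall>n. X n \<in> bemb N ` mcarr N" and lim: "X \<longlonglongrightarrow> l"
  have "bcoord l M = mzero (banach_pad M)" if M: "M \<noteq> N" for M
  proof -
    have "mnorm (banach_pad M) (bcoord l M) \<le> norm (l - X n)" for n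
      using bcoord_norm[of M "l - X n"] X M
      by (simp add: bcoord_minus bemb_image msub_def cnormed_smul_zero[OF pad] cnormed_add_zero[OF pad] bcoord_mem)
    moreover have "(\<lambda>n. norm (l - X n)) \<longlonglongrightarrow> norm (l - l)" by (intro tendsto_intros lim)
    ultimately have "mnorm (banach_pad M) (bcoord l M) \<le> 0"
      by (intro tendsto_lowerbound[of "\<lambda>n. norm (l - X n)" 0 sequentially]) auto
    then show ?thesis
      using cnormed_norm_ge_0[OF pad bcoord_mem] cnormed_norm_eq_0[OF pad bcoord_mem] by (metis antisym)
  qed
  then show "l \<in> bemb N ` mcarr N" by (simp add: bemb_image)
qed

lemma bcoord_mem_banach: "F \<in> bemb N ` mcarr N \<Longrightarrow> bcoord F N \<in> mcarr N"
  and bemb_bcoord: "F \<in> bemb N ` mcarr N \<Longrightarrow> bemb N (bcoord F N) = F"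
  by (auto simp: bcoord_bemb_self)

end

section \<open>The spaces l1\<close>

definition l1_unit :: "'i \<Rightarrow> 'i \<Rightarrow> complex" where
  "l1_unit i = (\<lambda>k. if k = i then 1 else 0)"

lemma l1space_simps [simp]:
  "mzero (l1space L) = (\<lambda>i. 0)"
  "madd (l1space L) = (\<lambda>f g i. f i + g i)"
  "msmul (l1space L) = (\<lambda>c f i. c * f i)"
  "mnorm (l1space L) = (\<lambda>f. \<Sum>\<^sub>\<infinity>i\<in>L. cmod (f i))"
  by (simp_all add: l1space_def)

lemma l1space_mem: "f \<in> mcarr (l1space L) \<longleftrightarrow> (\<forall>i. i \<notin> L \<longrightarrow> f i = 0) \<and> (\<lambda>i. cmod (f i)) summable_on L"
  by (simp add: l1space_def)

lemma l1space_summable: "f \<in> mcarr (l1space L) \<Longrightarrow> (\<lambda>i. cmod (f i)) summable_on L"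
  by (simp add: l1space_mem)

lemma l1space_add_summable:
  assumes "(\<lambda>i. cmod (f i)) summable_on L" "(\<lambda>i. cmod (g i)) summable_on L"
  shows "(\<lambda>i. cmod (f i + g i)) summable_on L"
  by (rule summable_on_comparison_test[OF summable_on_add[OF assms]]) (auto intro: norm_triangle_ineq)

lemma l1space_cnormed: "cnormed_space (l1space L)"
proof -
  have add: "(\<Sum>\<^sub>\<infinity>i\<in>L. cmod (f i + g i)) \<le> (\<Sum>\<^sub>\<infinity>i\<in>L. cmod (f i)) + (\<Sum>\<^sub>\<infinity>i\<in>L. cmod (g i))"
    if "f \<in> mcarr (l1space L)" "g \<in> mcarr (l1space L)" for f g
    unfolding infsum_add[OF that[THEN l1space_summable], symmetric]
    by (intro infsum_mono l1space_add_summable summable_on_add that[THEN l1space_summable] norm_triangle_ineq)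
  have zero: "(\<Sum>\<^sub>\<infinity>i\<in>L. cmod (f i)) = 0 \<longleftrightarrow> f = (\<lambda>i. 0)" if f: "f \<in> mcarr (l1space L)" for f
  proof
    assume "(\<Sum>\<^sub>\<infinity>i\<in>L. cmod (f i)) = 0"
    then have "cmod (f i) = 0" if "i \<in> L" for i
      using nonneg_infsum_le_0D[of "\<lambda>i. cmod (f i)" L i] l1space_summable[OF f] that by simp
    then show "f = (\<lambda>i. 0)" using f unfolding l1space_mem by auto
  qed simp
  show ?thesis
    unfolding cnormed_space_def
    by (simp add: add zero infsum_nonneg infsum_cmult_right' norm_mult)
      (auto simp: l1space_mem l1space_add_summable norm_mult algebra_simps intro: summable_on_cmult_right)
qed

lemma l1space_norm_ge:
  assumes "f \<in> mcarr (l1space L)"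
  shows "cmod (f i) \<le> mnorm (l1space L) f"
proof (cases "i \<in> L")
  case True
  then show ?thesis using finite_sum_le_infsum[OF l1space_summable[OF assms], of "{i}"] by simp
next
  case False
  then show ?thesis using assms by (simp add: l1space_mem infsum_nonneg)
qed

lemma l1space_complete: "mod_complete (l1space L)"
  unfolding mod_complete_def
proof (intro allI impI)
  fix s :: "nat \<Rightarrow> 'a \<Rightarrow> complex"
  assume s: "\<forall>k. s k \<in> mcarr (l1space L)"
    and C: "\<forall>e>0. \<exists>K. \<forall>m\<ge>K. \<forall>k\<ge>K. mnorm (l1space L) (msub (l1space L) (s m) (s k)) < e"
  have sub: "msub (l1space L) f g = (\<lambda>i. f i - g i)" for f g :: "'a \<Rightarrow> complex"
    by (simp add: msub_def)
  have mem: "(\<lambda>i. s m i - s k i) \<in> mcarr (l1space L)" for m k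
    using cnormed_sub[OF l1space_cnormed, of "s m" L "s k"] s by (simp add: sub)
  have "Cauchy (\<lambda>k. s k i)" for i
  proof (rule metric_CauchyI)
    fix e :: real assume "e > 0"
    then obtain K where "\<forall>m\<ge>K. \<forall>k\<ge>K. mnorm (l1space L) (\<lambda>i. s m i - s k i) < e"
      using C by (auto simp: sub)
    then show "\<exists>K. \<forall>m\<ge>K. \<forall>k\<ge>K. dist (s m i) (s k i) < e"
      using le_less_trans[OF l1space_norm_ge[OF mem]] unfolding dist_norm by blast
  qed
  then have "\<forall>i. \<exists>l. (\<lambda>k. s k i) \<longlonglongrightarrow> l"
    by (simp add: Cauchy_convergent_iff convergent_def)
  then obtain l where l: "\<And>i. (\<lambda>k. s k i) \<longlonglongrightarrow> l i" by metis
  \<comment> \<open>The Cauchy bound is carried to the pointwise limit on finite sets first, where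
    limit and sum commute; taking all finite subsets of \<open>L\<close> then bounds the full
    norm.\<close>
  have fin: "(\<Sum>i\<in>F. cmod (s m i - l i)) \<le> e"
    if K: "\<forall>m\<ge>K. \<forall>k\<ge>K. mnorm (l1space L) (\<lambda>i. s m i - s k i) < e" and "m \<ge> K" "finite F" "F \<subseteq> L" for e K m F
  proof (rule tendsto_upperbound)
    show "(\<lambda>k. \<Sum>i\<in>F. cmod (s m i - s k i)) \<longlonglongrightarrow> (\<Sum>i\<in>F. cmod (s m i - l i))"
      by (intro tendsto_intros l)
    show "\<forall>\<^sub>F k in sequentially. (\<Sum>i\<in>F. cmod (s m i - s k i)) \<le> e"
      unfolding eventually_sequentially
    proof (intro exI[of _ K] allI impI)
      fix k assume "k \<ge> K"
      have "(\<Sum>i\<in>F. cmod (s m i - s k i)) \<le> mnorm (l1space L) (\<lambda>i. s m i - s k i)"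
        unfolding l1space_simps by (rule finite_sum_le_infsum[OF l1space_summable[OF mem]]) (use that in auto)
      also have "\<dots> < e" using K \<open>k \<ge> K\<close> \<open>m \<ge> K\<close> by blast
      finally show "(\<Sum>i\<in>F. cmod (s m i - s k i)) \<le> e" by simp
    qed
  qed simp
  have diff: "(\<lambda>i. cmod (s m i - l i)) summable_on L" "(\<Sum>\<^sub>\<infinity>i\<in>L. cmod (s m i - l i)) \<le> e"
    if K: "\<forall>m\<ge>K. \<forall>k\<ge>K. mnorm (l1space L) (\<lambda>i. s m i - s k i) < e" and m: "m \<ge> K" for e K m
  proof -
    show *: "(\<lambda>i. cmod (s m i - l i)) summable_on L"
      by (rule nonneg_bdd_above_summable_on) (use fin[OF K m] in \<open>auto intro!: bdd_aboveI\<close>)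
    show "(\<Sum>\<^sub>\<infinity>i\<in>L. cmod (s m i - l i)) \<le> e"
      by (rule infsum_le_finite_sums[OF *]) (rule fin[OF K m])
  qed
  have ex: "\<exists>K. \<forall>m\<ge>K. \<forall>k\<ge>K. mnorm (l1space L) (\<lambda>i. s m i - s k i) < e" if "e > 0" for e
    using C that by (simp add: sub)
  obtain K where "\<forall>m\<ge>K. \<forall>k\<ge>K. mnorm (l1space L) (\<lambda>i. s m i - s k i) < 1" using ex[of 1] by auto
  then have 1: "(\<lambda>i. cmod (s K i - l i)) summable_on L" using diff(1)[of K 1 K] by blast
  have "l i = 0" if "i \<notin> L" for i
  proof (rule LIMSEQ_unique[OF l])
    show "(\<lambda>k. s k i) \<longlonglongrightarrow> 0" using s that by (simp add: l1space_mem)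
  qed
  moreover have "(\<lambda>i. cmod (s K i + - (s K i - l i))) summable_on L"
    by (rule l1space_add_summable[OF l1space_summable]) (use s 1 in \<open>simp_all only: norm_minus_cancel\<close>)
  ultimately have lm: "l \<in> mcarr (l1space L)" by (simp add: l1space_mem)
  moreover have "\<exists>N. \<forall>k\<ge>N. mnorm (l1space L) (msub (l1space L) (s k) l) < e" if e: "e > 0" for e
  proof -
    obtain K where "\<forall>m\<ge>K. \<forall>k\<ge>K. mnorm (l1space L) (\<lambda>i. s m i - s k i) < e / 2"
      using ex[OF half_gt_zero[OF e]] by blast
    then have "\<forall>k\<ge>K. mnorm (l1space L) (msub (l1space L) (s k) l) < e"
      using diff(2)[of K "e / 2"] e by (fastforce simp: sub)
    then show ?thesis by blast
  qed
  ultimately show "\<exists>l\<in>mcarr (l1space L). \<forall>e>0. \<exists>N. \<forall>k\<ge>N. mnorm (l1space L) (msub (l1space L) (s k) l) < e"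
    by blast
qed

lemma l1_unit:
  assumes "i \<in> L"
  shows "l1_unit i \<in> mcarr (l1space L)" "mnorm (l1space L) (l1_unit i) = 1"
proof -
  have "((\<lambda>k. cmod (l1_unit i k)) has_sum 1) L"
    by (rule has_sum_finite_neutralI[of "{i}"]) (use assms in \<open>auto simp: l1_unit_def\<close>)
  then show "l1_unit i \<in> mcarr (l1space L)" "mnorm (l1space L) (l1_unit i) = 1"
    using assms by (auto simp: l1space_mem infsumI has_sum_imp_summable l1_unit_def)
qed

text \<open>The universal property of l1: for bounded \<open>y\<close> this is the operator sending
  the i-th basis vector to \<open>y i\<close>. The series is summed in the ambient Banach type and
  its value is read back in \<open>N\<close>.\<close>

definition l1_map :: "'v nmod \<Rightarrow> 'i set \<Rightarrow> ('i \<Rightarrow> 'v) \<Rightarrow> ('i \<Rightarrow> complex) \<Rightarrow> 'v" where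
  "l1_map N L y c = bcoord (\<Sum>\<^sub>\<infinity>i\<in>L. c i *\<^sub>C bemb N (y i)) N"

context
  fixes N :: "'v nmod" and L :: "'i set" and y :: "'i \<Rightarrow> 'v" and C :: real
  assumes N: "banach_space N" and y: "\<And>i. i \<in> L \<Longrightarrow> y i \<in> mcarr N" "\<And>i. i \<in> L \<Longrightarrow> mnorm N (y i) \<le> C"
begin

lemma l1_map_has_sum:
  assumes c: "c \<in> mcarr (l1space L)"
  shows "l1_map N L y c \<in> mcarr N" "((\<lambda>i. c i *\<^sub>C bemb N (y i)) has_sum bemb N (l1_map N L y c)) L"
proof -
  have "(\<lambda>i. cmod (c i) * C) summable_on L"
    by (rule summable_on_cmult_left[OF l1space_summable[OF c]])
  then have "(\<lambda>i. norm (c i *\<^sub>C bemb N (y i))) summable_on L"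
    by (rule summable_on_comparison_test) (auto simp: norm_cscale norm_bemb[OF N] y mult_left_mono
        cnormed_norm_ge_0[OF banach_cnormed[OF N]])
  then have s: "((\<lambda>i. c i *\<^sub>C bemb N (y i)) has_sum (\<Sum>\<^sub>\<infinity>i\<in>L. c i *\<^sub>C bemb N (y i))) L"
    by (intro has_sum_infsum abs_summable_summable[of "\<lambda>i. c i *\<^sub>C bemb N (y i)"])
  have mem: "(\<Sum>\<^sub>\<infinity>i\<in>L. c i *\<^sub>C bemb N (y i)) \<in> bemb N ` mcarr N"
    by (rule csubspace_has_sum[OF csubspace_bemb[OF N] closed_bemb[OF N] s])
      (auto intro: csubspace_cscale[OF csubspace_bemb[OF N]] y)
  show "l1_map N L y c \<in> mcarr N" unfolding l1_map_def by (rule bcoord_mem_banach[OF N mem])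
  show "((\<lambda>i. c i *\<^sub>C bemb N (y i)) has_sum bemb N (l1_map N L y c)) L"
    using s unfolding l1_map_def bemb_bcoord[OF N mem] .
qed

lemma l1_map_eqI:
  assumes "c \<in> mcarr (l1space L)" "x \<in> mcarr N" "((\<lambda>i. c i *\<^sub>C bemb N (y i)) has_sum bemb N x) L"
  shows "l1_map N L y c = x"
  using has_sum_unique[OF l1_map_has_sum(2)[OF assms(1)] assms(3)]
  by (metis N assms(1,2) bcoord_bemb_self l1_map_has_sum(1))

lemma l1_map_add:
  assumes c: "c \<in> mcarr (l1space L)" and d: "d \<in> mcarr (l1space L)"
  shows "l1_map N L y (madd (l1space L) c d) = madd N (l1_map N L y c) (l1_map N L y d)"
  by (rule l1_map_eqI[OF cnormed_add[OF l1space_cnormed c d]])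
    (simp_all add: cnormed_add[OF banach_cnormed[OF N]] l1_map_has_sum assms bemb_add[OF N] cscale_add_left has_sum_add)

lemma l1_map_smul:
  assumes c: "c \<in> mcarr (l1space L)"
  shows "l1_map N L y (msmul (l1space L) a c) = msmul N a (l1_map N L y c)"
proof (rule l1_map_eqI[OF cnormed_smul[OF l1space_cnormed c]])
  show "msmul N a (l1_map N L y c) \<in> mcarr N"
    by (simp add: cnormed_smul[OF banach_cnormed[OF N]] l1_map_has_sum c)
  show "((\<lambda>i. msmul (l1space L) a c i *\<^sub>C bemb N (y i)) has_sum bemb N (msmul N a (l1_map N L y c))) L"
    using has_sum_bounded_linear[OF bounded_linear_cscale_right l1_map_has_sum(2)[OF c]]
    by (simp add: bemb_smul[OF N l1_map_has_sum(1)[OF c]] cscale_cscale)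
qed

lemma l1_map_norm:
  assumes c: "c \<in> mcarr (l1space L)"
  shows "mnorm N (l1_map N L y c) \<le> C * mnorm (l1space L) c"
proof -
  have "norm (bemb N (l1_map N L y c)) \<le> C * (\<Sum>\<^sub>\<infinity>i\<in>L. cmod (c i))"
    by (rule norm_infsum_le[OF l1_map_has_sum(2)[OF c] has_sum_cmult_right[OF has_sum_infsum[OF l1space_summable[OF c]]]])
      (auto simp: norm_cscale norm_bemb[OF N] y mult.commute[of C] mult_left_mono)
  then show ?thesis by (simp add: norm_bemb[OF N l1_map_has_sum(1)[OF c]])
qed

lemma l1_map_unit:
  assumes "i \<in> L"
  shows "l1_map N L y (l1_unit i) = y i"
proof (rule l1_map_eqI[OF l1_unit(1)[OF assms]])
  show "y i \<in> mcarr N" by (rule y(1)[OF assms])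
  show "((\<lambda>k. l1_unit i k *\<^sub>C bemb N (y k)) has_sum bemb N (y i)) L"
    by (rule has_sum_finite_neutralI[of "{i}"]) (use assms in \<open>auto simp: l1_unit_def\<close>)
qed

end

section \<open>Bounded linear maps out of l1\<close>

definition bounded_linear_map :: "'v nmod \<Rightarrow> 'w nmod \<Rightarrow> ('v \<Rightarrow> 'w) \<Rightarrow> bool" where
  "bounded_linear_map V W T \<longleftrightarrow>
     (\<forall>x\<in>mcarr V. T x \<in> mcarr W) \<and>
     (\<forall>x\<in>mcarr V. \<forall>y\<in>mcarr V. T (madd V x y) = madd W (T x) (T y)) \<and>
     (\<forall>c. \<forall>x\<in>mcarr V. T (msmul V c x) = msmul W c (T x)) \<and>
     (\<exists>C. \<forall>x\<in>mcarr V. mnorm W (T x) \<le> C * mnorm V x)"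

lemma bounded_linear_mapD:
  assumes "bounded_linear_map V W T"
  shows "x \<in> mcarr V \<Longrightarrow> T x \<in> mcarr W"
    and "x \<in> mcarr V \<Longrightarrow> y \<in> mcarr V \<Longrightarrow> T (madd V x y) = madd W (T x) (T y)"
    and "x \<in> mcarr V \<Longrightarrow> T (msmul V c x) = msmul W c (T x)"
    and "\<exists>C. \<forall>x\<in>mcarr V. mnorm W (T x) \<le> C * mnorm V x"
  using assms by (auto simp: bounded_linear_map_def)

lemma l1_restrict:
  assumes c: "c \<in> mcarr (l1space L)"
  shows "(\<lambda>i. if i \<in> F then c i else 0) \<in> mcarr (l1space L)"
proof -
  have "(\<lambda>i. cmod (if i \<in> F then c i else 0)) summable_on L"
    by (rule summable_on_comparison_test[OF l1space_summable[OF c]]) auto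
  with c show ?thesis by (auto simp: l1space_mem)
qed

text \<open>Agreement on the basis gives agreement on every finite restriction \<open>r F\<close>;
  the rest of \<open>c\<close> has arbitrarily small norm, and both maps are bounded.\<close>

lemma bounded_linear_map_l1_eqI:
  assumes W: "cnormed_space W" and T: "bounded_linear_map (l1space L) W T" and T': "bounded_linear_map (l1space L) W T'"
    and unit: "\<And>i. i \<in> L \<Longrightarrow> T (l1_unit i) = T' (l1_unit i)" and c: "c \<in> mcarr (l1space L)"
  shows "T c = T' c"
proof -
  let ?l = "l1space L"
  obtain C C' where C: "\<And>x. x \<in> mcarr ?l \<Longrightarrow> mnorm W (T x) \<le> C * mnorm ?l x"
    "\<And>x. x \<in> mcarr ?l \<Longrightarrow> mnorm W (T' x) \<le> C' * mnorm ?l x"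
    using bounded_linear_mapD(4)[OF T] bounded_linear_mapD(4)[OF T'] by blast
  note mem = bounded_linear_mapD(1)[OF T] bounded_linear_mapD(1)[OF T']
  note add = bounded_linear_mapD(2)[OF T] bounded_linear_mapD(2)[OF T']
  note smul = bounded_linear_mapD(3)[OF T] bounded_linear_mapD(3)[OF T']
  define r where "r F = (\<lambda>i. if i \<in> F then c i else 0)" for F
  have r: "r F \<in> mcarr ?l" for F unfolding r_def by (rule l1_restrict[OF c])
  have fin: "T (r F) = T' (r F)" if "finite F" "F \<subseteq> L" for F
    using that
  proof (induction F)
    case empty
    have "r {} = msmul ?l 0 (r {})" by (simp add: r_def)
    then show ?case using smul[OF r, of 0 "{}"] by (metis W cnormed_smul_0 mem r)
  next
    case (insert i F)
    then have i: "i \<in> L" by simp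
    have "r (insert i F) = madd ?l (r F) (msmul ?l (c i) (l1_unit i))"
      using insert by (auto simp: r_def l1_unit_def)
    moreover have "T (r F) = T' (r F)" using insert by simp
    ultimately show ?case
      by (simp only: add r smul cnormed_smul[OF l1space_cnormed] l1_unit(1)[OF i] unit[OF i])
  qed
  \<comment> \<open>The absolute values allow for negative constants, and the 1 makes
    \<open>D\<close> positive, so that \<open>e / D\<close> is an admissible tolerance.\<close>
  define D where "D = \<bar>C\<bar> + \<bar>C'\<bar> + 1"
  have "mnorm W (msub W (T c) (T' c)) \<le> e" if "e > 0" for e
  proof -
    have "e / D > 0" using that by (simp add: D_def add_nonneg_pos)
    then obtain F where F: "finite F" "F \<subseteq> L" "dist (\<Sum>i\<in>F. cmod (c i)) (\<Sum>\<^sub>\<infinity>i\<in>L. cmod (c i)) \<le> e / D"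
      using infsum_finite_approximation[OF l1space_summable[OF c]] by blast
    define t where "t = r (- F)"
    have t: "t \<in> mcarr ?l" unfolding t_def by (rule r)
    have "mnorm ?l t = (\<Sum>\<^sub>\<infinity>i\<in>L-F. cmod (c i))"
      unfolding l1space_simps by (rule infsum_cong_neutral) (auto simp: t_def r_def)
    also have "\<dots> = (\<Sum>\<^sub>\<infinity>i\<in>L. cmod (c i)) - (\<Sum>i\<in>F. cmod (c i))"
      using infsum_Diff[OF l1space_summable[OF c] _ F(2)] F by simp
    finally have nt: "mnorm ?l t \<le> e / D" using F(3) by (simp add: dist_real_def)
    have "c = madd ?l t (r F)" by (auto simp: t_def r_def)
    then have "T c = madd W (T t) (T (r F))" "T' c = madd W (T' t) (T (r F))"
      using add[OF t r] fin[OF F(1,2)] by metis+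
    moreover have "msub W (madd W a z) (madd W b z) = msub W a b"
      if "a \<in> mcarr W" "b \<in> mcarr W" "z \<in> mcarr W" for a b z
    proof -
      let ?m = "\<lambda>z. msmul W (-1) z"
      have m: "?m b \<in> mcarr W" "?m z \<in> mcarr W" using that by (simp_all add: cnormed_smul[OF W])
      have "msub W (madd W a z) (madd W b z) = madd W (madd W a z) (madd W (?m z) (?m b))"
        using that m by (simp add: msub_def cnormed_smul_add[OF W] cnormed_commute[OF W])
      also have "\<dots> = madd W a (madd W (madd W z (?m z)) (?m b))"
        using that m by (simp add: cnormed_assoc[OF W] cnormed_add[OF W])
      also have "\<dots> = msub W a b"
        using that m by (simp add: msub_def cnormed_minus[OF W] cnormed_commute[OF W cnormed_zero[OF W]] cnormed_add_zero[OF W])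
      finally show ?thesis .
    qed
    ultimately have "msub W (T c) (T' c) = msub W (T t) (T' t)" using mem t r by metis
    then have "mnorm W (msub W (T c) (T' c)) \<le> mnorm W (T t) + mnorm W (T' t)"
      using cnormed_triangle[OF W mem(1)[OF t] cnormed_smul[OF W mem(2)[OF t], of "-1"]]
      by (simp add: msub_def cnormed_norm_smul[OF W] mem t)
    also have "\<dots> \<le> D * mnorm ?l t"
    proof -
      have "0 \<le> mnorm ?l t" by (rule cnormed_norm_ge_0[OF l1space_cnormed t])
      then have "C * mnorm ?l t \<le> \<bar>C\<bar> * mnorm ?l t" "C' * mnorm ?l t \<le> \<bar>C'\<bar> * mnorm ?l t"
        by (auto intro: mult_right_mono)
      with C[OF t] \<open>0 \<le> mnorm ?l t\<close> show ?thesis by (simp add: D_def distrib_right)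
    qed
    also have "\<dots> \<le> D * (e / D)" using nt by (intro mult_left_mono) (auto simp: D_def)
    also have "\<dots> = e" by (simp add: D_def)
    finally show ?thesis .
  qed
  then have "mnorm W (msub W (T c) (T' c)) \<le> 0" by (rule field_le_epsilon) simp
  then have "msub W (T c) (T' c) = mzero W"
    by (rule cnormed_norm_le_0[OF W cnormed_sub[OF W mem[OF c]]])
  then show ?thesis by (rule cnormed_sub_eq_zero[OF W mem[OF c]])
qed

section \<open>Operator norms\<close>

lemma opnorm_set_nonempty:
  assumes X: "cnormed_space X" and "\<exists>C. \<forall>x\<in>mcarr X. mnorm Y (f x) \<le> C * mnorm X x"
  shows "{C. 0 \<le> C \<and> (\<forall>x\<in>mcarr X. mnorm Y (f x) \<le> C * mnorm X x)} \<noteq> {}"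
proof -
  obtain C where C: "\<And>x. x \<in> mcarr X \<Longrightarrow> mnorm Y (f x) \<le> C * mnorm X x" using assms by blast
  have "mnorm Y (f x) \<le> max C 0 * mnorm X x" if "x \<in> mcarr X" for x
    using C[OF that] mult_right_mono[of C "max C 0" "mnorm X x"] cnormed_norm_ge_0[OF X that] by simp
  then have "max C 0 \<in> {C. 0 \<le> C \<and> (\<forall>x\<in>mcarr X. mnorm Y (f x) \<le> C * mnorm X x)}" by simp
  then show ?thesis by blast
qed

text \<open>For a vector of positive norm every admissible constant dominates the quotient of the
  norms, hence so does the infimum; for a vector of norm zero a single admissible constant
  decides.\<close>

lemma opnorm_bound:
  assumes X: "cnormed_space X" and f: "morphism A X Y f" and x: "x \<in> mcarr X"
  shows "mnorm Y (f x) \<le> opnorm X Y f * mnorm X x"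
proof -
  let ?S = "{C. 0 \<le> C \<and> (\<forall>x\<in>mcarr X. mnorm Y (f x) \<le> C * mnorm X x)}"
  have ne: "?S \<noteq> {}" by (rule opnorm_set_nonempty[OF X]) (use f in \<open>simp add: morphism_def\<close>)
  show ?thesis
  proof (cases "mnorm X x = 0")
    case True
    with ne x show ?thesis by force
  next
    case False
    then have pos: "mnorm X x > 0" using cnormed_norm_ge_0[OF X x] by simp
    have "mnorm Y (f x) / mnorm X x \<le> Inf ?S"
      by (rule cInf_greatest[OF ne]) (use x pos in \<open>auto simp: divide_le_eq\<close>)
    then show ?thesis using pos by (simp add: opnorm_def divide_le_eq)
  qed
qed

lemma opnorm_nonneg:
  assumes X: "cnormed_space X" and f: "morphism A X Y f"
  shows "0 \<le> opnorm X Y f"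
  unfolding opnorm_def
  by (rule cInf_greatest[OF opnorm_set_nonempty[OF X]]) (use f in \<open>auto simp: morphism_def\<close>)

lemma opnorm_le:
  assumes "0 \<le> C" "\<And>x. x \<in> mcarr X \<Longrightarrow> mnorm Y (f x) \<le> C * mnorm X x"
  shows "opnorm X Y f \<le> C"
  unfolding opnorm_def by (rule cInf_lower) (use assms in \<open>auto intro!: bdd_belowI[of _ 0]\<close>)

section \<open>Modules over sequence algebras\<close>

locale sequence_algebra =
  fixes A :: "(nat \<Rightarrow> complex) set" and nA :: "(nat \<Rightarrow> complex) \<Rightarrow> real"
  assumes seq_algebra: "seq_algebra A nA"
begin

lemma algebra_norm_smul: "a \<in> A \<Longrightarrow> nA (\<lambda>k. c * a k) = cmod c * nA a"
  and algebra_norm_mult: "a \<in> A \<Longrightarrow> b \<in> A \<Longrightarrow> nA (\<lambda>k. a k * b k) \<le> nA a * nA b"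
  and algebra_add: "a \<in> A \<Longrightarrow> b \<in> A \<Longrightarrow> (\<lambda>k. a k + b k) \<in> A"
  and algebra_smul: "a \<in> A \<Longrightarrow> (\<lambda>k. c * a k) \<in> A"
  and algebra_dense: "a \<in> A \<Longrightarrow> e > 0 \<Longrightarrow> \<exists>b\<in>c00. nA (\<lambda>k. a k - b k) < e"
  and norm_pseq: "nA (pseq n) = 1"
  and c00_subset: "c00 \<subseteq> A"
  by (insert seq_algebra[unfolded seq_algebra_def]) simp_all

lemma pseq_mem: "pseq n \<in> A"
proof -
  have "{k. pseq n k \<noteq> 0} = {n}" by (auto simp: pseq_def)
  then show ?thesis using c00_subset by (auto simp: c00_def)
qed

lemma pseq_mult: "(\<lambda>k. a k * pseq n k) = (\<lambda>k. a n * pseq n k)"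
  by (auto simp: pseq_def)

text \<open>The product of \<open>a\<close> with \<open>pseq n\<close> is \<open>a n\<close> times
  \<open>pseq n\<close>, and \<open>pseq n\<close> has norm 1. Thus taking the n-th entry is a
  contractive character of the algebra, which is what lets \<open>entry_module\<close> be a
  contractive module.\<close>

lemma norm_entry_le:
  assumes "a \<in> A"
  shows "cmod (a n) \<le> nA a"
  using algebra_norm_mult[OF assms pseq_mem, of n] algebra_norm_smul[OF pseq_mem, of "a n" n]
  by (simp add: pseq_mult[of a] norm_pseq)

end

locale hbar_module = sequence_algebra A nA
  for A :: "(nat \<Rightarrow> complex) set" and nA :: "(nat \<Rightarrow> complex) \<Rightarrow> real" +
  fixes X :: "'v nmod"
  assumes hbar: "X \<in> Hbar A nA"
begin

lemma module: "normed_module A nA X" and complete: "mod_complete X"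
  and essential: "essential A X" and homogeneous: "homogeneous X"
  using hbar by (simp_all add: Hbar_def)

lemma cnormed: "cnormed_space X"
  using module by (simp add: normed_module_def)

lemmas mzero_mem = cnormed_zero[OF cnormed]
  and madd_mem = cnormed_add[OF cnormed]
  and msmul_mem = cnormed_smul[OF cnormed]
  and msub_mem = cnormed_sub[OF cnormed]
  and mnorm_mzero = cnormed_norm_zero[OF cnormed]
  and mnorm_nonneg = cnormed_norm_ge_0[OF cnormed]
  and mnorm_msmul = cnormed_norm_smul[OF cnormed]
  and msmul_mzero = cnormed_smul_zero[OF cnormed]
  and msmul_0 = cnormed_smul_0[OF cnormed]
  and madd_mzero = cnormed_add_zero[OF cnormed]
  and mnorm_le_0 = cnormed_norm_le_0[OF cnormed]

lemma banach: "banach_space X"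
  using cnormed complete by (simp add: banach_space_def)

lemma act_mem: "a \<in> A \<Longrightarrow> x \<in> mcarr X \<Longrightarrow> mact X a x \<in> mcarr X"
  and act_add: "a \<in> A \<Longrightarrow> x \<in> mcarr X \<Longrightarrow> y \<in> mcarr X \<Longrightarrow> mact X a (madd X x y) = madd X (mact X a x) (mact X a y)"
  and act_smul: "a \<in> A \<Longrightarrow> x \<in> mcarr X \<Longrightarrow> mact X a (msmul X c x) = msmul X c (mact X a x)"
  and act_smul_left: "a \<in> A \<Longrightarrow> x \<in> mcarr X \<Longrightarrow> mact X (\<lambda>k. c * a k) x = msmul X c (mact X a x)"
  and act_act: "a \<in> A \<Longrightarrow> b \<in> A \<Longrightarrow> x \<in> mcarr X \<Longrightarrow> mact X a (mact X b x) = mact X (\<lambda>k. a k * b k) x"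
  and act_norm: "a \<in> A \<Longrightarrow> x \<in> mcarr X \<Longrightarrow> mnorm X (mact X a x) \<le> nA a * mnorm X x"
  using module[unfolded normed_module_def] by simp_all

abbreviation coord :: "nat \<Rightarrow> 'v \<Rightarrow> 'v" where
  "coord n \<equiv> mact X (pseq n)"

lemma coord_mem: "x \<in> mcarr X \<Longrightarrow> coord n x \<in> mcarr X"
  by (rule act_mem[OF pseq_mem])

lemma coord_norm: "x \<in> mcarr X \<Longrightarrow> mnorm X (coord n x) \<le> mnorm X x"
  using act_norm[OF pseq_mem, of x n] by (simp add: norm_pseq)

lemma act_coord: "a \<in> A \<Longrightarrow> x \<in> mcarr X \<Longrightarrow> mact X a (coord n x) = msmul X (a n) (coord n x)"
  by (simp add: act_act pseq_mem pseq_mult[of a] act_smul_left)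

lemma coord_act: "a \<in> A \<Longrightarrow> x \<in> mcarr X \<Longrightarrow> coord n (mact X a x) = msmul X (a n) (coord n x)"
  by (simp add: act_act pseq_mem pseq_mult[of a] act_smul_left mult.commute[of "pseq n _"])

lemma coord_coord: "x \<in> mcarr X \<Longrightarrow> coord m (coord n x) = (if m = n then coord n x else mzero X)"
  using act_coord[OF pseq_mem[of m], of x n]
  by (simp add: pseq_def[of m] cnormed_smul_one[OF cnormed] msmul_0 coord_mem)

lemma coord_zero: "coord n (mzero X) = mzero X"
  using act_smul[OF pseq_mem[of n] mzero_mem, where c = 0]
  by (simp add: msmul_0 mzero_mem coord_mem)

lemma coord_sub: "x \<in> mcarr X \<Longrightarrow> y \<in> mcarr X \<Longrightarrow> coord n (msub X x y) = msub X (coord n x) (coord n y)"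
  unfolding msub_def by (simp add: act_add act_smul pseq_mem msmul_mem)

lemma coord_add: "x \<in> mcarr X \<Longrightarrow> y \<in> mcarr X \<Longrightarrow> coord n (madd X x y) = madd X (coord n x) (coord n y)"
  by (rule act_add[OF pseq_mem])

lemma coord_smul: "x \<in> mcarr X \<Longrightarrow> coord n (msmul X c x) = msmul X c (coord n x)"
  by (rule act_smul[OF pseq_mem])

lemma homogeneousD:
  assumes "x \<in> mcarr X" "y \<in> mcarr X" "\<And>n. mnorm X (coord n x) \<le> mnorm X (coord n y)"
  shows "mnorm X x \<le> mnorm X y"
  using homogeneous assms unfolding homogeneous_def by blast

lemma sub_self: "x \<in> mcarr X \<Longrightarrow> msub X x x = mzero X"
  unfolding msub_def by (rule cnormed_minus[OF cnormed])

text \<open>Homogeneity compared with zero: all coordinates of the difference vanish, so its norm is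
  at most that of \<open>mzero X\<close>.\<close>

lemma coord_eqI:
  assumes x: "x \<in> mcarr X" and y: "y \<in> mcarr X" and eq: "\<And>n. coord n x = coord n y"
  shows "x = y"
proof (rule cnormed_sub_eq_zero[OF cnormed x y])
  have s: "msub X x y \<in> mcarr X" by (rule msub_mem[OF x y])
  have "mnorm X (msub X x y) \<le> mnorm X (mzero X)"
    by (rule homogeneousD[OF s mzero_mem])
      (simp add: coord_sub x y eq sub_self coord_mem coord_zero)
  then show "msub X x y = mzero X"
    by (intro mnorm_le_0[OF s]) (simp add: mnorm_mzero)
qed

lemma coord_synthesis:
  assumes "finite I" "\<And>n. n \<in> I \<Longrightarrow> z n \<in> mcarr X" "\<And>n. n \<in> I \<Longrightarrow> coord n (z n) = z n"
  shows "\<exists>x\<in>mcarr X. \<forall>n. coord n x = (if n \<in> I then z n else mzero X)"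
  using assms
proof (induction I)
  case empty
  then show ?case using mzero_mem coord_zero by force
next
  case (insert m I)
  then obtain x where x: "x \<in> mcarr X" "\<And>n. coord n x = (if n \<in> I then z n else mzero X)" by auto
  have m: "z m \<in> mcarr X" "coord m (z m) = z m" using insert by auto
  have "coord n (z m) = (if n = m then z m else mzero X)" for n
    using coord_coord[OF m(1), of n m] m(2) by simp
  then have "coord n (madd X x (z m)) = (if n \<in> insert m I then z n else mzero X)" for n
    using insert m x
    by (auto simp: coord_add madd_mzero mzero_mem
        cnormed_commute[OF cnormed mzero_mem])
  then show ?case using madd_mem[OF x(1) m(1)] by blast
qed

text \<open>The action of the sequence with \<open>N\<close> leading ones followed by zeros. Only
  its coordinates matter in the homogeneity arguments, and by \<open>coord_eqI\<close> they
  determine the chosen element.\<close>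

definition trunc :: "nat \<Rightarrow> 'v \<Rightarrow> 'v" where
  "trunc N x = (SOME x'. x' \<in> mcarr X \<and> (\<forall>n. coord n x' = (if n < N then coord n x else mzero X)))"

lemma trunc:
  assumes "x \<in> mcarr X"
  shows "trunc N x \<in> mcarr X" "coord n (trunc N x) = (if n < N then coord n x else mzero X)"
proof -
  have "\<exists>x'. x' \<in> mcarr X \<and> (\<forall>n. coord n x' = (if n < N then coord n x else mzero X))"
    using coord_synthesis[of "{..<N}" "\<lambda>n. coord n x"] assms by (auto simp: coord_mem coord_coord)
  from someI_ex[OF this] show "trunc N x \<in> mcarr X" "coord n (trunc N x) = (if n < N then coord n x else mzero X)"
    unfolding trunc_def by auto
qed

abbreviation tail :: "nat \<Rightarrow> 'v \<Rightarrow> 'v" where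
  "tail N x \<equiv> msub X x (trunc N x)"

lemma coord_tail:
  assumes "x \<in> mcarr X"
  shows "coord n (tail N x) = (if n < N then mzero X else coord n x)"
  using assms trunc[OF assms]
  by (simp add: coord_sub sub_self coord_mem)
    (simp add: msub_def msmul_mzero madd_mzero coord_mem)

text \<open>This is where essentiality enters. By homogeneity, passing to a tail does not increase
  the norm, so the vectors whose tails tend to zero form a closed subspace. It contains the action
  of any \<open>a\<close> on any \<open>z\<close>: for \<open>b\<close> in \<open>c00\<close> near
  \<open>a\<close>, the tails beyond the support of \<open>b\<close> are dominated coordinatewise by
  the action of \<open>a - b\<close> on \<open>z\<close>.\<close>

lemma trunc_limit:
  assumes x: "x \<in> mcarr X" and e: "e > 0"
  shows "\<exists>M. \<forall>N\<ge>M. mnorm X (tail N x) < e"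
proof -
  define G where "G = {x\<in>mcarr X. \<forall>e>0. \<exists>M. \<forall>N\<ge>M. mnorm X (tail N x) < e}"
  have tail_mem: "tail N x \<in> mcarr X" if "x \<in> mcarr X" for x N
    by (rule msub_mem[OF that trunc(1)[OF that]])
  have tail_le: "mnorm X (tail N x) \<le> mnorm X x" if "x \<in> mcarr X" for x N
    by (rule homogeneousD[OF tail_mem[OF that] that])
      (simp add: coord_tail that mnorm_mzero mnorm_nonneg coord_mem)
  have tail_add: "tail N (madd X x y) = madd X (tail N x) (tail N y)"
    if "x \<in> mcarr X" "y \<in> mcarr X" for x y N
    by (rule coord_eqI)
      (simp_all add: tail_mem that madd_mem coord_tail coord_add madd_mzero mzero_mem)
  have tail_smul: "tail N (msmul X c x) = msmul X c (tail N x)"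
    if "x \<in> mcarr X" for x c N
    by (rule coord_eqI)
      (simp_all add: tail_mem that msmul_mem coord_tail coord_smul msmul_mzero)
  have span: "mspan X {mact X a z | a z. a \<in> A \<and> z \<in> mcarr X} \<subseteq> G"
  proof
    fix y assume "y \<in> mspan X {mact X a z | a z. a \<in> A \<and> z \<in> mcarr X}"
    then show "y \<in> G"
    proof induction
      case span_zero
      have "mnorm X (tail N (mzero X)) \<le> 0" for N
        using tail_le[OF mzero_mem] by (simp add: mnorm_mzero)
      then show ?case using mzero_mem unfolding G_def by (auto intro: le_less_trans)
    next
      case (span_base s)
      then obtain a z where s: "s = mact X a z" and a: "a \<in> A" and z: "z \<in> mcarr X" by blast
      have sm: "s \<in> mcarr X" using s a z act_mem by simp
      have "\<exists>M. \<forall>N\<ge>M. mnorm X (tail N s) < e" if e: "e > 0" for e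
      proof -
        have nz: "mnorm X z \<ge> 0" by (rule mnorm_nonneg[OF z])
        then have "e / (mnorm X z + 1) > 0" using e by simp
        then obtain b where b: "b \<in> c00" and ab: "nA (\<lambda>k. a k - b k) < e / (mnorm X z + 1)"
          using algebra_dense[OF a] by blast
        have bA: "b \<in> A" using b c00_subset by blast
        define d where "d = (\<lambda>k. a k + (-1) * b k)"
        have dA: "d \<in> A" unfolding d_def by (intro algebra_add algebra_smul a bA)
        have nd: "nA d < e / (mnorm X z + 1)" using ab by (simp add: d_def)
        have "finite {k. b k \<noteq> 0}" using b by (simp add: c00_def)
        then obtain M where "\<forall>k\<in>{k. b k \<noteq> 0}. k < M" using finite_nat_set_iff_bounded by blast
        then have M: "b k = 0" if "k \<ge> M" for k using that by fastforce
        have "mnorm X (tail N s) < e" if N: "N \<ge> M" for N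
        proof -
          have "mnorm X (tail N s) \<le> mnorm X (mact X d z)"
          proof (rule homogeneousD[OF tail_mem[OF sm] act_mem[OF dA z]])
            fix n
            show "mnorm X (coord n (tail N s)) \<le> mnorm X (coord n (mact X d z))"
            proof (cases "n < N")
              case True
              then show ?thesis
                by (simp add: coord_tail sm mnorm_mzero mnorm_nonneg coord_mem act_mem dA z)
            next
              case False
              then have "d n = a n" using M N by (simp add: d_def)
              then show ?thesis using False by (simp add: coord_tail sm) (simp add: s coord_act a z dA)
            qed
          qed
          also have "\<dots> \<le> nA d * mnorm X z" by (rule act_norm[OF dA z])
          also have "\<dots> \<le> e / (mnorm X z + 1) * mnorm X z" using nd nz by (intro mult_right_mono) auto
          also have "\<dots> < e" using e nz by (simp add: field_simps)
          finally show ?thesis .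
        qed
        then show ?thesis by blast
      qed
      then show ?case using sm by (simp add: G_def)
    next
      case (span_add x y)
      then have xy: "x \<in> mcarr X" "y \<in> mcarr X" by (auto simp: G_def)
      have "\<exists>M. \<forall>N\<ge>M. mnorm X (tail N (madd X x y)) < e" if e: "e > 0" for e
      proof -
        obtain M1 M2 where M: "\<And>N. N \<ge> M1 \<Longrightarrow> mnorm X (tail N x) < e / 2"
          "\<And>N. N \<ge> M2 \<Longrightarrow> mnorm X (tail N y) < e / 2"
          using span_add.IH half_gt_zero[OF e] unfolding G_def by blast
        have "mnorm X (tail N (madd X x y)) < e" if "N \<ge> max M1 M2" for N
          using cnormed_triangle[OF cnormed tail_mem[OF xy(1)] tail_mem[OF xy(2)], of N N] M[of N] that
          by (simp add: tail_add xy)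
        then show ?thesis by blast
      qed
      then show ?case using madd_mem[OF xy] by (simp add: G_def)
    next
      case (span_smul x c)
      then have x: "x \<in> mcarr X" by (auto simp: G_def)
      have "\<exists>M. \<forall>N\<ge>M. mnorm X (tail N (msmul X c x)) < e" if e: "e > 0" for e
      proof -
        have "e / (cmod c + 1) > 0" using e by (simp add: add_nonneg_pos)
        then obtain M where M: "\<And>N. N \<ge> M \<Longrightarrow> mnorm X (tail N x) < e / (cmod c + 1)"
          using span_smul.IH unfolding G_def by blast
        have "mnorm X (tail N (msmul X c x)) < e" if "N \<ge> M" for N
        proof -
          have "cmod c * mnorm X (tail N x) \<le> cmod c * (e / (cmod c + 1))"
            using M[OF that] by (intro mult_left_mono) auto
          also have "\<dots> < e"
          proof -
            have "cmod c + 1 > 0" by (simp add: add_nonneg_pos)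
            then show ?thesis using e by (simp add: pos_divide_less_eq distrib_left mult.commute[of _ e])
          qed
          finally show ?thesis by (simp add: tail_smul x mnorm_msmul tail_mem)
        qed
        then show ?thesis by blast
      qed
      then show ?case using msmul_mem[OF x] by (simp add: G_def)
    qed
  qed
  obtain y where y: "y \<in> mspan X {mact X a z | a z. a \<in> A \<and> z \<in> mcarr X}" "mnorm X (msub X x y) < e / 2"
    using essential x half_gt_zero[OF e] unfolding essential_def by blast
  then have yG: "y \<in> G" using span by blast
  then have ym: "y \<in> mcarr X" by (simp add: G_def)
  obtain M where M: "\<And>N. N \<ge> M \<Longrightarrow> mnorm X (tail N y) < e / 2"
    using yG half_gt_zero[OF e] unfolding G_def by blast
  have sm: "msub X x y \<in> mcarr X" by (rule msub_mem[OF x ym])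
  have "mnorm X (tail N x) < e" if "N \<ge> M" for N
  proof -
    have "tail N x = madd X (tail N (msub X x y)) (tail N y)"
      using tail_add[OF sm ym, of N] by (simp add: cnormed_sub_add[OF cnormed x ym])
    then have "mnorm X (tail N x)
      \<le> mnorm X (tail N (msub X x y)) + mnorm X (tail N y)"
      using cnormed_triangle[OF cnormed tail_mem[OF sm] tail_mem[OF ym], of N N] by simp
    then show ?thesis using tail_le[OF sm, of N] y(2) M[OF that] by linarith
  qed
  then show ?thesis by blast
qed

section \<open>Coordinate subspaces as Banach spaces\<close>

lemma coord_space_simps [simp]:
  "mzero (coord_space X n) = mzero X" "madd (coord_space X n) = madd X" "msmul (coord_space X n) = msmul X"
  "mnorm (coord_space X n) = mnorm X" "msub (coord_space X n) = msub X"
  by (simp_all add: coord_space_def msub_def[abs_def])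

text \<open>\<open>pseq n\<close> is idempotent, so its range is its set of fixed vectors, and
  membership becomes an equation.\<close>

lemma coord_space_mem: "x \<in> mcarr (coord_space X n) \<longleftrightarrow> x \<in> mcarr X \<and> coord n x = x"
proof
  assume "x \<in> mcarr (coord_space X n)"
  then show "x \<in> mcarr X \<and> coord n x = x" by (auto simp: coord_space_def coord_mem coord_coord)
next
  assume "x \<in> mcarr X \<and> coord n x = x"
  then have "x = coord n x" "x \<in> mcarr X" by simp_all
  then show "x \<in> mcarr (coord_space X n)" unfolding coord_space_def by (simp add: image_iff) blast
qed

lemma coord_in_coord_space: "x \<in> mcarr X \<Longrightarrow> coord n x \<in> mcarr (coord_space X n)"
  by (simp add: coord_space_mem coord_mem coord_coord)

lemma coord_space_banach: "banach_space (coord_space X n)"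
proof -
  have sub: "mcarr (coord_space X n) \<subseteq> mcarr X" by (auto simp: coord_space_mem)
  have "cnormed_space (coord_space X n)"
    using mzero_mem coord_zero
    unfolding cnormed_space_def
    by (auto simp: coord_space_mem coord_add coord_smul cnormed_axioms[OF cnormed] intro: cnormed_commute[OF cnormed])
  moreover have "mod_complete (coord_space X n)"
    unfolding mod_complete_def coord_space_simps
  proof (intro allI impI)
    fix s :: "nat \<Rightarrow> 'v"
    assume s: "\<forall>k. s k \<in> mcarr (coord_space X n)"
      and C: "\<forall>e>0. \<exists>N. \<forall>m\<ge>N. \<forall>k\<ge>N. mnorm X (msub X (s m) (s k)) < e"
    from s have sX: "\<forall>k. s k \<in> mcarr X" using sub by blast
    obtain l where l: "l \<in> mcarr X" "\<forall>e>0. \<exists>N. \<forall>k\<ge>N. mnorm X (msub X (s k) l) < e"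
      using complete[unfolded mod_complete_def, rule_format, of s] sX C by blast
    \<comment> \<open>The limit \<open>l\<close> in \<open>X\<close> is replaced by its n-th
      coordinate: the contraction \<open>coord n\<close> fixes the terms of the sequence, so the
      coordinate is a limit as well.\<close>
    have "mnorm X (msub X (s k) (coord n l)) \<le> mnorm X (msub X (s k) l)" for k
    proof -
      have "msub X (s k) (coord n l) = coord n (msub X (s k) l)"
        using s sX l by (simp add: coord_sub coord_space_mem)
      then show ?thesis using coord_norm[of "msub X (s k) l" n] sX l msub_mem by simp
    qed
    then have "\<forall>e>0. \<exists>N. \<forall>k\<ge>N. mnorm X (msub X (s k) (coord n l)) < e"
      using l(2) by (meson le_less_trans)
    then show "\<exists>l\<in>mcarr (coord_space X n). \<forall>e>0. \<exists>N. \<forall>k\<ge>N. mnorm X (msub X (s k) l) < e"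
      using coord_in_coord_space[OF l(1)] by blast
  qed
  ultimately show ?thesis by (simp add: banach_space_def)
qed

end

section \<open>Coordinate spaces of projective modules\<close>

text \<open>Lifting problems for \<open>X\<^sub>n\<close> over \<open>\<complex>\<close> become lifting problems for \<open>X\<close> over \<open>A\<close> when the
  algebra acts through the \<open>n\<close>-th entry only. The injection \<open>j\<close> moves the space into the type over
  which projectivity is tested.\<close>
definition entry_module :: "nat \<Rightarrow> ('v \<Rightarrow> 'u) \<Rightarrow> 'v nmod \<Rightarrow> 'u nmod" where
  "entry_module n j V = \<lparr>mcarr = j ` mcarr V, mzero = j (mzero V),
     madd = (\<lambda>x y. j (madd V (inv j x) (inv j y))), msmul = (\<lambda>c x. j (msmul V c (inv j x))),
     mnorm = (\<lambda>x. mnorm V (inv j x)), mact = (\<lambda>a x. j (msmul V (a n) (inv j x)))\<rparr>"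

lemma entry_module_simps:
  assumes "inj j"
  shows "mcarr (entry_module n j V) = j ` mcarr V"
    "mzero (entry_module n j V) = j (mzero V)"
    "madd (entry_module n j V) (j x) (j y) = j (madd V x y)"
    "msmul (entry_module n j V) c (j x) = j (msmul V c x)"
    "mnorm (entry_module n j V) (j x) = mnorm V x"
    "mact (entry_module n j V) a (j x) = j (msmul V (a n) x)"
    "msub (entry_module n j V) (j x) (j y) = j (msub V x y)"
  using assms by (simp_all add: entry_module_def msub_def)

text \<open>Contractivity is \<open>norm_entry_le\<close>. As \<open>pseq n\<close> acts as the
  identity, every vector lies in the range of the action, which gives essentiality, and equals its
  own n-th coordinate, which gives homogeneity.\<close>

lemma (in sequence_algebra) entry_module_Hbar:
  assumes j: "inj j" and V: "banach_space V"
  shows "entry_module n j V \<in> Hbar A nA"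
proof -
  have cn: "cnormed_space V" and cp: "mod_complete V" using V by (auto simp: banach_space_def)
  note simps = entry_module_simps[OF j]
  have cnormed: "cnormed_space (entry_module n j V)"
    unfolding cnormed_space_def simps ball_simps
    using inj_eq[OF j]
    by (auto simp: simps cnormed_zero[OF cn] cnormed_axioms[OF cn] intro: cnormed_commute[OF cn])
  have "normed_module A nA (entry_module n j V)"
    unfolding normed_module_def simps ball_simps
    by (auto simp: simps cnormed cnormed_smul[OF cn] cnormed_smul_add[OF cn] cnormed_smul_smul[OF cn]
        cnormed_smul_add_left[OF cn] cnormed_norm_smul[OF cn] mult.commute[where 'a = complex]
        intro!: mult_right_mono cnormed_norm_ge_0[OF cn] norm_entry_le)
  moreover have "mod_complete (entry_module n j V)"
    unfolding mod_complete_def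
  proof (intro allI impI)
    fix s :: "nat \<Rightarrow> 'b"
    assume "\<forall>k. s k \<in> mcarr (entry_module n j V)"
      and C: "\<forall>e>0. \<exists>N. \<forall>m\<ge>N. \<forall>k\<ge>N. mnorm (entry_module n j V) (msub (entry_module n j V) (s m) (s k)) < e"
    then have "\<forall>k. \<exists>x\<in>mcarr V. s k = j x" by (auto simp: simps)
    then obtain r where r: "\<And>k. r k \<in> mcarr V" "\<And>k. s k = j (r k)" by metis
    have "\<forall>e>0. \<exists>N. \<forall>m\<ge>N. \<forall>k\<ge>N. mnorm V (msub V (r m) (r k)) < e"
      using C by (simp add: r simps)
    then obtain l where "l \<in> mcarr V" "\<forall>e>0. \<exists>N. \<forall>k\<ge>N. mnorm V (msub V (r k) l) < e"
      using cp[unfolded mod_complete_def, rule_format, of r] r by blast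
    then show "\<exists>l\<in>mcarr (entry_module n j V). \<forall>e>0. \<exists>N. \<forall>k\<ge>N.
        mnorm (entry_module n j V) (msub (entry_module n j V) (s k) l) < e"
      by (intro bexI[of _ "j l"]) (simp_all add: r simps)
  qed
  moreover have pn: "mact (entry_module n j V) (pseq n) x = x" if "x \<in> mcarr (entry_module n j V)" for x
    using that by (auto simp: simps pseq_def cnormed_smul_one[OF cn])
  have "essential A (entry_module n j V)"
    unfolding essential_def
  proof (intro ballI allI impI)
    fix x and e :: real assume x: "x \<in> mcarr (entry_module n j V)" and e: "e > 0"
    let ?S = "{mact (entry_module n j V) a z |a z. a \<in> A \<and> z \<in> mcarr (entry_module n j V)}"
    have "\<exists>a z. x = mact (entry_module n j V) a z \<and> a \<in> A \<and> z \<in> mcarr (entry_module n j V)"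
      by (intro exI[of _ "pseq n"] exI[of _ x]) (simp add: pn x pseq_mem)
    then have "x \<in> mspan (entry_module n j V) ?S" by (intro mspan.span_base) blast
    moreover have "mnorm (entry_module n j V) (msub (entry_module n j V) x x) < e"
      using x e by (auto simp: simps msub_def[of V] cnormed_minus[OF cn] cnormed_norm_zero[OF cn])
    ultimately show "\<exists>y\<in>mspan (entry_module n j V) ?S. mnorm (entry_module n j V) (msub (entry_module n j V) x y) < e"
      by blast
  qed
  moreover have "homogeneous (entry_module n j V)"
    unfolding homogeneous_def using pn by metis
  ultimately show ?thesis using cnormed by (simp add: Hbar_def)
qed

text \<open>Every \<open>x\<close> in \<open>X\<^sub>n\<close> is a unit vector times its norm, so
  the map from l1(S) sending each basis vector \<open>s\<close> to \<open>s\<close> attains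
  \<open>x\<close> without loss of norm and is coisometric. The coordinate map of \<open>X\<close>
  is a morphism into the entry module of \<open>X\<^sub>n\<close>, since \<open>a\<close> acts on
  n-th coordinates by the scalar \<open>a n\<close>. A lifting of it, restricted to
  \<open>X\<^sub>n\<close>, is the required right inverse.\<close>

lemma (in hbar_module) coord_space_factors_through_l1:
  fixes j1 :: "'v \<Rightarrow> 'u" and j2 :: "('v \<Rightarrow> complex) \<Rightarrow> 'u"
  assumes proj: "ext_proj_wrt A (Hbar A nA :: 'u nmod set) X" and j: "inj j1" "inj j2" and \<epsilon>: "0 < \<epsilon>"
    and S: "S = {x \<in> mcarr (coord_space X n). mnorm X x = 1}"
  shows "\<exists>\<psi>. bounded_linear_map (coord_space X n) (l1space S) \<psi> \<and>
    (\<forall>x\<in>mcarr (coord_space X n). mnorm (l1space S) (\<psi> x) \<le> (1 + \<epsilon>) * mnorm X x \<and>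
       l1_map (coord_space X n) S (\<lambda>x. x) (\<psi> x) = x)"
proof -
  let ?N = "coord_space X n"
  have N: "banach_space ?N" by (rule coord_space_banach)
  have cN: "cnormed_space ?N" by (rule banach_cnormed[OF N])
  have S1: "s \<in> mcarr ?N" "mnorm ?N s \<le> 1" if "s \<in> S" for s using that S by auto
  define t where "t = l1_map ?N S (\<lambda>x. x)"
  have t: "t c \<in> mcarr ?N" "mnorm X (t c) \<le> 1 * mnorm (l1space S) c" if "c \<in> mcarr (l1space S)" for c
    using l1_map_has_sum(1)[OF N S1 that] l1_map_norm[OF N S1 that] by (auto simp: t_def)
  have t_add: "t (madd (l1space S) c d) = madd X (t c) (t d)"
    if "c \<in> mcarr (l1space S)" "d \<in> mcarr (l1space S)" for c d
    using l1_map_add[OF N S1 that] by (simp add: t_def)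
  have t_smul: "t (msmul (l1space S) a c) = msmul X a (t c)" if "c \<in> mcarr (l1space S)" for a c
    using l1_map_smul[OF N S1 that] by (simp add: t_def)
  have l1: "banach_space (l1space S)" by (simp add: banach_space_def l1space_cnormed l1space_complete)
  define Z where "Z = entry_module n j1 ?N"
  define Y where "Y = entry_module n j2 (l1space S)"
  have ZY: "Z \<in> Hbar A nA" "Y \<in> Hbar A nA"
    unfolding Z_def Y_def by (intro entry_module_Hbar j N l1)+
  note Zs = entry_module_simps[OF j(1), where V = ?N and n = n, folded Z_def]
  note Ys = entry_module_simps[OF j(2), where V = "l1space S" and n = n, folded Y_def]
  define \<tau> where "\<tau> y = j1 (t (inv j2 y))" for y
  have \<tau>: "\<tau> (j2 c) = j1 (t c)" for c using j by (simp add: \<tau>_def)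
  have \<tau>_norm: "mnorm Z (\<tau> y) \<le> 1 * mnorm Y y" if "y \<in> mcarr Y" for y
    using that t(2) by (auto simp: Ys(1,5) \<tau> Zs(5))
  have \<tau>_morphism: "morphism A Y Z \<tau>"
    unfolding morphism_def
  proof (intro conjI)
    show "\<exists>C. \<forall>x\<in>mcarr Y. mnorm Z (\<tau> x) \<le> C * mnorm Y x" using \<tau>_norm by blast
  qed (auto simp: Ys(1,3,4,6) Zs(1,3,4,6) \<tau> t t_add t_smul simp del: l1space_simps)
  have "coisometric A Y Z \<tau>"
    unfolding coisometric_def
  proof (intro conjI ballI allI impI)
    show "opnorm Y Z \<tau> \<le> 1" by (rule opnorm_le[OF _ \<tau>_norm]) auto
    fix z and e :: real assume z: "z \<in> mcarr Z" and e: "e > 0"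
    then obtain x where x: "x \<in> mcarr ?N" "z = j1 x" by (auto simp: Zs)
    have "\<exists>c\<in>mcarr (l1space S). t c = x \<and> mnorm (l1space S) c \<le> mnorm X x"
    proof (cases "mnorm X x = 0")
      case True
      then have "x = mzero X" using cnormed_norm_eq_0[OF cN x(1)] by simp
      moreover have "t (mzero (l1space S)) = mzero X"
      proof -
        have "t (msmul (l1space S) 0 (mzero (l1space S))) = msmul ?N 0 (t (mzero (l1space S)))"
          using t_smul[OF cnormed_zero[OF l1space_cnormed]] by simp
        then show ?thesis
          using cnormed_smul_0[OF cN t(1)[OF cnormed_zero[OF l1space_cnormed]]]
            cnormed_smul_0[OF l1space_cnormed cnormed_zero[OF l1space_cnormed]] by simp
      qed
      moreover have "mnorm (l1space S) (mzero (l1space S)) = 0" by (rule cnormed_norm_zero[OF l1space_cnormed])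
      ultimately show ?thesis using True cnormed_zero[OF l1space_cnormed] by (metis order_refl)
    next
      case False
      then have pos: "mnorm X x > 0" using cnormed_norm_ge_0[OF cN x(1)] by simp
      define s where "s = msmul X (complex_of_real (1 / mnorm X x)) x"
      have "s \<in> S"
        using cnormed_smul[OF cN x(1)] cnormed_norm_smul[OF cN x(1)] pos by (simp add: S s_def norm_divide)
      let ?c = "msmul (l1space S) (complex_of_real (mnorm X x)) (l1_unit s)"
      have "t ?c = msmul X (complex_of_real (mnorm X x)) s"
        using t_smul[OF l1_unit(1)[OF \<open>s \<in> S\<close>]] l1_map_unit[OF N S1 \<open>s \<in> S\<close>] by (simp add: t_def)
      also have "\<dots> = x"
        using cnormed_smul_smul[OF cN x(1)] cnormed_smul_one[OF cN x(1)] pos by (simp add: s_def)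
      finally have "t ?c = x" .
      moreover have "?c \<in> mcarr (l1space S)" by (rule cnormed_smul[OF l1space_cnormed l1_unit(1)[OF \<open>s \<in> S\<close>]])
      moreover have "mnorm (l1space S) ?c = mnorm X x"
        unfolding cnormed_norm_smul[OF l1space_cnormed l1_unit(1)[OF \<open>s \<in> S\<close>]] l1_unit(2)[OF \<open>s \<in> S\<close>]
        using pos by simp
      ultimately show ?thesis by (intro bexI[of _ ?c]) auto
    qed
    then obtain c where "c \<in> mcarr (l1space S)" "t c = x" "mnorm (l1space S) c \<le> mnorm X x" by blast
    then show "\<exists>y\<in>mcarr Y. \<tau> y = z \<and> mnorm Y y < mnorm Z z + e"
      using e x by (intro bexI[of _ "j2 c"]) (auto simp: \<tau> Ys Zs simp del: l1space_simps)
  qed (rule \<tau>_morphism)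
  define \<phi> where "\<phi> x = j1 (coord n x)" for x
  have \<phi>_norm: "mnorm Z (\<phi> x) \<le> 1 * mnorm X x" if "x \<in> mcarr X" for x
    using coord_norm[OF that] by (simp add: \<phi>_def Zs)
  have \<phi>: "morphism A X Z \<phi>"
    unfolding morphism_def
  proof (intro conjI)
    show "\<exists>C. \<forall>x\<in>mcarr X. mnorm Z (\<phi> x) \<le> C * mnorm X x" using \<phi>_norm by blast
  qed (auto simp: \<phi>_def Zs coord_in_coord_space coord_add coord_smul coord_act)
  have \<phi>1: "opnorm X Z \<phi> \<le> 1" by (rule opnorm_le[OF _ \<phi>_norm]) auto
  obtain \<psi> where \<psi>: "morphism A X Y \<psi>" "\<And>x. x \<in> mcarr X \<Longrightarrow> \<tau> (\<psi> x) = \<phi> x"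
    and \<psi>_norm: "opnorm X Y \<psi> < opnorm X Z \<phi> + \<epsilon>"
    using proj ZY \<open>coisometric A Y Z \<tau>\<close> \<phi> \<epsilon> unfolding ext_proj_wrt_def by blast
  define \<psi>' where "\<psi>' x = inv j2 (\<psi> x)" for x
  have \<psi>': "\<psi>' x \<in> mcarr (l1space S)" "\<psi> x = j2 (\<psi>' x)" if "x \<in> mcarr X" for x
  proof -
    have "\<psi> x \<in> j2 ` mcarr (l1space S)" using \<psi>(1) that unfolding morphism_def Ys(1) by blast
    then show "\<psi>' x \<in> mcarr (l1space S)" "\<psi> x = j2 (\<psi>' x)" using j by (auto simp: \<psi>'_def)
  qed
  have sub: "x \<in> mcarr X" "coord n x = x" if "x \<in> mcarr ?N" for x using that by (simp_all add: coord_space_mem)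
  have \<psi>'_norm: "mnorm (l1space S) (\<psi>' x) \<le> (1 + \<epsilon>) * mnorm X x" if x: "x \<in> mcarr X" for x
  proof -
    have "mnorm (l1space S) (\<psi>' x) \<le> opnorm X Y \<psi> * mnorm X x"
      using opnorm_bound[OF cnormed \<psi>(1) x] by (simp only: \<psi>'(2)[OF x] Ys(5))
    also have "\<dots> \<le> (1 + \<epsilon>) * mnorm X x"
      using \<psi>_norm \<phi>1 mnorm_nonneg[OF x] by (intro mult_right_mono) auto
    finally show ?thesis .
  qed
  have "bounded_linear_map ?N (l1space S) \<psi>'"
    unfolding bounded_linear_map_def coord_space_simps
  proof (intro conjI ballI allI)
    fix x y c assume x: "x \<in> mcarr ?N"
    show "\<psi>' x \<in> mcarr (l1space S)" using \<psi>' sub x by simp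
    have "j2 (\<psi>' (msmul X c x)) = j2 (msmul (l1space S) c (\<psi>' x))"
      using \<psi>(1) sub(1)[OF x] \<psi>'(2) msmul_mem unfolding morphism_def by (metis Ys(4))
    then show "\<psi>' (msmul X c x) = msmul (l1space S) c (\<psi>' x)" using j by (simp add: inj_eq)
    assume y: "y \<in> mcarr ?N"
    have "j2 (\<psi>' (madd X x y)) = j2 (madd (l1space S) (\<psi>' x) (\<psi>' y))"
      using \<psi>(1) sub(1)[OF x] sub(1)[OF y] \<psi>'(2) madd_mem unfolding morphism_def by (metis Ys(3))
    then show "\<psi>' (madd X x y) = madd (l1space S) (\<psi>' x) (\<psi>' y)" using j by (simp add: inj_eq)
  next
    show "\<exists>C. \<forall>x\<in>mcarr ?N. mnorm (l1space S) (\<psi>' x) \<le> C * mnorm X x" using \<psi>'_norm sub by blast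
  qed
  moreover have "t (\<psi>' x) = x" if "x \<in> mcarr ?N" for x
  proof -
    have "j1 (t (\<psi>' x)) = j1 x"
      using \<psi>(2)[OF sub(1)[OF that]] sub(2)[OF that] \<psi>'(2)[OF sub(1)[OF that]] by (simp add: \<tau> \<phi>_def)
    then show ?thesis using j by (simp add: inj_eq)
  qed
  ultimately show ?thesis using \<psi>'_norm sub unfolding t_def by blast
qed

text \<open>\<open>E\<close> is the copy of \<open>X\<^sub>n\<close> in the ambient Banach type,
  where \<open>ell1_structure\<close> applies, and \<open>p\<close> leads back. The index set is
  transported along \<open>p\<close> as well, so that it consists of vectors of
  \<open>X\<^sub>n\<close>.\<close>

theorem (in hbar_module) coord_space_l1_of_projective:
  fixes j1 :: "'v \<Rightarrow> 'u" and j2 :: "('v \<Rightarrow> complex) \<Rightarrow> 'u"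
  assumes proj: "ext_proj_wrt A (Hbar A nA :: 'u nmod set) X" and j: "inj j1" "inj j2"
  shows "\<exists>L :: 'v set. isometric_iso (coord_space X n) (l1space L)"
proof -
  let ?N = "coord_space X n"
  have N: "banach_space ?N" by (rule coord_space_banach)
  define S where "S = {x \<in> mcarr ?N. mnorm X x = 1}"
  have S1: "s \<in> mcarr ?N" "mnorm ?N s \<le> 1" if "s \<in> S" for s using that S_def by auto
  define E where "E = bemb ?N ` mcarr ?N"
  define p where "p F = bcoord F ?N" for F
  have p: "p F \<in> mcarr ?N" "bemb ?N (p F) = F" if "F \<in> E" for F
    using bcoord_mem_banach[OF N] bemb_bcoord[OF N] that by (simp_all add: p_def E_def)
  have p_bemb: "p (bemb ?N x) = x" if "x \<in> mcarr ?N" for x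
    unfolding p_def by (rule bcoord_bemb_self[OF N that])
  have E: "bemb ?N x \<in> E" if "x \<in> mcarr ?N" for x using that by (simp add: E_def)
  have p_add: "p (F + G) = madd X (p F) (p G)" if "F \<in> E" "G \<in> E" for F G
    using p_bemb[OF cnormed_add[OF banach_cnormed[OF N] p(1)[OF that(1)] p(1)[OF that(2)]]]
      bemb_add[OF N p(1)[OF that(1)] p(1)[OF that(2)]] p(2) that by simp
  have p_cscale: "p (c *\<^sub>C F) = msmul X c (p F)" if "F \<in> E" for F c
    using p_bemb[OF cnormed_smul[OF banach_cnormed[OF N] p(1)[OF that]], of c]
      bemb_smul[OF N p(1)[OF that], of c] p(2) that by simp
  have p_norm: "mnorm X (p F) = norm F" if "F \<in> E" for F
    using norm_bemb[OF N p(1)[OF that]] p(2)[OF that] by simp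
  interpret ell1_factorable E S "bemb ?N"
  proof
    show "csubspace E" "closed E" unfolding E_def by (rule csubspace_bemb[OF N] closed_bemb[OF N])+
    show "bemb ?N s \<in> E" "norm (bemb ?N s) \<le> 1" if "s \<in> S" for s
      using S1[OF that] by (simp_all add: E_def norm_bemb[OF N])
    fix \<epsilon> :: real assume "0 < \<epsilon>"
    then obtain \<psi> where \<psi>: "bounded_linear_map ?N (l1space S) \<psi>"
      "\<And>x. x \<in> mcarr ?N \<Longrightarrow> mnorm (l1space S) (\<psi> x) \<le> (1 + \<epsilon>) * mnorm X x"
      "\<And>x. x \<in> mcarr ?N \<Longrightarrow> l1_map ?N S (\<lambda>x. x) (\<psi> x) = x"
      using coord_space_factors_through_l1[OF proj j _ S_def] by blast
    note \<psi>m = bounded_linear_mapD(1)[OF \<psi>(1)]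
    define \<psi>' where "\<psi>' s F = \<psi> (p F) s" for s F
    have "cfunctional E (\<psi>' s)" for s
      unfolding cfunctional_def
    proof (intro conjI ballI allI exI)
      fix F G c assume F: "F \<in> E"
      show "\<psi>' s (c *\<^sub>C F) = c * \<psi>' s F"
        using bounded_linear_mapD(3)[OF \<psi>(1) p(1)[OF F]] by (simp add: \<psi>'_def p_cscale F)
      show "cmod (\<psi>' s F) \<le> (1 + \<epsilon>) * norm F"
        unfolding \<psi>'_def
        using order_trans[OF l1space_norm_ge[OF \<psi>m[OF p(1)[OF F]]] \<psi>(2)[OF p(1)[OF F]]] by (simp add: p_norm F)
      assume G: "G \<in> E"
      show "\<psi>' s (F + G) = \<psi>' s F + \<psi>' s G"
        using bounded_linear_mapD(2)[OF \<psi>(1) p(1)[OF F] p(1)[OF G]] by (simp add: \<psi>'_def p_add F G)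
    qed
    moreover have "(\<lambda>s. cmod (\<psi>' s F)) summable_on S" if "F \<in> E" for F
      unfolding \<psi>'_def by (rule l1space_summable[OF \<psi>m[OF p(1)[OF that]]])
    moreover have "(\<Sum>\<^sub>\<infinity>s\<in>S. cmod (\<psi>' s F)) \<le> (1 + \<epsilon>) * norm F" if "F \<in> E" for F
      using \<psi>(2)[OF p(1)[OF that]] by (simp add: \<psi>'_def p_norm that)
    moreover have "((\<lambda>s. \<psi>' s F *\<^sub>C bemb ?N s) has_sum F) S" if "F \<in> E" for F
      using l1_map_has_sum(2)[where y = "\<lambda>x. x", OF N S1 \<psi>m[OF p(1)[OF that]]] by (simp add: \<psi>'_def \<psi>(3) p that)
    ultimately show "\<exists>\<psi>. (\<forall>s\<in>S. cfunctional E (\<psi> s)) \<and>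
      (\<forall>F\<in>E. (\<lambda>s. cmod (\<psi> s F)) summable_on S \<and> (\<Sum>\<^sub>\<infinity>s\<in>S. cmod (\<psi> s F)) \<le> (1 + \<epsilon>) * norm F \<and>
              ((\<lambda>s. \<psi> s F *\<^sub>C bemb ?N s) has_sum F) S)"
      by (intro exI[of _ \<psi>']) blast
  qed
  obtain \<Lambda> f where \<Lambda>: "\<Lambda> \<subseteq> E" "\<And>e. e \<in> \<Lambda> \<Longrightarrow> cfunctional E (f e)"
    "\<And>y. y \<in> E \<Longrightarrow> (\<lambda>e. cmod (f e y)) summable_on \<Lambda>"
    "\<And>y. y \<in> E \<Longrightarrow> (\<Sum>\<^sub>\<infinity>e\<in>\<Lambda>. cmod (f e y)) = norm y"
    "\<And>c. (\<lambda>e. cmod (c e)) summable_on \<Lambda> \<Longrightarrow> \<exists>y\<in>E. \<forall>e\<in>\<Lambda>. f e y = c e"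
    by (rule ell1_structure) (rule that)
  define L where "L = p ` \<Lambda>"
  define T where "T x = (\<lambda>l. if l \<in> L then f (bemb ?N l) (bemb ?N x) else 0)" for x
  have bij: "bij_betw p \<Lambda> L"
    unfolding L_def by (rule inj_on_imp_bij_betw, rule inj_on_inverseI[of _ "bemb ?N"]) (use p(2) \<Lambda>(1) in auto)
  have Tp: "T x (p e) = f e (bemb ?N x)" if "e \<in> \<Lambda>" for e x
    using that \<Lambda>(1) p(2) by (auto simp: T_def L_def)
  have T: "T x \<in> mcarr (l1space L)" "mnorm (l1space L) (T x) = mnorm X x" if x: "x \<in> mcarr ?N" for x
  proof -
    have "((\<lambda>e. cmod (f e (bemb ?N x))) has_sum mnorm X x) \<Lambda>"
      using has_sum_infsum[OF \<Lambda>(3)[OF E[OF x]]] \<Lambda>(4)[OF E[OF x]] by (simp add: norm_bemb[OF N x])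
    then have "((\<lambda>e. cmod (T x (p e))) has_sum mnorm X x) \<Lambda>"
      by (rule has_sum_cong[THEN iffD1, rotated]) (simp add: Tp)
    then have "((\<lambda>l. cmod (T x l)) has_sum mnorm X x) L"
      by (simp add: has_sum_reindex_bij_betw[OF bij, of "\<lambda>l. cmod (T x l)"])
    then show "T x \<in> mcarr (l1space L)" "mnorm (l1space L) (T x) = mnorm X x"
      by (auto simp: l1space_mem has_sum_imp_summable infsumI T_def)
  qed
  have f_lin: "f e (F + G) = f e F + f e G" "f e (c *\<^sub>C F) = c * f e F"
    if "e \<in> \<Lambda>" "F \<in> E" "G \<in> E" for e F G c
    using \<Lambda>(2)[OF that(1)] that(2,3) unfolding cfunctional_def by blast+
  have T_ext: "T x = g" if "\<And>e. e \<in> \<Lambda> \<Longrightarrow> f e (bemb ?N x) = g (p e)" "\<And>l. l \<notin> L \<Longrightarrow> g l = 0" for x g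
  proof
    show "T x l = g l" for l
    proof (cases "l \<in> L")
      case True
      then obtain e where "e \<in> \<Lambda>" "l = p e" by (auto simp: L_def)
      then show ?thesis using that(1) by (simp add: Tp)
    next
      case False
      then show ?thesis using that(2) by (simp add: T_def)
    qed
  qed
  have T_add: "T (madd X x y) = madd (l1space L) (T x) (T y)" if "x \<in> mcarr ?N" "y \<in> mcarr ?N" for x y
    using bemb_add[OF N that] that by (intro T_ext) (simp add: Tp f_lin E, simp add: T_def)
  have T_smul: "T (msmul X c x) = msmul (l1space L) c (T x)" if "x \<in> mcarr ?N" for x c
    using bemb_smul[OF N that, of c] that by (intro T_ext) (simp add: Tp f_lin(2)[OF _ _ E] E, simp add: T_def)
  have "bij_betw T (mcarr ?N) (mcarr (l1space L))"
    unfolding bij_betw_def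
  proof (intro conjI equalityI subsetI)
    have cN: "cnormed_space ?N" by (rule banach_cnormed[OF N])
    show "inj_on T (mcarr ?N)"
    proof (rule inj_onI)
      fix x y assume xy: "x \<in> mcarr ?N" "y \<in> mcarr ?N" "T x = T y"
      have s: "msub ?N x y \<in> mcarr ?N" by (rule cnormed_sub[OF cN xy(1,2)])
      have "T (msub ?N x y) = (\<lambda>l. 0)"
        using T_add[OF xy(1) cnormed_smul[OF cN xy(2), of "-1"]] T_smul[OF xy(2), of "-1"] xy(3)
        by (simp add: msub_def)
      then have "mnorm X (msub ?N x y) = 0" using T(2)[OF s] by simp
      then show "x = y"
        using cnormed_norm_eq_0[OF cN s] cnormed_sub_eq_zero[OF cN xy(1,2)] by simp
    qed
    show "c \<in> mcarr (l1space L)" if "c \<in> T ` mcarr ?N" for c using that T(1) by auto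
    fix c assume c: "c \<in> mcarr (l1space L)"
    have "(\<lambda>e. cmod (c (p e))) summable_on \<Lambda>"
      using l1space_summable[OF c] by (simp add: summable_on_reindex_bij_betw[OF bij, of "\<lambda>l. cmod (c l)"])
    then obtain y where y: "y \<in> E" "\<And>e. e \<in> \<Lambda> \<Longrightarrow> f e y = c (p e)"
      using \<Lambda>(5)[of "\<lambda>e. c (p e)"] by blast
    have "T (p y) = c" using c y p(2)[OF y(1)] by (intro T_ext) (auto simp: l1space_mem)
    then show "c \<in> T ` mcarr ?N" using p(1)[OF y(1)] by blast
  qed
  then have "isometric_iso ?N (l1space L)"
    unfolding isometric_iso_def coord_space_simps using T T_add T_smul by blast
  then show ?thesis by blast
qed

section \<open>Gluing coordinate liftings\<close>

lemma bounded_linear_map_comp: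
  assumes W: "cnormed_space W" and S: "bounded_linear_map V W S" and T: "bounded_linear_map W U T"
  shows "bounded_linear_map V U (\<lambda>x. T (S x))"
proof -
  obtain C D where C: "\<And>x. x \<in> mcarr V \<Longrightarrow> mnorm W (S x) \<le> C * mnorm V x"
    and D: "\<And>x. x \<in> mcarr W \<Longrightarrow> mnorm U (T x) \<le> D * mnorm W x"
    using bounded_linear_mapD(4)[OF S] bounded_linear_mapD(4)[OF T] by blast
  have "mnorm U (T (S x)) \<le> (\<bar>D\<bar> * C) * mnorm V x" if x: "x \<in> mcarr V" for x
  proof -
    have Sx: "S x \<in> mcarr W" by (rule bounded_linear_mapD(1)[OF S x])
    have "mnorm U (T (S x)) \<le> D * mnorm W (S x)" by (rule D[OF Sx])
    also have "\<dots> \<le> \<bar>D\<bar> * mnorm W (S x)" using cnormed_norm_ge_0[OF W Sx] by (intro mult_right_mono) auto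
    also have "\<dots> \<le> \<bar>D\<bar> * (C * mnorm V x)" using C[OF x] by (intro mult_left_mono) auto
    finally show ?thesis by (simp add: mult.assoc)
  qed
  then show ?thesis
    unfolding bounded_linear_map_def
    by (auto simp: bounded_linear_mapD(1-3)[OF S] bounded_linear_mapD(1-3)[OF T])
qed

text \<open>Projectivity of l1: lift the basis vectors with the common bound \<open>K\<close> and
  extend by \<open>l1_map\<close>. The two sides of the lifting identity agree on the basis, hence
  everywhere.\<close>

lemma l1_lifting:
  assumes N: "cnormed_space N" and iso: "isometric_iso N (l1space L)"
    and W: "banach_space W" and Z: "cnormed_space Z"
    and \<tau>: "bounded_linear_map W Z \<tau>" and \<phi>: "bounded_linear_map N Z \<phi>"
    and lift: "\<And>x. x \<in> mcarr N \<Longrightarrow> mnorm N x \<le> 1 \<Longrightarrow> \<exists>y\<in>mcarr W. \<tau> y = \<phi> x \<and> mnorm W y \<le> K"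
  shows "\<exists>\<psi>. bounded_linear_map N W \<psi> \<and> (\<forall>x\<in>mcarr N. \<tau> (\<psi> x) = \<phi> x \<and> mnorm W (\<psi> x) \<le> K * mnorm N x)"
proof -
  obtain T where bij: "bij_betw T (mcarr N) (mcarr (l1space L))"
    and T_add: "\<And>x y. x \<in> mcarr N \<Longrightarrow> y \<in> mcarr N \<Longrightarrow> T (madd N x y) = madd (l1space L) (T x) (T y)"
    and T_smul: "\<And>c x. x \<in> mcarr N \<Longrightarrow> T (msmul N c x) = msmul (l1space L) c (T x)"
    and T_norm: "\<And>x. x \<in> mcarr N \<Longrightarrow> mnorm (l1space L) (T x) = mnorm N x"
    using iso unfolding isometric_iso_def by blast
  have T_mem: "T x \<in> mcarr (l1space L)" if "x \<in> mcarr N" for x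
    using bij that by (auto simp: bij_betw_def)
  have T: "bounded_linear_map N (l1space L) T"
    unfolding bounded_linear_map_def
  proof (intro conjI ballI allI exI)
    show "mnorm (l1space L) (T x) \<le> 1 * mnorm N x" if "x \<in> mcarr N" for x using T_norm[OF that] by simp
  qed (use T_mem T_add T_smul in auto)
  define R where "R = inv_into (mcarr N) T"
  have R: "R c \<in> mcarr N" "T (R c) = c" if "c \<in> mcarr (l1space L)" for c
    using bij that unfolding R_def bij_betw_def by (metis inv_into_into, metis f_inv_into_f)
  have RT: "R (T x) = x" if "x \<in> mcarr N" for x
    using bij that unfolding R_def bij_betw_def by simp
  have R_norm: "mnorm N (R c) = mnorm (l1space L) c" if "c \<in> mcarr (l1space L)" for c
    using T_norm[OF R(1)[OF that]] R(2)[OF that] by simp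
  have R_lin: "bounded_linear_map (l1space L) N R"
    unfolding bounded_linear_map_def
  proof (intro conjI ballI allI exI)
    fix c d a assume c: "c \<in> mcarr (l1space L)"
    show "R c \<in> mcarr N" by (rule R(1)[OF c])
    show "mnorm N (R c) \<le> 1 * mnorm (l1space L) c" using R_norm[OF c] by simp
    show "R (msmul (l1space L) a c) = msmul N a (R c)"
      using RT[OF cnormed_smul[OF N R(1)[OF c]]] T_smul[OF R(1)[OF c]] R(2)[OF c] by metis
    assume d: "d \<in> mcarr (l1space L)"
    show "R (madd (l1space L) c d) = madd N (R c) (R d)"
      using RT[OF cnormed_add[OF N R(1)[OF c] R(1)[OF d]]] T_add[OF R(1)[OF c] R(1)[OF d]] R(2)[OF c] R(2)[OF d] by metis
  qed
  have "\<forall>i\<in>L. \<exists>y\<in>mcarr W. \<tau> y = \<phi> (R (l1_unit i)) \<and> mnorm W y \<le> K"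
    using lift R(1) R_norm l1_unit by (metis order_refl)
  then obtain y where y: "\<And>i. i \<in> L \<Longrightarrow> y i \<in> mcarr W" "\<And>i. i \<in> L \<Longrightarrow> mnorm W (y i) \<le> K"
    and \<tau>y: "\<And>i. i \<in> L \<Longrightarrow> \<tau> (y i) = \<phi> (R (l1_unit i))"
    by metis
  let ?P = "l1_map W L y"
  have P_norm: "mnorm W (?P c) \<le> K * mnorm (l1space L) c" if "c \<in> mcarr (l1space L)" for c
    by (rule l1_map_norm[OF W y that])
  have P: "bounded_linear_map (l1space L) W ?P"
    unfolding bounded_linear_map_def
    by (intro conjI ballI allI exI[of _ K] l1_map_has_sum(1)[OF W y] l1_map_add[OF W y] l1_map_smul[OF W y] P_norm)
  have eq: "\<tau> (?P c) = \<phi> (R c)" if "c \<in> mcarr (l1space L)" for c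
    by (rule bounded_linear_map_l1_eqI[OF Z bounded_linear_map_comp[OF banach_cnormed[OF W] P \<tau>]
          bounded_linear_map_comp[OF N R_lin \<phi>] _ that])
      (simp add: l1_map_unit[OF W y] \<tau>y)
  have "bounded_linear_map N W (\<lambda>x. ?P (T x))"
    by (rule bounded_linear_map_comp[OF l1space_cnormed T P])
  moreover have "\<tau> (?P (T x)) = \<phi> x \<and> mnorm W (?P (T x)) \<le> K * mnorm N x" if "x \<in> mcarr N" for x
    using eq[OF T_mem[OF that]] P_norm[OF T_mem[OF that]] T_norm[OF that] RT[OF that] by simp
  ultimately show ?thesis by blast
qed

section \<open>A lifting problem and its coordinates\<close>

locale hbar_lifting_problem =
  X: hbar_module A nA X + Y: hbar_module A nA Y + Z: hbar_module A nA Z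
  for A nA and X :: "'v nmod" and Y :: "'u nmod" and Z :: "'u nmod" +
  fixes \<tau> :: "'u \<Rightarrow> 'u" and \<phi> :: "'v \<Rightarrow> 'u"
  assumes coisometric: "coisometric A Y Z \<tau>" and \<phi>: "morphism A X Z \<phi>"
begin

lemma \<tau>: "morphism A Y Z \<tau>"
  using coisometric by (simp add: coisometric_def)

lemma \<tau>_norm:
  assumes "y \<in> mcarr Y"
  shows "mnorm Z (\<tau> y) \<le> mnorm Y y"
proof -
  have "opnorm Y Z \<tau> * mnorm Y y \<le> 1 * mnorm Y y"
    using coisometric Y.mnorm_nonneg[OF assms] unfolding coisometric_def by (intro mult_right_mono) auto
  with opnorm_bound[OF Y.cnormed \<tau> assms] show ?thesis by simp
qed

lemma \<tau>_lift:
  assumes "z \<in> mcarr Z" "e > 0"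
  obtains y where "y \<in> mcarr Y" "\<tau> y = z" "mnorm Y y < mnorm Z z + e"
  using coisometric assms unfolding coisometric_def by blast

lemma \<tau>_mem: "y \<in> mcarr Y \<Longrightarrow> \<tau> y \<in> mcarr Z"
  and \<phi>_mem: "x \<in> mcarr X \<Longrightarrow> \<phi> x \<in> mcarr Z"
  using \<tau> \<phi> unfolding morphism_def by blast+

lemma \<tau>_coord: "y \<in> mcarr Y \<Longrightarrow> \<tau> (Y.coord n y) = Z.coord n (\<tau> y)"
  and \<phi>_coord: "x \<in> mcarr X \<Longrightarrow> \<phi> (X.coord n x) = Z.coord n (\<phi> x)"
  using \<tau> \<phi> X.pseq_mem unfolding morphism_def by blast+

lemma \<phi>_smul: "x \<in> mcarr X \<Longrightarrow> \<phi> (msmul X c x) = msmul Z c (\<phi> x)"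
  using \<phi> unfolding morphism_def by blast

abbreviation \<Phi> :: real where "\<Phi> \<equiv> opnorm X Z \<phi>"

lemma \<Phi>: "0 \<le> \<Phi>" "x \<in> mcarr X \<Longrightarrow> mnorm Z (\<phi> x) \<le> \<Phi> * mnorm X x"
  using opnorm_nonneg[OF X.cnormed \<phi>] opnorm_bound[OF X.cnormed \<phi>] by auto

text \<open>The norm of \<open>\<phi>\<close> on \<open>X\<^sub>n\<close>. Liftings on
  \<open>X\<^sub>n\<close> are measured against it and not against the global norm
  \<open>\<Phi>\<close>, since only \<open>M n\<close> can be compared with actual values of
  \<open>\<phi>\<close> in the n-th coordinate.\<close>

definition M :: "nat \<Rightarrow> real" where
  "M n = (SUP x\<in>{x\<in>mcarr (coord_space X n). mnorm X x \<le> 1}. mnorm Z (\<phi> x))"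

lemma coord_space_subset: "x \<in> mcarr (coord_space X n) \<Longrightarrow> x \<in> mcarr X"
  by (simp add: X.coord_space_mem)

lemma M_bdd: "bdd_above ((\<lambda>x. mnorm Z (\<phi> x)) ` {x\<in>mcarr (coord_space X n). mnorm X x \<le> 1})"
proof (rule bdd_aboveI2)
  fix x assume "x \<in> {x\<in>mcarr (coord_space X n). mnorm X x \<le> 1}"
  then have x: "x \<in> mcarr X" "mnorm X x \<le> 1" using coord_space_subset by auto
  have "\<Phi> * mnorm X x \<le> \<Phi> * 1" using x \<Phi>(1) by (intro mult_left_mono) auto
  with \<Phi>(2)[OF x(1)] show "mnorm Z (\<phi> x) \<le> \<Phi>" by simp
qed

lemma M_upper:
  assumes "x \<in> mcarr (coord_space X n)" "mnorm X x \<le> 1"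
  shows "mnorm Z (\<phi> x) \<le> M n"
  unfolding M_def by (rule cSUP_upper[OF _ M_bdd]) (use assms in auto)

lemma M_nonneg: "0 \<le> M n"
proof -
  have z: "mzero X \<in> mcarr (coord_space X n)"
    by (simp add: X.coord_space_mem X.coord_zero X.mzero_mem)
  have "0 \<le> mnorm Z (\<phi> (mzero X))"
    by (rule Z.mnorm_nonneg[OF \<phi>_mem[OF X.mzero_mem]])
  also have "\<dots> \<le> M n" by (rule M_upper[OF z]) (simp add: X.mnorm_mzero)
  finally show ?thesis .
qed

text \<open>Scale by \<open>r\<close> a vector on which \<open>\<phi>\<close> nearly attains
  \<open>M n\<close>. The slack is a factor, so the same one serves in all coordinates at
  once.\<close>

lemma M_almost_attained:
  assumes \<kappa>: "\<kappa> > 1" and r: "r \<ge> 0"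
  shows "\<exists>x\<in>mcarr (coord_space X n). mnorm X x \<le> r \<and> M n * r \<le> \<kappa> * mnorm Z (\<phi> x)"
proof (cases "M n * r = 0")
  case True
  have "0 \<le> mnorm Z (\<phi> (mzero X))"
    by (rule Z.mnorm_nonneg[OF \<phi>_mem[OF X.mzero_mem]])
  then have "M n * r \<le> \<kappa> * mnorm Z (\<phi> (mzero X))" unfolding True using \<kappa> by simp
  then show ?thesis using r
    by (intro bexI[of _ "mzero X"])
      (simp_all add: X.coord_space_mem X.coord_zero X.mzero_mem X.mnorm_mzero)
next
  case False
  then have "M n > 0" using M_nonneg[of n] by (auto simp: less_le)
  then have "M n / \<kappa> < M n" using \<kappa> by (simp add: divide_less_eq)
  moreover have "{x\<in>mcarr (coord_space X n). mnorm X x \<le> 1} \<noteq> {}"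
    using X.mzero_mem X.mnorm_mzero X.coord_zero by (force simp: X.coord_space_mem)
  ultimately obtain x where x: "x \<in> mcarr (coord_space X n)" "mnorm X x \<le> 1" "M n / \<kappa> < mnorm Z (\<phi> x)"
    unfolding M_def using less_cSUP_iff[OF _ M_bdd] by blast
  let ?x = "msmul X (complex_of_real r) x"
  have xX: "x \<in> mcarr X" by (rule coord_space_subset[OF x(1)])
  have "?x \<in> mcarr (coord_space X n)"
    using x(1) by (simp add: X.coord_space_mem X.coord_smul X.msmul_mem)
  moreover have "mnorm X ?x \<le> r"
    using x(2) r by (simp add: X.mnorm_msmul[OF xX] mult_left_le)
  moreover have "M n * r \<le> \<kappa> * mnorm Z (\<phi> ?x)"
  proof -
    have "M n \<le> \<kappa> * mnorm Z (\<phi> x)" using x(3) \<kappa> by (simp add: divide_less_eq mult.commute)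
    then have "M n * r \<le> (\<kappa> * mnorm Z (\<phi> x)) * r" using r by (rule mult_right_mono)
    then show ?thesis
      using r by (simp add: \<phi>_smul xX Z.mnorm_msmul[OF \<phi>_mem[OF xX]] mult_ac)
  qed
  ultimately show ?thesis by blast
qed

text \<open>A lift to \<open>Y\<close> of an element coming from \<open>X\<^sub>n\<close> may be
  replaced by its n-th coordinate: its image under \<open>\<tau>\<close> stays the same and its norm
  does not grow. This supplies the liftings of the unit ball that \<open>l1_lifting\<close> asks
  for.\<close>

lemma coord_lifting:
  fixes L :: "'i set"
  assumes \<kappa>: "\<kappa> > 1" and iso: "isometric_iso (coord_space X n) (l1space L)"
  shows "\<exists>\<psi>. bounded_linear_map (coord_space X n) (coord_space Y n) \<psi> \<and>
    (\<forall>x\<in>mcarr (coord_space X n). \<tau> (\<psi> x) = \<phi> x \<and> mnorm Y (\<psi> x) \<le> \<kappa> * M n * mnorm X x)"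
proof -
  have \<phi>': "bounded_linear_map (coord_space X n) Z \<phi>"
    using \<phi> coord_space_subset \<Phi>(2) unfolding morphism_def bounded_linear_map_def X.coord_space_simps by blast
  have "mcarr (coord_space Y n) \<subseteq> mcarr Y" by (auto simp: Y.coord_space_mem)
  then have \<tau>': "bounded_linear_map (coord_space Y n) Z \<tau>"
    using \<tau> unfolding morphism_def bounded_linear_map_def Y.coord_space_simps by blast
  have "\<exists>y\<in>mcarr (coord_space Y n). \<tau> y = \<phi> x \<and> mnorm (coord_space Y n) y \<le> \<kappa> * M n"
    if x: "x \<in> mcarr (coord_space X n)" "mnorm (coord_space X n) x \<le> 1" for x
  proof -
    have xX: "x \<in> mcarr X" "X.coord n x = x" using x(1) by (simp_all add: X.coord_space_mem)
    have le: "mnorm Z (\<phi> x) \<le> M n" using M_upper[OF x(1)] x(2) by simp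
    have co: "Z.coord n (\<phi> x) = \<phi> x" using \<phi>_coord[OF xX(1), of n] xX(2) by simp
    show ?thesis
    proof (cases "M n = 0")
      case True
      then have "\<phi> x = mzero Z"
        using le by (intro Z.mnorm_le_0[OF \<phi>_mem[OF xX(1)]]) simp
      moreover have "\<tau> (mzero Y) = mzero Z"
        using \<tau>_norm[OF Y.mzero_mem] Y.mnorm_mzero
        by (intro Z.mnorm_le_0[OF \<tau>_mem[OF Y.mzero_mem]]) simp
      ultimately show ?thesis using True
        by (intro bexI[of _ "mzero Y"])
          (simp_all add: Y.coord_space_mem Y.coord_zero Y.mzero_mem Y.mnorm_mzero)
    next
      case False
      \<comment> \<open>The additive slack of a coisometry is made proportional to
        \<open>M n\<close>, which turns the bound into the factor \<open>\<kappa>\<close>. It is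
        positive only for nonzero \<open>M n\<close>, whence the case distinction.\<close>
      then have pos: "(\<kappa> - 1) * M n > 0" using M_nonneg[of n] \<kappa> by simp
      obtain y where y: "y \<in> mcarr Y" "\<tau> y = \<phi> x" "mnorm Y y < mnorm Z (\<phi> x) + (\<kappa> - 1) * M n"
        by (rule \<tau>_lift[OF \<phi>_mem[OF xX(1)] pos])
      have "mnorm Y (Y.coord n y) \<le> \<kappa> * M n"
        using Y.coord_norm[OF y(1), of n] y(3) le by (simp add: algebra_simps)
      moreover have "\<tau> (Y.coord n y) = \<phi> x" using \<tau>_coord[OF y(1), of n] y(2) co by simp
      ultimately show ?thesis using Y.coord_in_coord_space[OF y(1)] by (intro bexI[of _ "Y.coord n y"]) auto
    qed
  qed
  from l1_lifting[OF banach_cnormed[OF X.coord_space_banach] iso Y.coord_space_banach Z.cnormed \<tau>' \<phi>' this]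
  show ?thesis by simp
qed

context
  fixes \<psi> :: "nat \<Rightarrow> 'v \<Rightarrow> 'u" and \<kappa> :: real
  assumes \<kappa>: "\<kappa> > 1"
    and \<psi>: "\<And>n. bounded_linear_map (coord_space X n) (coord_space Y n) (\<psi> n)"
    and \<tau>\<psi>: "\<And>n x. x \<in> mcarr (coord_space X n) \<Longrightarrow> \<tau> (\<psi> n x) = \<phi> x"
    and \<psi>_norm: "\<And>n x. x \<in> mcarr (coord_space X n) \<Longrightarrow> mnorm Y (\<psi> n x) \<le> \<kappa> * M n * mnorm X x"
begin

lemma \<psi>_mem: "x \<in> mcarr X \<Longrightarrow> \<psi> n (X.coord n x) \<in> mcarr Y"
  and \<psi>_coord: "x \<in> mcarr X \<Longrightarrow> Y.coord n (\<psi> n (X.coord n x)) = \<psi> n (X.coord n x)"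
  using bounded_linear_mapD(1)[OF \<psi> X.coord_in_coord_space] by (simp_all add: Y.coord_space_mem)

lemma \<psi>_add: "x \<in> mcarr X \<Longrightarrow> y \<in> mcarr X \<Longrightarrow>
    \<psi> n (madd X (X.coord n x) (X.coord n y)) = madd Y (\<psi> n (X.coord n x)) (\<psi> n (X.coord n y))"
  using bounded_linear_mapD(2)[OF \<psi>[of n] X.coord_in_coord_space[of x n] X.coord_in_coord_space[of y n]] by simp

lemma \<psi>_smul: "x \<in> mcarr X \<Longrightarrow> \<psi> n (msmul X c (X.coord n x)) = msmul Y c (\<psi> n (X.coord n x))"
  using bounded_linear_mapD(3)[OF \<psi>[of n] X.coord_in_coord_space[of x n], of c] by simp

lemma \<psi>_zero: "\<psi> n (mzero X) = mzero Y"
  using \<psi>_smul[OF X.mzero_mem, of n 0] \<psi>_mem[OF X.mzero_mem, of n]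
  by (simp add: X.coord_zero X.msmul_mzero Y.msmul_0)

text \<open>Norms in \<open>X\<close> and \<open>Y\<close> cannot be compared coordinatewise directly; the comparison goes through
  \<open>Z\<close>, replacing the coordinates of \<open>x\<close> by ones of the same size on which \<open>\<phi>\<close> almost attains its norm.\<close>
lemma finite_support_lift_norm:
  assumes x: "x \<in> mcarr X" and I: "finite I" "\<And>n. n \<notin> I \<Longrightarrow> X.coord n x = mzero X"
    and y: "y \<in> mcarr Y" "\<And>n. Y.coord n y = \<psi> n (X.coord n x)"
  shows "mnorm Y y \<le> \<kappa>\<^sup>2 * \<Phi> * mnorm X x"
proof (rule field_le_epsilon)
  fix e :: real assume e: "e > 0"
  have \<kappa>0: "\<kappa>\<^sup>2 > 0" using \<kappa> by simp
  have "\<exists>x'\<in>mcarr (coord_space X n). mnorm X x' \<le> mnorm X (X.coord n x) \<and>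
      M n * mnorm X (X.coord n x) \<le> \<kappa> * mnorm Z (\<phi> x')" for n
    by (rule M_almost_attained[OF \<kappa> X.mnorm_nonneg[OF X.coord_mem[OF x]]])
  then obtain w where w: "\<And>n. w n \<in> mcarr (coord_space X n)" "\<And>n. mnorm X (w n) \<le> mnorm X (X.coord n x)"
    "\<And>n. M n * mnorm X (X.coord n x) \<le> \<kappa> * mnorm Z (\<phi> (w n))"
    by metis
  obtain x' where x': "x' \<in> mcarr X" "\<And>n. X.coord n x' = (if n \<in> I then w n else mzero X)"
    using X.coord_synthesis[OF I(1), of w] w(1) by (auto simp: X.coord_space_mem)
  have "mnorm X x' \<le> mnorm X x"
    by (rule X.homogeneousD[OF x'(1) x])
      (auto simp: x'(2) w(2) X.mnorm_mzero X.mnorm_nonneg X.coord_mem x)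
  then have "\<Phi> * mnorm X x' \<le> \<Phi> * mnorm X x" using \<Phi>(1) by (rule mult_left_mono)
  then have z': "mnorm Z (\<phi> x') \<le> \<Phi> * mnorm X x" using \<Phi>(2)[OF x'(1)] by linarith
  have "e / \<kappa>\<^sup>2 > 0" using e \<kappa>0 by simp
  then obtain y' where y': "y' \<in> mcarr Y" "\<tau> y' = \<phi> x'" "mnorm Y y' < mnorm Z (\<phi> x') + e / \<kappa>\<^sup>2"
    by (rule \<tau>_lift[OF \<phi>_mem[OF x'(1)]])
  \<comment> \<open>One factor \<open>\<kappa>\<close> pays for the coordinate liftings, the other
    for the near attainment of \<open>M n\<close>; the slack for \<open>y'\<close> was divided by
    \<open>\<kappa>\<^sup>2\<close> in advance.\<close>
  let ?y = "msmul Y (complex_of_real (\<kappa>\<^sup>2)) y'"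
  have ny: "mnorm Y (msmul Y (complex_of_real (\<kappa>\<^sup>2)) v) = \<kappa>\<^sup>2 * mnorm Y v" if "v \<in> mcarr Y" for v
    unfolding Y.mnorm_msmul[OF that] norm_of_real using \<kappa>0 by simp
  have "mnorm Y y \<le> mnorm Y ?y"
  proof (rule Y.homogeneousD[OF y(1) Y.msmul_mem[OF y'(1)]])
    fix n
    show "mnorm Y (Y.coord n y) \<le> mnorm Y (Y.coord n ?y)"
    proof (cases "n \<in> I")
      case True
      have "mnorm Y (Y.coord n y) \<le> \<kappa> * (M n * mnorm X (X.coord n x))"
        using \<psi>_norm[OF X.coord_in_coord_space[OF x]] by (simp add: y(2) mult.assoc)
      also have "\<dots> \<le> \<kappa> * (\<kappa> * mnorm Z (\<phi> (w n)))" using w(3) \<kappa> by (intro mult_left_mono) auto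
      also have "\<dots> = \<kappa>\<^sup>2 * mnorm Z (\<phi> (w n))" by (simp add: power2_eq_square)
      also have "\<phi> (w n) = \<tau> (Y.coord n y')"
        using \<phi>_coord[OF x'(1), of n] \<tau>_coord[OF y'(1), of n] y'(2) x'(2)[of n] True by simp
      also have "\<kappa>\<^sup>2 * mnorm Z (\<tau> (Y.coord n y')) \<le> \<kappa>\<^sup>2 * mnorm Y (Y.coord n y')"
        using \<tau>_norm[OF Y.coord_mem[OF y'(1)]] by (intro mult_left_mono) auto
      also have "\<dots> = mnorm Y (Y.coord n ?y)"
        using ny[OF Y.coord_mem[OF y'(1)]] Y.coord_smul[OF y'(1)] by simp
      finally show ?thesis .
    next
      case False
      then have "Y.coord n y = mzero Y" by (simp add: y(2) I(2) \<psi>_zero)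
      then show ?thesis
        using Y.mnorm_nonneg[OF Y.coord_mem[OF Y.msmul_mem[OF y'(1)]]]
        by (simp add: Y.mnorm_mzero)
    qed
  qed
  also have "\<dots> = \<kappa>\<^sup>2 * mnorm Y y'" by (rule ny[OF y'(1)])
  also have "\<dots> \<le> \<kappa>\<^sup>2 * (\<Phi> * mnorm X x + e / \<kappa>\<^sup>2)" using y'(3) z' by (intro mult_left_mono) auto
  also have "\<dots> = \<kappa>\<^sup>2 * \<Phi> * mnorm X x + e" using \<kappa>0 by (simp add: algebra_simps)
  finally show "mnorm Y y \<le> \<kappa>\<^sup>2 * \<Phi> * mnorm X x + e" .
qed

text \<open>The elements \<open>s N\<close> lift the truncations of \<open>x\<close>. Differences of
  them lift differences of truncations, so \<open>finite_support_lift_norm\<close> transfers the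
  Cauchy property from \<open>X\<close> to \<open>Y\<close>. Coordinates are continuous, so those of
  the limit are the prescribed ones.\<close>

lemma ex_glued:
  assumes x: "x \<in> mcarr X"
  shows "\<exists>y\<in>mcarr Y. (\<forall>n. Y.coord n y = \<psi> n (X.coord n x)) \<and> mnorm Y y \<le> \<kappa>\<^sup>2 * \<Phi> * mnorm X x"
proof -
  define K where "K = \<kappa>\<^sup>2 * \<Phi>"
  have K: "K \<ge> 0" using \<Phi>(1) by (simp add: K_def)
  note tx = X.trunc[OF x]
  have "\<exists>y\<in>mcarr Y. \<forall>n. Y.coord n y = (if n \<in> {..<N} then \<psi> n (X.coord n x) else mzero Y)" for N
    by (rule Y.coord_synthesis) (simp_all add: \<psi>_mem \<psi>_coord x)
  then obtain s where s: "\<And>N. s N \<in> mcarr Y"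
    "\<And>N n. Y.coord n (s N) = (if n < N then \<psi> n (X.coord n x) else mzero Y)"
    by (metis lessThan_iff)
  have s': "Y.coord n (s N) = \<psi> n (X.coord n (X.trunc N x))" for N n
    by (simp add: s(2) tx(2) \<psi>_zero)
  have s_norm: "mnorm Y (s N) \<le> K * mnorm X (X.trunc N x)" for N
    unfolding K_def by (rule finite_support_lift_norm[of _ "{..<N}"]) (simp_all add: tx s(1) s')
  have diff: "mnorm Y (msub Y (s m) (s k)) \<le> K * mnorm X (msub X (X.trunc m x) (X.trunc k x))" for m k
    unfolding K_def
  proof (rule finite_support_lift_norm[of _ "{..<max m k}"])
    show "msub X (X.trunc m x) (X.trunc k x) \<in> mcarr X" by (rule X.msub_mem[OF tx(1) tx(1)])
    show "msub Y (s m) (s k) \<in> mcarr Y" by (rule Y.msub_mem[OF s(1) s(1)])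
    show "X.coord n (msub X (X.trunc m x) (X.trunc k x)) = mzero X" if "n \<notin> {..<max m k}" for n
      using that by (simp add: X.coord_sub tx X.sub_self X.mzero_mem less_max_iff_disj)
    show "Y.coord n (msub Y (s m) (s k)) = \<psi> n (X.coord n (msub X (X.trunc m x) (X.trunc k x)))" for n
    proof -
      have neg: "\<psi> n (msmul X (-1) (X.coord n (X.trunc k x))) = msmul Y (-1) (\<psi> n (X.coord n (X.trunc k x)))"
        by (rule \<psi>_smul[OF tx(1)])
      have "\<psi> n (madd X (X.coord n (X.trunc m x)) (X.coord n (msmul X (-1) (X.trunc k x))))
          = madd Y (\<psi> n (X.coord n (X.trunc m x))) (\<psi> n (X.coord n (msmul X (-1) (X.trunc k x))))"
        by (rule \<psi>_add[OF tx(1) X.msmul_mem[OF tx(1)]])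
      then show ?thesis
        unfolding Y.coord_sub[OF s(1) s(1)] X.coord_sub[OF tx(1) tx(1)] s'
        by (simp only: msub_def X.coord_smul[OF tx(1)] neg)
    qed
  qed simp
  have "\<forall>e>0. \<exists>N. \<forall>m\<ge>N. \<forall>k\<ge>N. mnorm Y (msub Y (s m) (s k)) < e"
  proof (intro allI impI)
    fix e :: real assume "e > 0"
    then have "e / (K + 1) / 2 > 0" using K by simp
    then obtain N where N: "\<And>k. k \<ge> N \<Longrightarrow> mnorm X (msub X x (X.trunc k x)) < e / (K + 1) / 2"
      using X.trunc_limit[OF x] by blast
    have "mnorm Y (msub Y (s m) (s k)) < e" if "m \<ge> N" "k \<ge> N" for m k
    proof -
      have "mnorm X (msub X (X.trunc m x) (X.trunc k x)) \<le> mnorm X (msub X x (X.trunc m x)) + mnorm X (msub X x (X.trunc k x))"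
        using cnormed_sub_triangle[OF X.cnormed tx(1) x tx(1), of m k]
          cnormed_norm_sub_commute[OF X.cnormed tx(1) x, of m] by simp
      also have "\<dots> \<le> e / (K + 1) / 2 + e / (K + 1) / 2" using N that by (intro add_mono less_imp_le) auto
      also have "\<dots> = e / (K + 1)" by (rule field_sum_of_halves)
      finally have "K * mnorm X (msub X (X.trunc m x) (X.trunc k x)) \<le> K * (e / (K + 1))"
        using K by (rule mult_left_mono)
      also have "\<dots> < e" using K \<open>e > 0\<close> by (simp add: pos_divide_less_eq algebra_simps)
      finally show ?thesis using diff[of m k] by linarith
    qed
    then show "\<exists>N. \<forall>m\<ge>N. \<forall>k\<ge>N. mnorm Y (msub Y (s m) (s k)) < e" by blast
  qed
  then obtain y where y: "y \<in> mcarr Y" and lim: "\<And>e. e > 0 \<Longrightarrow> \<exists>N. \<forall>k\<ge>N. mnorm Y (msub Y (s k) y) < e"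
    using Y.complete[unfolded mod_complete_def, rule_format, of s] s(1) by blast
  have "Y.coord n y = \<psi> n (X.coord n x)" for n
  proof -
    let ?p = "\<psi> n (X.coord n x)"
    have p: "?p \<in> mcarr Y" by (rule \<psi>_mem[OF x])
    have "mnorm Y (msub Y ?p (Y.coord n y)) \<le> 0 + e" if e: "e > 0" for e
    proof -
      obtain N where N: "\<And>k. k \<ge> N \<Longrightarrow> mnorm Y (msub Y (s k) y) < e" using lim[OF e] by blast
      \<comment> \<open>From index \<open>Suc n\<close> on, the n-th coordinate of
        \<open>s k\<close> has its final value.\<close>
      define k where "k = max N (Suc n)"
      have "msub Y ?p (Y.coord n y) = Y.coord n (msub Y (s k) y)"
        by (simp add: Y.coord_sub s y k_def less_max_iff_disj)
      then show ?thesis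
        using Y.coord_norm[OF Y.msub_mem[OF s(1) y], of n k] N[of k] by (simp add: k_def)
    qed
    then have "mnorm Y (msub Y ?p (Y.coord n y)) \<le> 0" by (rule field_le_epsilon)
    then have "msub Y ?p (Y.coord n y) = mzero Y"
      by (rule Y.mnorm_le_0[OF Y.msub_mem[OF p Y.coord_mem[OF y]]])
    then show ?thesis by (rule sym[OF cnormed_sub_eq_zero[OF Y.cnormed p Y.coord_mem[OF y]]])
  qed
  moreover have "mnorm Y y \<le> K * mnorm X x"
  proof (rule field_le_epsilon)
    fix e :: real assume "e > 0"
    then obtain k where k: "mnorm Y (msub Y (s k) y) < e" using lim by blast
    have "mnorm X (X.trunc k x) \<le> mnorm X x"
      by (rule X.homogeneousD[OF tx(1) x])
        (simp add: tx(2) X.mnorm_mzero X.mnorm_nonneg X.coord_mem x)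
    then have "K * mnorm X (X.trunc k x) \<le> K * mnorm X x" using K by (rule mult_left_mono)
    then show "mnorm Y y \<le> K * mnorm X x + e"
      using cnormed_norm_le_sub[OF Y.cnormed y s(1), of k] cnormed_norm_sub_commute[OF Y.cnormed y s(1), of k]
        s_norm[of k] k by linarith
  qed
  ultimately show ?thesis using y unfolding K_def by blast
qed

text \<open>Elements of \<open>Y\<close> and \<open>Z\<close> are determined by their coordinates,
  so linearity, compatibility with the action and the lifting identity all reduce to the maps
  \<open>\<psi> n\<close>.\<close>

lemma glued_lifting:
  "\<exists>\<Psi>. morphism A X Y \<Psi> \<and> (\<forall>x\<in>mcarr X. \<tau> (\<Psi> x) = \<phi> x) \<and> opnorm X Y \<Psi> \<le> \<kappa>\<^sup>2 * \<Phi>"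
proof -
  obtain \<Psi> where \<Psi>: "\<And>x. x \<in> mcarr X \<Longrightarrow> \<Psi> x \<in> mcarr Y"
    "\<And>x n. x \<in> mcarr X \<Longrightarrow> Y.coord n (\<Psi> x) = \<psi> n (X.coord n x)"
    "\<And>x. x \<in> mcarr X \<Longrightarrow> mnorm Y (\<Psi> x) \<le> \<kappa>\<^sup>2 * \<Phi> * mnorm X x"
    using ex_glued by metis
  have "morphism A X Y \<Psi>"
    unfolding morphism_def
  proof (intro conjI ballI allI)
    fix x assume x: "x \<in> mcarr X"
    show "\<Psi> x \<in> mcarr Y" by (rule \<Psi>(1)[OF x])
    show "\<Psi> (madd X x y) = madd Y (\<Psi> x) (\<Psi> y)" if y: "y \<in> mcarr X" for y
      by (rule Y.coord_eqI)
        (simp_all add: \<Psi> x y X.madd_mem Y.madd_mem Y.coord_add X.coord_add \<psi>_add)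
    show "\<Psi> (msmul X c x) = msmul Y c (\<Psi> x)" for c
      by (rule Y.coord_eqI)
        (simp_all add: \<Psi> x X.msmul_mem Y.msmul_mem Y.coord_smul X.coord_smul \<psi>_smul)
    show "\<Psi> (mact X a x) = mact Y a (\<Psi> x)" if a: "a \<in> A" for a
      by (rule Y.coord_eqI) (simp_all add: \<Psi> x a X.act_mem Y.act_mem Y.coord_act X.coord_act \<psi>_smul)
  next
    show "\<exists>C. \<forall>x\<in>mcarr X. mnorm Y (\<Psi> x) \<le> C * mnorm X x" using \<Psi>(3) by blast
  qed
  moreover have "\<tau> (\<Psi> x) = \<phi> x" if x: "x \<in> mcarr X" for x
  proof (rule Z.coord_eqI[OF \<tau>_mem[OF \<Psi>(1)[OF x]] \<phi>_mem[OF x]])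
    fix n
    show "Z.coord n (\<tau> (\<Psi> x)) = Z.coord n (\<phi> x)"
      using \<tau>_coord[OF \<Psi>(1)[OF x], of n] \<tau>\<psi>[OF X.coord_in_coord_space[OF x], of n] \<phi>_coord[OF x, of n]
      by (simp add: \<Psi>(2)[OF x])
  qed
  moreover have "opnorm X Y \<Psi> \<le> \<kappa>\<^sup>2 * \<Phi>" by (rule opnorm_le[OF _ \<Psi>(3)]) (simp add: \<Phi>(1))
  ultimately show ?thesis by blast
qed

end

end

theorem (in hbar_module) projective_of_coord_space_l1:
  assumes iso: "\<And>n. \<exists>L :: 'i set. isometric_iso (coord_space X n) (l1space L)"
  shows "ext_proj_wrt A (Hbar A nA :: 'u nmod set) X"
  unfolding ext_proj_wrt_def
proof (intro ballI allI impI)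
  fix Z Y :: "'u nmod" and \<tau> \<phi> and e :: real
  assume "Z \<in> Hbar A nA" "Y \<in> Hbar A nA" and e: "e > 0" and "coisometric A Y Z \<tau>" "morphism A X Z \<phi>"
  then interpret hbar_lifting_problem A nA X Y Z \<tau> \<phi>
    by unfold_locales
  \<comment> \<open>For \<open>\<delta> \<le> 1\<close> the number
    \<open>\<kappa>\<^sup>2 - 1\<close> is at most \<open>3 * \<delta>\<close>, so the excess over
    \<open>\<Phi>\<close> stays below \<open>e\<close>; the 1 in the denominator covers
    \<open>\<Phi> = 0\<close>.\<close>
  define \<delta> where "\<delta> = min 1 (e / (4 * (\<Phi> + 1)))"
  define \<kappa> where "\<kappa> = 1 + \<delta>"
  have \<delta>: "0 < \<delta>" "\<delta> \<le> 1" "\<delta> \<le> e / (4 * (\<Phi> + 1))" using e \<Phi>(1) by (auto simp: \<delta>_def)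
  have \<kappa>: "\<kappa> > 1" using \<delta> by (simp add: \<kappa>_def)
  have "\<kappa>\<^sup>2 * \<Phi> < \<Phi> + e"
  proof -
    have "\<delta> * (4 * (\<Phi> + 1)) \<le> e" using \<delta>(3) \<Phi>(1) by (simp add: pos_le_divide_eq)
    then have "4 * (\<delta> * \<Phi>) + 4 * \<delta> \<le> e" by (simp add: algebra_simps)
    moreover have nonneg: "0 \<le> \<delta> * \<Phi>" using \<delta> \<Phi>(1) by simp
    moreover have "\<delta> * (\<delta> * \<Phi>) \<le> 1 * (\<delta> * \<Phi>)" using \<delta>(2) nonneg by (rule mult_right_mono)
    moreover have "\<kappa>\<^sup>2 * \<Phi> = \<Phi> + 2 * (\<delta> * \<Phi>) + \<delta> * (\<delta> * \<Phi>)"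
      by (simp add: \<kappa>_def power2_eq_square algebra_simps)
    ultimately show ?thesis using \<delta>(1) by linarith
  qed
  have "\<exists>\<psi>. bounded_linear_map (coord_space X n) (coord_space Y n) \<psi> \<and>
    (\<forall>x\<in>mcarr (coord_space X n). \<tau> (\<psi> x) = \<phi> x \<and> mnorm Y (\<psi> x) \<le> \<kappa> * M n * mnorm X x)" for n
    using iso[of n] coord_lifting[OF \<kappa>] by blast
  then obtain \<psi> where \<psi>: "\<And>n. bounded_linear_map (coord_space X n) (coord_space Y n) (\<psi> n)"
    "\<And>n x. x \<in> mcarr (coord_space X n) \<Longrightarrow> \<tau> (\<psi> n x) = \<phi> x"
    "\<And>n x. x \<in> mcarr (coord_space X n) \<Longrightarrow> mnorm Y (\<psi> n x) \<le> \<kappa> * M n * mnorm X x"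
    by metis
  show "\<exists>\<psi>. morphism A X Y \<psi> \<and> (\<forall>x\<in>mcarr X. \<tau> (\<psi> x) = \<phi> x) \<and> opnorm X Y \<psi> < \<Phi> + e"
    using glued_lifting[OF \<kappa> \<psi>] \<open>\<kappa>\<^sup>2 * \<Phi> < \<Phi> + e\<close> by (meson le_less_trans)
qed

text \<open>Projectivity is tested on modules carried by one type \<open>'u\<close>. The injection
  provides room in \<open>'u\<close> for \<open>X\<^sub>n\<close> and for l1 over its unit sphere,
  whose elements are complex functions on \<open>'x\<close>; these are the two modules in the
  lifting problem that yields the factorization.\<close>

theorem mainTheorem2:
  fixes A :: "(nat \<Rightarrow> complex) set" and nA :: "(nat \<Rightarrow> complex) \<Rightarrow> real"
    and X :: "'x nmod"
  assumes "seq_algebra A nA"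
    and "X \<in> Hbar A nA"
    and "\<exists>f :: (('x \<Rightarrow> complex) \<Rightarrow> complex) \<Rightarrow> 'u. inj f"
  shows "ext_proj_wrt A (Hbar A nA :: 'u nmod set) X \<longleftrightarrow>
         (\<forall>n. \<exists>L :: 'x set. isometric_iso (coord_space X n) (l1space L))"
proof -
  interpret hbar_module A nA X using assms by unfold_locales
  obtain f :: "(('x \<Rightarrow> complex) \<Rightarrow> complex) \<Rightarrow> 'u" where f: "inj f" using assms(3) by blast
  \<comment> \<open>\<open>l1_unit\<close> embeds any type into the complex functions on it, which
    turns \<open>f\<close> into injections of both \<open>'x \<Rightarrow> complex\<close> and
    \<open>'x\<close>.\<close>
  have l1_unit: "inj (l1_unit :: 'i \<Rightarrow> _)"
    by (rule injI) (metis l1_unit_def zero_neq_one)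
  have j2: "inj (\<lambda>c :: 'x \<Rightarrow> complex. f (l1_unit c))"
    using inj_compose[OF f l1_unit] by (simp add: comp_def)
  have j1: "inj (\<lambda>x :: 'x. f (l1_unit (l1_unit x)))"
    using inj_compose[OF j2 l1_unit] by (simp add: comp_def)
  show ?thesis
    using coord_space_l1_of_projective[OF _ j1 j2] projective_of_coord_space_l1 by blast
qed

end
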